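(* Let $K\subset\mathbb{R}^n$ be a convex body with boundary of class $C^2$ and everywhere positive Gauss curvature, with $0\in\mathrm{Int}(K)$. Then, for any real $p\ne 0,-n$, letting $\mathrm{SGN}_p:=\mathrm{sgn}\big(\frac{p}{n+p}\big)$, $$\mathrm{SGN}_p\,\frac{\Omega_p(K)}{\Omega_{-\frac{np}{n+2p}}(K^\circ)}\ \le\ \mathrm{SGN}_p\,\frac{\mathrm{Vol}(K)}{\mathrm{Vol}(K^\circ)}\ \le\ \mathrm{SGN}_p\,\frac{\Omega_{-\frac{np}{n+2p}}(K)}{\Omega_p(K^\circ)},$$ with equalities if and only if $K$ is an ellipsoid centered at the origin.
   Context: Here $n\ge2$ and $K^\circ=\{y\in\mathbb{R}^n:x\cdot y\le1\ \forall x\in K\}$ is the polar body. For a convex body $L$ with $C^2$ boundary, positive Gauss curvature and $0\in\mathrm{Int}(L)$, let $h_L(u)=\max_{x\in L}x\cdot u$ be its support function on $\mathbb{S}^{n-1}$, $\mathcal{K}(u)$ the Gauss curvature of $\partial L$ at the point with outer unit normal $u$, and $\mathcal{K}_0(u)=\mathcal{K}(u)/h_L(u)^{n+1}$ the centro-affine curvature. The cone measure $d\mu_{cL}$ on $\partial L$ is $x\mapsto h_L(\nu(x))\,d\mu_L(x)$, with $\mu_L$ the surface area measure and $\nu$ the outer normal; parametrized by the normal it is $\frac{h_L(u)}{\mathcal{K}(u)}\,d\mu_{\mathbb{S}^{n-1}}(u)$. For real $q\neq -n$ the $q$-affine surface area is $$\Omega_q(L)=\int_{\partial L}\mathcal{K}_0^{\frac{q}{n+q}}\,d\mu_{cL},$$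 and $\Omega_{\pm\infty}(L)=n\,\mathrm{Vol}(L^\circ)$ (this convention is used for $-\frac{np}{n+2p}$ when $p=-n/2$). *)

theory Defs
  imports "HOL-Analysis.Analysis"
begin

definition convex_body :: "(real^'n) set \<Rightarrow> bool" where
  "convex_body L \<longleftrightarrow> convex L \<and> compact L \<and> interior L \<noteq> {}"

definition polar_body :: "(real^'n) set \<Rightarrow> (real^'n) set" where
  "polar_body L = {y. \<forall>x\<in>L. x \<bullet> y \<le> 1}"

definition centered_ellipsoid :: "(real^'n) set \<Rightarrow> bool" where
  "centered_ellipsoid E \<longleftrightarrow>
     (\<exists>A :: real^'n^'n. invertible A \<and> E = (\<lambda>x. A *v x) ` cball 0 1)"

text \<open>For compact nonempty L the supremum is attained.\<close>

definition support_function :: "(real^'n) set \<Rightarrow> real^'n \<Rightarrow> real" where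
  "support_function L u = (SUP x\<in>L. x \<bullet> u)"

definition C2_on :: "(real^'n) set \<Rightarrow> (real^'n \<Rightarrow> real) \<Rightarrow> bool" where
  "C2_on U G \<longleftrightarrow>
     (\<exists>(g :: real^'n \<Rightarrow> real^'n) (H :: real^'n \<Rightarrow> ((real^'n) \<Rightarrow>\<^sub>L (real^'n))).
        (\<forall>y\<in>U. (G has_derivative (\<lambda>v. g y \<bullet> v)) (at y) \<and>
               (g has_derivative blinfun_apply (H y)) (at y)) \<and>
        continuous_on U H)"

definition C2_boundary :: "(real^'n) set \<Rightarrow> bool" where
  "C2_boundary L \<longleftrightarrow>
     (\<forall>x\<in>frontier L. \<exists>U G. open U \<and> x \<in> U \<and> C2_on U G \<and>
        \<not> (G has_derivative (\<lambda>v. 0)) (at x) \<and> L \<inter> U = {y\<in>U. G y \<le> 0})"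

text \<open>The outer unit normal (Gauss map), meaningful at boundary points of a convex body
  that has a unique supporting hyperplane there.\<close>

definition outer_normal :: "(real^'n) set \<Rightarrow> real^'n \<Rightarrow> real^'n" where
  "outer_normal L x = (THE u. norm u = 1 \<and> (\<forall>y\<in>L. y \<bullet> u \<le> x \<bullet> u))"

text \<open>The Gauss curvature at a boundary point is the determinant of the differential of the
  Gauss map on the tangent hyperplane. A derivative D of the Gauss map within the boundary is
  determined only on the tangent hyperplane, which it maps to itself; the matrix below is that
  of D on the tangent hyperplane extended by the identity on the normal line, so its determinant
  is the one of the restriction and does not depend on the choice of D.\<close>

definition gauss_curvature :: "(real^'n) set \<Rightarrow> real^'n \<Rightarrow> real" where
  "gauss_curvature L x =
     (let \<nu> = outer_normal L x;
          D = (SOME D. (outer_normal L has_derivative D) (at x within frontier L))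
      in det (matrix (\<lambda>v. D (v - (v \<bullet> \<nu>) *\<^sub>R \<nu>) + (v \<bullet> \<nu>) *\<^sub>R \<nu>)))"

definition gauss_curvature_at_normal :: "(real^'n) set \<Rightarrow> real^'n \<Rightarrow> real" where
  "gauss_curvature_at_normal L u =
     gauss_curvature L (THE x. x \<in> frontier L \<and> outer_normal L x = u)"

definition centro_affine_curvature :: "(real^'n) set \<Rightarrow> real^'n \<Rightarrow> real" where
  "centro_affine_curvature L u =
     gauss_curvature_at_normal L u / support_function L u ^ (CARD('n) + 1)"

text \<open>The d-dimensional Hausdorff outer measure without normalising constant.\<close>

definition hausdorff_outer :: "nat \<Rightarrow> 'a::metric_space set \<Rightarrow> ennreal" where
  "hausdorff_outer d A =
     (SUP \<delta>\<in>{0::real<..}.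
        INF C\<in>{C :: nat \<Rightarrow> 'a set. A \<subseteq> (\<Union>i. C i) \<and> (\<forall>i. bounded (C i) \<and> diameter (C i) \<le> \<delta>)}.
          \<Sum>i. ennreal (diameter (C i) ^ d))"

text \<open>A unit cube of dimension n - 1 in a coordinate hyperplane. By invariance under isometries
  the choice of the hyperplane does not affect its Hausdorff measure.\<close>

definition unit_face :: "(real^'n) set" where
  "unit_face = cbox 0 (\<chi> i. if i = (SOME k. True) then 0 else 1)"

text \<open>Surface area: the (n - 1)-dimensional Hausdorff measure, normalised so that the
  (n - 1)-dimensional unit cube has measure 1, that is, so that it is Lebesgue measure on
  hyperplanes. Hausdorff outer measure is a metric outer measure, hence countably additive on
  the Borel sets, so \<^term>\<open>measure_of\<close> does not fall back to the zero measure.\<close>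

definition area_measure :: "(real^'n) measure" where
  "area_measure = measure_of UNIV (sets borel)
     (\<lambda>A. hausdorff_outer (CARD('n) - 1) A /
          hausdorff_outer (CARD('n) - 1) (unit_face :: (real^'n) set))"

definition surface_measure :: "(real^'n) set \<Rightarrow> (real^'n) measure" where
  "surface_measure L = restrict_space area_measure (frontier L)"

definition cone_measure :: "(real^'n) set \<Rightarrow> (real^'n) measure" where
  "cone_measure L =
     density (surface_measure L) (\<lambda>x. ennreal (support_function L (outer_normal L x)))"

definition affine_surface_area :: "ereal \<Rightarrow> (real^'n) set \<Rightarrow> real" where
  "affine_surface_area q L =
     (if \<bar>q\<bar> = \<infinity> then real CARD('n) * measure lebesgue (polar_body L)
      else (LINT x|cone_measure L.
              centro_affine_curvature L (outer_normal L x)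
                powr (real_of_ereal q / (real CARD('n) + real_of_ereal q))))"

text \<open>The index -np/(n+2p), read as infinite when the denominator vanishes. The sign of
  infinity is immaterial in the definition above.\<close>

definition companion_index :: "real \<Rightarrow> real \<Rightarrow> ereal" where
  "companion_index n p = (if n + 2 * p = 0 then \<infinity> else ereal (- (n * p) / (n + 2 * p)))"

end

theory Submission
  imports Defs
begin

text \<open>For a body \<open>K\<close> as in the theorem let \<open>\<rho>\<close> be its gauge, \<open>T\<close> the gradient of \<open>\<rho>\<^sup>2 / 2\<close>, a positively
  homogeneous map of degree one on the punctured space, and \<open>f\<close> the determinant of the derivative of \<open>T\<close>,
  which is constant along rays. At a boundary point \<open>x\<close> the vector \<open>T x\<close> is the point of the polar
  body dual to \<open>x\<close>; hence the normal is \<open>T x / |T x|\<close>, the support function is \<open>1 / |T x|\<close>, and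
  \<open>f x\<close> is the centro-affine curvature (\<open>centro_affine_curvature_eq\<close>). The cone measure of a part
  of the boundary is \<open>n\<close> times the volume of the cone over it (\<open>nn_integral_cone_measure\<close>), so
  \<open>\<Omega>\<^sub>q(K)\<close> is \<open>n\<close> times the integral of \<open>f powr (q / (n + q))\<close> over \<open>K\<close>
  (\<open>affine_surface_area_eq_integral\<close>). The gradient map of the polar body is the inverse of \<open>T\<close>, and the
  substitution \<open>w = T y\<close> turns an integral of the \<open>s\<close>-th power of the curvature of the polar body into
  the integral of \<open>f powr (1 - s)\<close> over \<open>K\<close> (\<open>integral_polar_curv_powr\<close>).

  Put \<open>a = p / (n + p)\<close> and let \<open>I(s)\<close> be the integral of \<open>f powr s\<close> over \<open>K\<close>. The index
  \<open>-np / (n + 2p)\<close> has exponent \<open>-a\<close>. Up to the common factor \<open>n\<close> the four affine surface areas are thus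
  \<open>I(a)\<close>, \<open>I(1 - a)\<close>, \<open>I(-a)\<close> and \<open>I(1 + a)\<close>, and the two volumes are \<open>I(0)\<close> and \<open>I(1)\<close>
  (\<open>affine_surface_areas\<close>). The left inequality compares \<open>I(a) I(1)\<close> with \<open>I(0) I(1 + a)\<close>: it is
  Chebyshev's inequality for the functions \<open>f\<close> and \<open>f powr a\<close>, which are similarly or oppositely ordered
  according to the sign of \<open>a\<close>, and it is an equality exactly if \<open>f\<close> is constant
  (\<open>curv_moment_chebyshev\<close>). The right inequality is the left one for \<open>-a\<close>.

  It remains to see that \<open>f\<close> is constant only for ellipsoids centred at the origin. Constancy of
  \<open>f\<close> is the Monge-Ampere equation \<open>det D\<^sup>2 \<phi> = c\<close> for \<open>\<phi> = \<rho>\<^sup>2 / 2\<close>. By the inequality between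
  the arithmetic and the geometric mean, any second difference of \<open>\<phi>\<close> in a direction \<open>e\<close> is a
  subsolution of the linearised equation (\<open>no_interior_maximum\<close>). The second derivative
  \<open>D\<^sup>2 \<phi>(e, e)\<close> is constant along rays, hence attains its maximum, and Hopf's proof of the
  strong maximum principle shows that it is constant (\<open>second_derivative_constant\<close>). It is carried out
  with second differences because \<open>\<phi>\<close> has only two derivatives. So \<open>\<phi>\<close> is a quadratic form and
  \<open>K\<close> is one of its sublevel sets.

  Surface area is a normalised Hausdorff measure. The formula for the cone measure needs three
  properties of it: it is a Borel measure, Lipschitz maps increase it by at most a power of their
  constant, and it is Lebesgue measure on hyperplanes. The last one is stated and used in the form that the
  area of a subset of a hyperplane, times the distance of the hyperplane from the origin, is \<open>n\<close> times
  the volume of the cone over the set (\<open>area_measure_hyperplane\<close>).\<close>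

section \<open>Change of variables over an arbitrary finite index type\<close>

text \<open>The theorem on change of variables in Lebesgue integrals concerns vectors indexed by a well-ordered
  finite type. An initial segment of the natural numbers provides one of each cardinality.\<close>

typedef ('a::finite) index_copy = "{..<CARD('a)}"
  by (rule exI[of _ 0]) simp

instance index_copy :: (finite) finite
proof
  have "finite (Rep_index_copy ` (UNIV :: 'a index_copy set))"
    by (rule finite_subset[of _ "{..<CARD('a)}"]) (use Rep_index_copy in auto)
  then show "finite (UNIV :: 'a index_copy set)"
    by (rule finite_imageD) (auto simp: inj_on_def Rep_index_copy_inject)
qed

instantiation index_copy :: (finite) wellorder
begin

definition less_eq_index_copy :: "'a index_copy \<Rightarrow> 'a index_copy \<Rightarrow> bool" where
  "less_eq_index_copy x y \<longleftrightarrow> Rep_index_copy x \<le> Rep_index_copy y"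

definition less_index_copy :: "'a index_copy \<Rightarrow> 'a index_copy \<Rightarrow> bool" where
  "less_index_copy x y \<longleftrightarrow> Rep_index_copy x < Rep_index_copy y"

instance
proof
  fix P :: "'a index_copy \<Rightarrow> bool" and a :: "'a index_copy"
  assume step: "\<And>x. (\<And>y. y < x \<Longrightarrow> P y) \<Longrightarrow> P x"
  show "P a"
    by (induction a rule: measure_induct_rule[of Rep_index_copy])
       (auto intro: step simp: less_index_copy_def)
qed (auto simp: less_eq_index_copy_def less_index_copy_def Rep_index_copy_inject)

end

definition index_iso :: "('a::finite) index_copy \<Rightarrow> 'a" where
  "index_iso = (SOME f. bij f)"

lemma bij_index_iso: "bij (index_iso :: 'a::finite index_copy \<Rightarrow> 'a)"
proof -
  have "CARD('a index_copy) = CARD('a)"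
    using type_definition.card[OF type_definition_index_copy] by simp
  then have "\<exists>f :: 'a index_copy \<Rightarrow> 'a. bij f"
    by (intro finite_same_card_bij) auto
  then show ?thesis
    unfolding index_iso_def by (rule someI_ex)
qed

lemma all_index_iso: "(\<forall>i. P (index_iso i)) \<longleftrightarrow> (\<forall>i. P i)"
  by (metis bij_index_iso bij_pointE)

definition reindex :: "real^'n \<Rightarrow> real^('n index_copy)" where
  "reindex x = (\<chi> i. x $ index_iso i)"

definition unreindex :: "real^('n index_copy) \<Rightarrow> real^'n" where
  "unreindex x = (\<chi> i. x $ inv index_iso i)"

lemma unreindex_reindex [simp]: "unreindex (reindex x) = x"
  by (simp add: reindex_def unreindex_def vec_eq_iff surj_f_inv_f[OF bij_is_surj[OF bij_index_iso]])

lemma reindex_unreindex [simp]: "reindex (unreindex x) = x"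
  by (simp add: reindex_def unreindex_def vec_eq_iff inv_f_f[OF bij_is_inj[OF bij_index_iso]])

lemma linear_reindex: "linear (reindex :: real^'n \<Rightarrow> _)"
  by (rule linearI) (simp_all add: reindex_def vec_eq_iff)

lemma linear_unreindex: "linear (unreindex :: _ \<Rightarrow> real^'n)"
  by (rule linearI) (simp_all add: unreindex_def vec_eq_iff)

lemma reindex_cbox: "reindex ` cbox a b = cbox (reindex a) (reindex b)"
proof -
  have "reindex x \<in> cbox (reindex a) (reindex b) \<longleftrightarrow> x \<in> cbox a b" for x :: "real^'a"
    using all_index_iso[of "\<lambda>i. a $ i \<le> x $ i \<and> x $ i \<le> b $ i"]
    by (simp add: mem_box_cart reindex_def)
  then show ?thesis
    by (auto simp: image_iff) (metis reindex_unreindex)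
qed

lemma unreindex_cbox: "unreindex ` cbox a b = cbox (unreindex a) (unreindex b)"
proof -
  have "unreindex ` cbox a b = unreindex ` (reindex ` cbox (unreindex a) (unreindex b))"
    by (simp add: reindex_cbox)
  also have "\<dots> = cbox (unreindex a) (unreindex b)"
    by (simp add: image_image)
  finally show ?thesis .
qed

lemma content_reindex_cbox: "measure lborel (reindex ` cbox a b) = measure lborel (cbox a b)"
proof (cases "cbox a b = {}")
  case False
  then have "cbox (reindex a) (reindex b) \<noteq> {}"
    by (metis image_is_empty reindex_cbox)
  then have "measure lborel (reindex ` cbox a b) = (\<Prod>i\<in>UNIV. b $ index_iso i - a $ index_iso i)"
    by (simp add: reindex_cbox content_cbox_cart) (simp add: reindex_def)
  also have "\<dots> = (\<Prod>i\<in>UNIV. b $ i - a $ i)"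
    by (rule prod.reindex_bij_betw[OF bij_index_iso])
  finally show ?thesis
    using False by (simp add: content_cbox_cart)
qed simp

lemma has_integral_reindex_cbox:
  fixes f :: "real^'n \<Rightarrow> real"
  shows "((\<lambda>x. f (unreindex x)) has_integral i) (reindex ` cbox a b) \<longleftrightarrow> (f has_integral i) (cbox a b)"
proof
  assume "(f has_integral i) (cbox a b)"
  then have "((\<lambda>x. f (unreindex x)) has_integral ((1 / 1) *\<^sub>R i)) (reindex ` cbox a b)"
  proof (rule has_integral_twiddle[rotated -1])
    show "\<exists>w z. unreindex ` cbox u v = cbox w z" for u v :: "real^('n index_copy)"
      using unreindex_cbox by blast
    show "\<exists>w z. reindex ` cbox u v = cbox w z" for u v :: "real^'n"
      using reindex_cbox by blast
    show "measure lborel (unreindex ` cbox u v) = 1 * measure lborel (cbox u v)" for u v :: "real^('n index_copy)"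
      using content_reindex_cbox[of "unreindex u" "unreindex v"]
      by (simp add: reindex_cbox unreindex_cbox)
    show "continuous (at x) unreindex" for x :: "real^('n index_copy)"
      by (simp add: linear_continuous_at linear_conv_bounded_linear[symmetric] linear_unreindex)
  qed auto
  then show "((\<lambda>x. f (unreindex x)) has_integral i) (reindex ` cbox a b)" by simp
next
  assume "((\<lambda>x. f (unreindex x)) has_integral i) (reindex ` cbox a b)"
  then have "((\<lambda>x. f (unreindex x)) has_integral i) (cbox (reindex a) (reindex b))"
    by (simp add: reindex_cbox)
  then have "((\<lambda>x. f (unreindex (reindex x))) has_integral ((1 / 1) *\<^sub>R i)) (unreindex ` cbox (reindex a) (reindex b))"
  proof (rule has_integral_twiddle[rotated -1])
    show "\<exists>w z. unreindex ` cbox u v = cbox w z" for u v :: "real^('n index_copy)"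
      using unreindex_cbox by blast
    show "\<exists>w z. reindex ` cbox u v = cbox w z" for u v :: "real^'n"
      using reindex_cbox by blast
    show "measure lborel (reindex ` cbox u v) = 1 * measure lborel (cbox u v)" for u v :: "real^'n"
      using content_reindex_cbox by simp
    show "continuous (at x) reindex" for x :: "real^'n"
      by (simp add: linear_continuous_at linear_conv_bounded_linear[symmetric] linear_reindex)
  qed auto
  then show "(f has_integral i) (cbox a b)"
    by (simp add: unreindex_cbox)
qed

lemma has_integral_reindex:
  fixes f :: "real^'n \<Rightarrow> real"
  assumes "bounded S"
  shows "((\<lambda>x. f (unreindex x)) has_integral i) (reindex ` S) \<longleftrightarrow> (f has_integral i) S"
proof -
  obtain a b where ab: "S \<subseteq> cbox a b"
    using assms bounded_subset_cbox_symmetric by blast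
  have "(f has_integral i) S \<longleftrightarrow> ((\<lambda>x. if x \<in> S then f x else 0) has_integral i) (cbox a b)"
    using ab by (simp add: has_integral_restrict)
  also have "\<dots> \<longleftrightarrow> ((\<lambda>x. if unreindex x \<in> S then f (unreindex x) else 0) has_integral i) (reindex ` cbox a b)"
    by (rule has_integral_reindex_cbox[symmetric])
  also have "(\<lambda>x. if unreindex x \<in> S then f (unreindex x) else 0) =
      (\<lambda>x. if x \<in> reindex ` S then f (unreindex x) else 0)"
    by (auto simp: fun_eq_iff image_iff)
  also have "(\<dots> has_integral i) (reindex ` cbox a b) \<longleftrightarrow>
      ((\<lambda>x. f (unreindex x)) has_integral i) (reindex ` S)"
    using ab by (intro has_integral_restrict) auto
  finally show ?thesis ..
qed

text \<open>Relabelling rows and columns by the same bijection conjugates the permutations in the Leibniz formula,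
  which preserves their signs.\<close>

lemma det_reindex:
  fixes A :: "real^'n^'n" and f :: "'m::finite \<Rightarrow> 'n"
  assumes f: "bij f"
  shows "det (\<chi> i j. A $ f i $ f j) = det A"
proof -
  let ?c = "map_permutation UNIV f"
  have inj: "inj f" and surj: "range f = UNIV"
    using f by (auto simp: bij_def)
  have bij: "bij_betw ?c {p. p permutes UNIV} {p. p permutes UNIV}"
  proof -
    have "?c = (\<lambda>\<pi> x. if x \<in> UNIV then f (\<pi> (inv_into UNIV f x)) else x)"
      by (simp add: fun_eq_iff map_permutation_def restrict_id_def surj)
    then show ?thesis
      using bij_betw_permutations[OF f] by simp
  qed
  have "det A = (\<Sum>p | p permutes UNIV. of_int (sign (?c p)) * (\<Prod>i\<in>UNIV. A $ i $ ?c p i))"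
    unfolding det_def by (rule sum.reindex_bij_betw[OF bij, symmetric])
  also have "\<dots> = (\<Sum>p | p permutes UNIV. of_int (sign p) * (\<Prod>i\<in>UNIV. A $ f i $ f (p i)))"
  proof (rule sum.cong[OF refl])
    fix p :: "'m \<Rightarrow> 'm" assume "p \<in> {p. p permutes UNIV}"
    then have p: "p permutes UNIV" by simp
    have "(\<Prod>i\<in>UNIV. A $ i $ ?c p i) = (\<Prod>i\<in>UNIV. A $ f i $ ?c p (f i))"
      by (rule prod.reindex_bij_betw[OF f, symmetric])
    also have "\<dots> = (\<Prod>i\<in>UNIV. A $ f i $ f (p i))"
      using inj by (simp add: map_permutation_apply)
    finally show "of_int (sign (?c p)) * (\<Prod>i\<in>UNIV. A $ i $ ?c p i) =
        of_int (sign p) * (\<Prod>i\<in>UNIV. A $ f i $ f (p i))"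
      using inj p by (simp add: sign_map_permutation)
  qed
  finally show ?thesis
    by (simp add: det_def)
qed

text \<open>Reindexing preserves boxes, their contents and determinants, so the statement carries over from
  well-ordered index types. For nonnegative functions integrability and absolute integrability coincide.\<close>

theorem has_integral_change_of_variables:
  fixes g :: "real^'n \<Rightarrow> real^'n" and f :: "real^'n \<Rightarrow> real"
  assumes S: "S \<in> sets borel" "bounded S" "bounded (g ` S)"
    and der: "\<And>x. x \<in> S \<Longrightarrow> (g has_derivative g' x) (at x within S)"
    and inj: "inj_on g S"
    and nonneg: "\<And>x. x \<in> S \<Longrightarrow> 0 \<le> f (g x)"
  shows "((\<lambda>x. \<bar>det (matrix (g' x))\<bar> * f (g x)) has_integral b) S \<longleftrightarrow> (f has_integral b) (g ` S)"
proof -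
  let ?S = "reindex ` S"
  let ?g = "\<lambda>x. reindex (g (unreindex x))"
  let ?g' = "\<lambda>x v. reindex (g' (unreindex x) (unreindex v))"
  let ?f = "\<lambda>x. vec (f (unreindex x)) :: real^1"
  have meas: "?S \<in> sets lebesgue"
  proof -
    have "?S = unreindex -` S \<inter> space borel"
      by (auto simp: image_iff) (metis reindex_unreindex)
    moreover have "unreindex \<in> borel_measurable (borel :: (real^('n index_copy)) measure)"
      by (intro borel_measurable_continuous_onI linear_continuous_on)
         (simp add: linear_conv_bounded_linear[symmetric] linear_unreindex)
    ultimately show ?thesis
      using S(1) by (auto dest: measurable_sets)
  qed
  have lin: "bounded_linear (reindex :: real^'n \<Rightarrow> _)" "bounded_linear (unreindex :: _ \<Rightarrow> real^'n)"
    using linear_reindex linear_unreindex by (simp_all add: linear_conv_bounded_linear)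
  have der': "(?g has_derivative ?g' x) (at x within ?S)" if "x \<in> ?S" for x
  proof -
    obtain y where y: "y \<in> S" "x = reindex y" using \<open>x \<in> ?S\<close> by blast
    have un: "(unreindex has_derivative unreindex) (at x within ?S)"
      using lin(2) by (rule bounded_linear_imp_has_derivative)
    have "(g has_derivative g' (unreindex x)) (at (unreindex x) within unreindex ` ?S)"
      using der[OF y(1)] y by (simp add: image_image)
    then have "(g \<circ> unreindex has_derivative g' (unreindex x) \<circ> unreindex) (at x within ?S)"
      using un by (intro diff_chain_within)
    then show ?thesis
      by (auto intro!: bounded_linear.has_derivative[OF lin(1)] simp: o_def)
  qed
  have inj': "inj_on ?g ?S"
    using inj by (auto simp: inj_on_def) (metis unreindex_reindex)
  have det': "det (matrix (?g' (reindex x))) = det (matrix (g' x))" if "x \<in> S" for x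
  proof -
    have [simp]: "unreindex (axis j 1) = axis (index_iso j) 1" for j :: "'n index_copy"
      using bij_index_iso[where 'a='n]
      by (auto simp: unreindex_def vec_eq_iff axis_def bij_def inv_f_f surj_f_inv_f)
    then have "matrix (?g' (reindex x)) = (\<chi> i j. matrix (g' x) $ index_iso i $ index_iso j)"
      unfolding matrix_def vec_eq_iff vec_lambda_beta unreindex_reindex
      by (simp add: reindex_def)
    then show ?thesis
      by (simp add: det_reindex bij_index_iso)
  qed
  have img: "?g ` ?S = reindex ` (g ` S)"
    by (simp add: image_image)
  have main: "((\<lambda>x. \<bar>det (matrix (?g' x))\<bar> *\<^sub>R ?f (?g x)) absolutely_integrable_on ?S \<and>
      integral ?S (\<lambda>x. \<bar>det (matrix (?g' x))\<bar> *\<^sub>R ?f (?g x)) = vec b) \<longleftrightarrow>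
      (?f absolutely_integrable_on ?g ` ?S \<and> integral (?g ` ?S) ?f = vec b)"
    by (rule has_absolute_integral_change_of_variables[OF meas der' inj'])
  let ?h1 = "\<lambda>x. \<bar>det (matrix (?g' x))\<bar> * f (unreindex (?g x))"
  let ?h2 = "\<lambda>x. f (unreindex x)"
  have conv: "(\<lambda>x. \<bar>det (matrix (?g' x))\<bar> *\<^sub>R ?f (?g x)) = (\<lambda>x. vec (?h1 x))"
    by (simp add: fun_eq_iff vec_eq_iff)
  have abs: "((\<lambda>x. vec (h x) :: real^1) absolutely_integrable_on U \<and> integral U (\<lambda>x. vec (h x)) = (vec b :: real^1)) \<longleftrightarrow>
     (h has_integral b) U" if "\<And>x. x \<in> U \<Longrightarrow> 0 \<le> h x" for h and U :: "(real^'n index_copy) set"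
  proof -
    have "h absolutely_integrable_on U \<longleftrightarrow> h integrable_on U"
      using that nonnegative_absolutely_integrable_1 set_lebesgue_integral_eq_integral(1) by blast
    then show ?thesis
      by (simp add: absolutely_integrable_on_1_iff integral_on_1_eq has_integral_iff)
  qed
  have "((\<lambda>x. \<bar>det (matrix (g' x))\<bar> * f (g x)) has_integral b) S \<longleftrightarrow> (?h1 has_integral b) ?S"
    unfolding has_integral_reindex[OF S(2), symmetric]
    by (intro has_integral_cong) (auto simp: det'[simplified])
  also have "\<dots> \<longleftrightarrow> (?h2 has_integral b) (?g ` ?S)"
  proof -
    have 1: "((\<lambda>x. vec (?h1 x) :: real^1) absolutely_integrable_on ?S \<and>
        integral ?S (\<lambda>x. vec (?h1 x)) = (vec b :: real^1)) \<longleftrightarrow> (?h1 has_integral b) ?S"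
      by (rule abs) (use nonneg in auto)
    have 2: "((\<lambda>x. vec (?h2 x) :: real^1) absolutely_integrable_on (?g ` ?S) \<and>
        integral (?g ` ?S) (\<lambda>x. vec (?h2 x)) = (vec b :: real^1)) \<longleftrightarrow> (?h2 has_integral b) (?g ` ?S)"
      by (rule abs) (use nonneg in auto)
    show ?thesis
      using main 1 2 unfolding conv by meson
  qed
  also have "\<dots> \<longleftrightarrow> (f has_integral b) (g ` S)"
    unfolding img by (rule has_integral_reindex[OF S(3)])
  finally show ?thesis .
qed

lemma emeasure_lborel_linear_image:
  fixes g :: "real^'n \<Rightarrow> real^'n"
  assumes g: "linear g" "inj g" and S: "S \<in> sets borel" "bounded S"
  shows "emeasure lborel (g ` S) = ennreal \<bar>det (matrix g)\<bar> * emeasure lborel S"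
proof -
  have bl: "bounded_linear g"
    using g by (simp add: linear_conv_bounded_linear)
  have gS: "g ` S \<in> sets borel" "bounded (g ` S)"
  proof -
    obtain h where h: "linear h" "\<And>x. h (g x) = x" "\<And>x. g (h x) = x"
      using linear_injective_isomorphism[OF g] by blast
    have "g ` S = h -` S \<inter> space borel"
    proof (intro subset_antisym subsetI)
      fix y assume "y \<in> h -` S \<inter> space borel"
      then show "y \<in> g ` S" by (intro image_eqI[of y g "h y"]) (auto simp: h)
    qed (auto simp: h)
    moreover have "h \<in> borel_measurable borel"
      using h(1) by (intro borel_measurable_continuous_onI linear_continuous_on)
         (simp add: linear_conv_bounded_linear)
    ultimately show "g ` S \<in> sets borel"
      using S(1) by (auto dest: measurable_sets)
    show "bounded (g ` S)"
      using S(2) bl by (rule bounded_linear_image)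
  qed
  have fin: "S \<in> lmeasurable" "g ` S \<in> lmeasurable"
    using S gS by (simp_all add: bounded_set_imp_lmeasurable)
  have "((\<lambda>x. \<bar>det (matrix g)\<bar> * 1) has_integral (\<bar>det (matrix g)\<bar> * measure lebesgue S)) S"
    using fin(1) by (intro has_integral_mult_right)
       (simp add: has_integral_iff lmeasurable_iff_integrable_on lmeasure_integral)
  then have "((\<lambda>x. 1) has_integral (\<bar>det (matrix g)\<bar> * measure lebesgue S)) (g ` S)"
    using has_integral_change_of_variables[OF S gS(2), of "\<lambda>_. g" "\<lambda>_. 1"] g(2)
    by (auto intro: bounded_linear_imp_has_derivative[OF bl] inj_on_subset)
  then have "measure lebesgue (g ` S) = \<bar>det (matrix g)\<bar> * measure lebesgue S"
    using fin(2) by (simp add: has_integral_iff lmeasure_integral)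
  then have "ennreal (measure lebesgue (g ` S)) = ennreal \<bar>det (matrix g)\<bar> * ennreal (measure lebesgue S)"
    by (simp add: ennreal_mult')
  moreover have "emeasure lborel U = ennreal (measure lebesgue U)"
    if "U \<in> sets borel" "U \<in> lmeasurable" for U :: "(real^'n) set"
    using that emeasure_completion[of U lborel] by (simp add: emeasure_eq_measure2)
  ultimately show ?thesis
    using fin S gS by simp
qed

lemma lborel_distr_linear:
  fixes g :: "real^'n \<Rightarrow> real^'n"
  assumes g: "linear g" and det: "\<bar>det (matrix g)\<bar> = 1"
  shows "distr lborel borel g = lborel"
proof (rule lborel_eqI[symmetric])
  have inv: "invertible (matrix g)"
    using det by (auto simp: invertible_det_nz)
  then have "inj g"
    using inj_matrix_vector_mult[OF inv] by (simp only: matrix_vector_mul(2)[OF g])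
  then obtain h where h: "linear h" "\<And>x. h (g x) = x" "\<And>x. g (h x) = x"
    using linear_injective_isomorphism[OF g] by blast
  have "matrix g ** matrix h = mat 1"
  proof -
    have "matrix g ** matrix h = matrix (g \<circ> h)"
      using g h(1) by (simp add: matrix_compose)
    also have "g \<circ> h = id"
      using h(3) by (simp add: fun_eq_iff)
    finally show ?thesis by (simp only: matrix_id_mat_1)
  qed
  then have "det (matrix g) * det (matrix h) = 1"
    by (metis det_I det_mul)
  then have "\<bar>det (matrix g)\<bar> * \<bar>det (matrix h)\<bar> = 1"
    by (metis abs_1 abs_mult)
  then have deth: "\<bar>det (matrix h)\<bar> = 1"
    using det by simp
  have [measurable]: "g \<in> borel_measurable borel"
    using g by (intro borel_measurable_continuous_onI linear_continuous_on)
       (simp add: linear_conv_bounded_linear)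
  fix l u :: "real^'n" assume lu: "\<And>b. b \<in> Basis \<Longrightarrow> l \<bullet> b \<le> u \<bullet> b"
  have "g -` box l u = h ` box l u"
  proof (intro subset_antisym subsetI)
    fix y assume "y \<in> g -` box l u"
    then show "y \<in> h ` box l u" by (intro image_eqI[of y h "g y"]) (auto simp: h)
  qed (auto simp: h)
  then have "emeasure (distr lborel borel g) (box l u) = emeasure lborel (h ` box l u)"
    by (simp add: emeasure_distr)
  also have "\<dots> = emeasure lborel (box l u)"
  proof -
    have "inj h" by (rule inj_on_inverseI[of _ g]) (simp add: h(3))
    then show ?thesis
      using emeasure_lborel_linear_image[OF h(1), of "box l u"] by (simp add: deth)
  qed
  finally show "emeasure (distr lborel borel g) (box l u) = ennreal (prod ((\<bullet>) (u - l)) Basis)"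
    using lu by (simp add: emeasure_lborel_box_eq)
qed simp

section \<open>Hausdorff measure as a Borel measure\<close>

definition thin_covers :: "real \<Rightarrow> 'a::metric_space set \<Rightarrow> (nat \<Rightarrow> 'a set) set" where
  "thin_covers \<delta> A = {C. A \<subseteq> (\<Union>i. C i) \<and> (\<forall>i. bounded (C i) \<and> diameter (C i) \<le> \<delta>)}"

definition hausdorff_pre :: "nat \<Rightarrow> real \<Rightarrow> 'a::metric_space set \<Rightarrow> ennreal" where
  "hausdorff_pre d \<delta> A = (INF C\<in>thin_covers \<delta> A. \<Sum>i. ennreal (diameter (C i) ^ d))"

lemma hausdorff_outer_eq: "hausdorff_outer d A = (SUP \<delta>\<in>{0<..}. hausdorff_pre d \<delta> A)"
  by (simp add: hausdorff_outer_def hausdorff_pre_def thin_covers_def)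

lemma hausdorff_pre_antimono: "\<delta> \<le> \<epsilon> \<Longrightarrow> hausdorff_pre d \<epsilon> A \<le> hausdorff_pre d \<delta> A"
  unfolding hausdorff_pre_def by (rule INF_superset_mono) (auto simp: thin_covers_def intro: order_trans)

lemma hausdorff_pre_mono: "A \<subseteq> B \<Longrightarrow> hausdorff_pre d \<delta> A \<le> hausdorff_pre d \<delta> B"
  unfolding hausdorff_pre_def by (rule INF_superset_mono) (auto simp: thin_covers_def)

lemma hausdorff_pre_le_outer: "\<delta> > 0 \<Longrightarrow> hausdorff_pre d \<delta> A \<le> hausdorff_outer d A"
  unfolding hausdorff_outer_eq by (rule SUP_upper) simp

lemma hausdorff_outer_mono: "A \<subseteq> B \<Longrightarrow> hausdorff_outer d A \<le> hausdorff_outer d B"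
  unfolding hausdorff_outer_eq by (intro SUP_mono) (auto intro: hausdorff_pre_mono)

lemma hausdorff_pre_less_obtain:
  assumes "hausdorff_pre d \<delta> A < c"
  obtains C where "C \<in> thin_covers \<delta> A" "(\<Sum>i. ennreal (diameter (C i) ^ d)) < c"
  using assms unfolding hausdorff_pre_def by (auto simp: INF_less_iff)

lemma hausdorff_pre_le:
  assumes "C \<in> thin_covers \<delta> A"
  shows "hausdorff_pre d \<delta> A \<le> (\<Sum>i. ennreal (diameter (C i) ^ d))"
  unfolding hausdorff_pre_def using assms by (rule INF_lower)

lemma hausdorff_pre_empty:
  assumes "d > 0" "\<delta> \<ge> 0"
  shows "hausdorff_pre d \<delta> ({} :: 'a::metric_space set) = 0"
proof -
  have "hausdorff_pre d \<delta> ({} :: 'a set) \<le> (\<Sum>i::nat. ennreal (diameter ({} :: 'a set) ^ d))"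
    by (rule hausdorff_pre_le[of "\<lambda>_. {}"]) (use assms in \<open>auto simp: thin_covers_def\<close>)
  then show ?thesis using assms by (simp add: power_0_left)
qed

lemma hausdorff_outer_empty: "d > 0 \<Longrightarrow> hausdorff_outer d {} = 0"
  unfolding hausdorff_outer_eq by (simp add: hausdorff_pre_empty)

text \<open>Covers of the single sets, chosen within a geometric error, are merged along a pairing of the
  naturals.\<close>

lemma hausdorff_pre_countably_subadditive:
  "hausdorff_pre d \<delta> (\<Union>i. A i) \<le> (\<Sum>i::nat. hausdorff_pre d \<delta> (A i))"
proof (rule ennreal_le_epsilon)
  fix e :: real assume e: "0 < e" and fin: "(\<Sum>i. hausdorff_pre d \<delta> (A i)) < top"
  have "\<exists>C. C \<in> thin_covers \<delta> (A i) \<and>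
      (\<Sum>j. ennreal (diameter (C j) ^ d)) \<le> hausdorff_pre d \<delta> (A i) + ennreal (e * (1/2) ^ Suc i)" for i
  proof -
    have "hausdorff_pre d \<delta> (A i) < top"
      using fin by (metis ennreal_suminf_lessD)
    then have "hausdorff_pre d \<delta> (A i) < hausdorff_pre d \<delta> (A i) + ennreal (e * (1/2) ^ Suc i)"
      using e by (simp add: ennreal_add_left_cancel_less[of _ 0, simplified])
    then show ?thesis
      by (elim hausdorff_pre_less_obtain) (auto intro: less_imp_le)
  qed
  then obtain C where C: "\<And>i. C i \<in> thin_covers \<delta> (A i)"
    "\<And>i. (\<Sum>j. ennreal (diameter (C i j) ^ d)) \<le> hausdorff_pre d \<delta> (A i) + ennreal (e * (1/2) ^ Suc i)"
    by metis
  define D where "D n = (case prod_decode n of (i, j) \<Rightarrow> C i j)" for n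
  have "D \<in> thin_covers \<delta> (\<Union>i. A i)"
  proof -
    have "x \<in> (\<Union>n. D n)" if x: "x \<in> A i" for x i
    proof -
      obtain j where "x \<in> C i j"
        using C(1)[of i] x by (auto simp: thin_covers_def)
      then have "x \<in> D (prod_encode (i, j))"
        by (simp add: D_def)
      then show ?thesis by blast
    qed
    moreover have "bounded (D n) \<and> diameter (D n) \<le> \<delta>" for n
      using C(1) by (auto simp: thin_covers_def D_def split: prod.split)
    ultimately show ?thesis
      by (auto simp: thin_covers_def)
  qed
  then have "hausdorff_pre d \<delta> (\<Union>i. A i) \<le> (\<Sum>n. ennreal (diameter (D n) ^ d))"
    by (rule hausdorff_pre_le)
  also have "\<dots> = (\<Sum>n. (\<lambda>(i, j). ennreal (diameter (C i j) ^ d)) (prod_decode n))"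
    by (simp add: D_def split_beta)
  also have "\<dots> = (\<Sum>i. \<Sum>j. ennreal (diameter (C i j) ^ d))"
    by (rule suminf_ennreal_2dimen) simp
  also have "\<dots> \<le> (\<Sum>i. hausdorff_pre d \<delta> (A i) + ennreal (e * (1/2) ^ Suc i))"
    by (intro suminf_le C(2)) auto
  also have "\<dots> = (\<Sum>i. hausdorff_pre d \<delta> (A i)) + (\<Sum>i. ennreal (e * (1/2) ^ Suc i))"
    by (rule suminf_add[symmetric]) auto
  also have "(\<Sum>i. ennreal (e * (1/2) ^ Suc i)) = ennreal e"
  proof -
    have "(\<lambda>i. e * (1/2) ^ Suc i) sums (e * 1)"
      by (intro sums_mult power_half_series)
    then show ?thesis
      using e by (intro suminf_ennreal_eq) auto
  qed
  finally show "hausdorff_pre d \<delta> (\<Union>i. A i) \<le> (\<Sum>i. hausdorff_pre d \<delta> (A i)) + ennreal e" .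
qed

lemma hausdorff_outer_countably_subadditive:
  "hausdorff_outer d (\<Union>i. A i) \<le> (\<Sum>i::nat. hausdorff_outer d (A i))"
  unfolding hausdorff_outer_eq[of d "\<Union>i. A i"]
proof (rule SUP_least)
  fix \<delta> :: real assume "\<delta> \<in> {0<..}"
  then have "(\<Sum>i. hausdorff_pre d \<delta> (A i)) \<le> (\<Sum>i. hausdorff_outer d (A i))"
    by (intro suminf_le hausdorff_pre_le_outer) auto
  then show "hausdorff_pre d \<delta> (\<Union>i. A i) \<le> (\<Sum>i. hausdorff_outer d (A i))"
    using hausdorff_pre_countably_subadditive order_trans by blast
qed

lemma hausdorff_outer_subadditive:
  assumes "d > 0"
  shows "hausdorff_outer d (A \<union> B) \<le> hausdorff_outer d A + hausdorff_outer d B"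
proof -
  let ?A = "\<lambda>i::nat. if i = 0 then A else if i = 1 then B else {}"
  have "A \<union> B = (\<Union>i. ?A i)"
    by (auto split: if_splits intro: exI[of _ 0] exI[of _ 1])
  then have "hausdorff_outer d (A \<union> B) \<le> (\<Sum>i. hausdorff_outer d (?A i))"
    using hausdorff_outer_countably_subadditive[of d ?A] by simp
  also have "\<dots> = (\<Sum>i\<in>{0,1}. hausdorff_outer d (?A i))"
    using assms by (intro suminf_finite) (auto simp: hausdorff_outer_empty)
  finally show ?thesis by simp
qed

text \<open>If two sets have distance at least \<open>\<delta>\<close>, a member of a cover by sets of diameter below
  \<open>\<delta>\<close> meets only one of them.\<close>

lemma hausdorff_outer_separated:
  assumes d: "d > 0" and r: "r > 0" and sep: "\<And>x y. x \<in> A \<Longrightarrow> y \<in> B \<Longrightarrow> r \<le> dist x y"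
  shows "hausdorff_outer d A + hausdorff_outer d B \<le> hausdorff_outer d (A \<union> B)"
proof -
  have pre: "hausdorff_pre d \<delta> A + hausdorff_pre d \<delta> B \<le> hausdorff_pre d \<delta> (A \<union> B)"
    if \<delta>: "0 < \<delta>" "\<delta> < r" for \<delta>
    unfolding hausdorff_pre_def[of d \<delta> "A \<union> B"]
  proof (rule INF_greatest)
    fix C assume C: "C \<in> thin_covers \<delta> (A \<union> B)"
    let ?A = "\<lambda>i. if C i \<inter> A = {} then {} else C i"
    let ?B = "\<lambda>i. if C i \<inter> B = {} then {} else C i"
    have "?A \<in> thin_covers \<delta> A" "?B \<in> thin_covers \<delta> B"
      using C \<delta> by (fastforce simp: thin_covers_def)+
    then have "hausdorff_pre d \<delta> A + hausdorff_pre d \<delta> B \<le>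
        (\<Sum>i. ennreal (diameter (?A i) ^ d)) + (\<Sum>i. ennreal (diameter (?B i) ^ d))"
      by (intro add_mono hausdorff_pre_le)
    also have "\<dots> = (\<Sum>i. ennreal (diameter (?A i) ^ d) + ennreal (diameter (?B i) ^ d))"
      by (rule suminf_add) auto
    also have "\<dots> \<le> (\<Sum>i. ennreal (diameter (C i) ^ d))"
    proof (intro suminf_le)
      fix i
      have "C i \<inter> A = {} \<or> C i \<inter> B = {}"
      proof (rule ccontr)
        assume "\<not> ?thesis"
        then obtain x y where xy: "x \<in> C i" "x \<in> A" "y \<in> C i" "y \<in> B" by blast
        then have "r \<le> dist x y" using sep by blast
        also have "dist x y \<le> diameter (C i)"
          using C xy by (intro diameter_bounded_bound) (auto simp: thin_covers_def)
        also have "\<dots> \<le> \<delta>" using C by (auto simp: thin_covers_def)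
        finally show False using \<delta> by simp
      qed
      then show "ennreal (diameter (?A i) ^ d) + ennreal (diameter (?B i) ^ d) \<le> ennreal (diameter (C i) ^ d)"
        using d by (auto simp: power_0_left)
    qed auto
    finally show "hausdorff_pre d \<delta> A + hausdorff_pre d \<delta> B \<le> (\<Sum>i. ennreal (diameter (C i) ^ d))" .
  qed
  have "hausdorff_outer d A + hausdorff_outer d B = (SUP \<delta>\<in>{0<..}. hausdorff_pre d \<delta> A + hausdorff_pre d \<delta> B)"
    unfolding hausdorff_outer_eq
  proof (rule SUP_add_directed_ennreal[symmetric]; safe)
    fix s t :: real assume "s > 0" "t > 0"
    then show "\<exists>k\<in>{0<..}. hausdorff_pre d s A + hausdorff_pre d t B \<le> hausdorff_pre d k A + hausdorff_pre d k B"
      by (intro bexI[of _ "min s t"] add_mono hausdorff_pre_antimono) auto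
  qed
  also have "\<dots> \<le> hausdorff_outer d (A \<union> B)"
  proof (rule SUP_least)
    fix \<delta> :: real assume "\<delta> \<in> {0<..}"
    then have m: "0 < min \<delta> (r/2)" "min \<delta> (r/2) < r" using r by auto
    have "hausdorff_pre d \<delta> A + hausdorff_pre d \<delta> B \<le>
       hausdorff_pre d (min \<delta> (r/2)) A + hausdorff_pre d (min \<delta> (r/2)) B"
      by (intro add_mono hausdorff_pre_antimono) auto
    also have "\<dots> \<le> hausdorff_pre d (min \<delta> (r/2)) (A \<union> B)"
      using m by (rule pre)
    also have "\<dots> \<le> hausdorff_outer d (A \<union> B)"
      using m by (intro hausdorff_pre_le_outer)
    finally show "hausdorff_pre d \<delta> A + hausdorff_pre d \<delta> B \<le> hausdorff_outer d (A \<union> B)" .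
  qed
  finally show ?thesis .
qed

text \<open>Caratheodory's criterion for a metric outer measure: a closed set \<open>F\<close> is cut out of
  \<open>E\<close> through the shells of points whose distance to \<open>F\<close> lies between two consecutive
  reciprocals; shells of the same parity are separated, so their measures are summable.\<close>

lemma hausdorff_outer_closed_split:
  fixes F E :: "'a::metric_space set"
  assumes d: "d > 0" and F: "closed F"
  shows "hausdorff_outer d (E \<inter> F) + hausdorff_outer d (E - F) \<le> hausdorff_outer d E"
proof (cases "F = {} \<or> hausdorff_outer d E = top")
  case True
  then show ?thesis
    using d by (auto simp: hausdorff_outer_empty)
next
  case False
  then have F0: "F \<noteq> {}" and fin: "hausdorff_outer d E < top"
    by (auto simp: top.not_eq_extremum)
  let ?H = "hausdorff_outer d"
  define g where "g x = infdist x F" for x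
  have g_sep: "s - t \<le> dist x y" if "s \<le> g x" "g y \<le> t" for x y s t
    using infdist_triangle[of x F y] that by (simp add: g_def)
  have g_F: "g x = 0" if "x \<in> F" for x
    using that by (simp add: g_def)
  have g_pos: "g x > 0" if "x \<notin> F" for x
    using that F F0 by (simp add: g_def infdist_pos_not_in_closed)
  define R where "R k = {x \<in> E. 1 / real (k + 2) \<le> g x \<and> g x < 1 / real (k + 1)}" for k
  define E' where "E' k = {x \<in> E. 1 / real (k + 1) \<le> g x}" for k
  have parity: "(\<Sum>j<N. ?H (R (2 * j + p))) \<le> ?H (\<Union>j<N. R (2 * j + p))" for N p
  proof (induction N)
    case (Suc N)
    have sep: "1 / real (2 * N + p) - 1 / real (2 * N + p + 1) \<le> dist x y"
      if xR: "x \<in> (\<Union>j<N. R (2 * j + p))" and yR: "y \<in> R (2 * N + p)" for x y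
    proof (rule g_sep)
      obtain j where j: "j < N" "x \<in> R (2 * j + p)" using xR by blast
      have "1 / real (2 * N + p) \<le> 1 / real (2 * j + p + 2)"
        using j(1) by (intro divide_left_mono) auto
      also have "\<dots> \<le> g x" using j(2) by (simp add: R_def)
      finally show "1 / real (2 * N + p) \<le> g x" .
      show "g y \<le> 1 / real (2 * N + p + 1)" using yR by (simp add: R_def)
    qed
    show ?case
    proof (cases "N = 0")
      case False
      then have r: "1 / real (2 * N + p) - 1 / real (2 * N + p + 1) > 0"
      proof -
        have "1 / real (2 * N + p + 1) < 1 / real (2 * N + p)"
          using False by (intro divide_strict_left_mono) auto
        then show ?thesis by simp
      qed
      have "(\<Sum>j<Suc N. ?H (R (2 * j + p))) \<le> ?H (\<Union>j<N. R (2 * j + p)) + ?H (R (2 * N + p))"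
        using Suc by (simp add: add_right_mono)
      also have "\<dots> \<le> ?H ((\<Union>j<N. R (2 * j + p)) \<union> R (2 * N + p))"
        by (rule hausdorff_outer_separated[OF d r]) (rule sep)
      also have "(\<Union>j<N. R (2 * j + p)) \<union> R (2 * N + p) = (\<Union>j<Suc N. R (2 * j + p))"
        by (auto simp: lessThan_Suc)
      finally show ?thesis .
    qed (simp add: lessThan_Suc)
  qed simp
  have half: "(\<Sum>j. ?H (R (2 * j + p))) \<le> ?H E" for p
  proof (rule suminf_le_const)
    fix N
    have "(\<Sum>j<N. ?H (R (2 * j + p))) \<le> ?H (\<Union>j<N. R (2 * j + p))" by (rule parity)
    also have "\<dots> \<le> ?H E" by (rule hausdorff_outer_mono) (auto simp: R_def)
    finally show "(\<Sum>j<N. ?H (R (2 * j + p))) \<le> ?H E" .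
  qed simp
  have "(\<Sum>k. ?H (R k)) = (\<Sum>j. ?H (R (2 * j)) + ?H (R (2 * j + 1)))"
  proof -
    have "(\<lambda>k. ?H (R k)) sums (\<Sum>k. ?H (R k))" by (rule summable_sums) simp
    then have "(\<lambda>j. \<Sum>k = j * 2..<j * 2 + 2. ?H (R k)) sums (\<Sum>k. ?H (R k))"
      by (rule sums_group) simp
    moreover have "(\<Sum>k = j * 2..<j * 2 + 2. ?H (R k)) = ?H (R (2 * j)) + ?H (R (2 * j + 1))" for j
    proof -
      have "{j * 2..<j * 2 + 2} = {2 * j, 2 * j + 1}" by auto
      then show ?thesis by simp
    qed
    ultimately show ?thesis by (simp add: sums_iff)
  qed
  also have "\<dots> = (\<Sum>j. ?H (R (2 * j))) + (\<Sum>j. ?H (R (2 * j + 1)))"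
    by (rule suminf_add[symmetric]) auto
  also have "\<dots> \<le> ?H E + ?H E"
    using half[of 0] half[of 1] by (intro add_mono) auto
  also have "\<dots> < top" using fin by simp
  finally have sum_fin: "(\<Sum>k. ?H (R k)) < top" .
  have tail: "\<exists>k. (\<Sum>j. ?H (R (j + k))) \<le> ennreal e" if e: "e > 0" for e :: real
  proof -
    define r where "r k = enn2real (?H (R k))" for k
    have rfin: "?H (R k) < top" for k
      using sum_fin by (metis ennreal_suminf_lessD)
    have r: "?H (R k) = ennreal (r k)" "r k \<ge> 0" for k
      using rfin[of k] by (simp_all add: r_def)
    have "summable r"
      using sum_fin r by (intro summable_suminf_not_top) auto
    then obtain k where "norm (\<Sum>j. r (j + k)) < e"
      using suminf_exist_split[OF e] by blast
    moreover have "(\<Sum>j. ennreal (r (j + k))) = ennreal (\<Sum>j. r (j + k))"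
      using \<open>summable r\<close> r(2) by (intro suminf_ennreal2) (auto simp: summable_iff_shift)
    ultimately show ?thesis
      using r by (intro exI[of _ k]) (auto intro!: ennreal_leI)
  qed
  show ?thesis
  proof (rule ennreal_le_epsilon)
    fix e :: real assume e: "0 < e"
    then obtain k where k: "(\<Sum>j. ?H (R (j + k))) \<le> ennreal e" using tail by blast
    have cover: "E - F \<subseteq> E' k \<union> (\<Union>j. R (j + k))"
    proof
      fix x assume x: "x \<in> E - F"
      then have "g x > 0" using g_pos by simp
      then obtain m where m: "inverse (real (Suc m)) < g x"
        using reals_Archimedean by blast
      then have ex: "1 / real (m + 1) \<le> g x" by (simp add: field_simps)
      define l where "l = (LEAST m. 1 / real (m + 1) \<le> g x)"
      have l: "1 / real (l + 1) \<le> g x"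
        unfolding l_def by (rule LeastI[of _ m]) (rule ex)
      show "x \<in> E' k \<union> (\<Union>j. R (j + k))"
      proof (cases "l \<le> k")
        case True
        then have "1 / real (k + 1) \<le> 1 / real (l + 1)" by (intro divide_left_mono) auto
        then show ?thesis using l x by (auto simp: E'_def)
      next
        case False
        then have "l - 1 < l" by simp
        then have "\<not> 1 / real (l - 1 + 1) \<le> g x"
          unfolding l_def by (rule not_less_Least)
        then have "x \<in> R (l - 1)"
          using False x l by (simp add: R_def of_nat_diff)
        then have "x \<in> R ((l - 1 - k) + k)" using False by simp
        then show ?thesis by blast
      qed
    qed
    have "?H (E - F) \<le> ?H (E' k \<union> (\<Union>j. R (j + k)))"
      using cover by (rule hausdorff_outer_mono)
    also have "\<dots> \<le> ?H (E' k) + ?H (\<Union>j. R (j + k))"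
      by (rule hausdorff_outer_subadditive[OF d])
    also have "?H (\<Union>j. R (j + k)) \<le> (\<Sum>j. ?H (R (j + k)))"
      by (rule hausdorff_outer_countably_subadditive)
    also note k
    finally have "?H (E - F) \<le> ?H (E' k) + ennreal e" by (simp add: add_left_mono)
    then have "?H (E \<inter> F) + ?H (E - F) \<le> ?H (E \<inter> F) + ?H (E' k) + ennreal e"
      by (metis add.assoc add_left_mono)
    also have "?H (E \<inter> F) + ?H (E' k) \<le> ?H (E \<inter> F \<union> E' k)"
    proof (rule hausdorff_outer_separated[OF d])
      fix x y assume "x \<in> E \<inter> F" "y \<in> E' k"
      then have "1 / real (k + 1) - 0 \<le> dist y x"
        by (intro g_sep) (auto simp: E'_def g_F)
      then show "1 / real (k + 1) \<le> dist x y" by (simp add: dist_commute)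
    qed simp
    also have "\<dots> \<le> ?H E" by (rule hausdorff_outer_mono) (auto simp: E'_def)
    finally show "?H (E \<inter> F) + ?H (E - F) \<le> ?H E + ennreal e"
      by (simp add: add_right_mono)
  qed
qed

text \<open>Closed sets, and with them all Borel sets, belong to the Caratheodory sigma-algebra.\<close>

lemma measure_space_hausdorff_outer:
  assumes d: "d > 0"
  shows "measure_space UNIV (sets (borel :: 'a::metric_space measure)) (hausdorff_outer d)"
proof -
  let ?H = "hausdorff_outer d :: 'a set \<Rightarrow> ennreal"
  let ?L = "lambda_system UNIV (Pow UNIV) ?H"
  have "outer_measure_space (Pow UNIV) ?H"
    using d hausdorff_outer_countably_subadditive[of d]
    by (auto simp: outer_measure_space_def positive_def increasing_def countably_subadditive_def
        hausdorff_outer_empty hausdorff_outer_mono)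
  then have L: "measure_space UNIV ?L ?H"
    by (rule sigma_algebra.caratheodory_lemma[OF sigma_algebra_Pow])
  have "sigma_sets UNIV {F. closed F} \<subseteq> ?L"
  proof (rule sigma_algebra.sigma_sets_subset)
    show "sigma_algebra UNIV ?L"
      using L by (simp add: measure_space_def)
    show "{F. closed F} \<subseteq> ?L"
    proof safe
      fix F :: "'a set" assume F: "closed F"
      show "F \<in> ?L"
        unfolding lambda_system_def
      proof safe
        fix E :: "'a set"
        have "?H (F \<inter> E) + ?H ((UNIV - F) \<inter> E) \<le> ?H E"
          using hausdorff_outer_closed_split[OF d F, of E]
          by (simp add: Int_commute Diff_eq)
        moreover have "?H E \<le> ?H (F \<inter> E) + ?H ((UNIV - F) \<inter> E)"
        proof -
          have "?H ((F \<inter> E) \<union> ((UNIV - F) \<inter> E)) \<le> ?H (F \<inter> E) + ?H ((UNIV - F) \<inter> E)"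
            by (rule hausdorff_outer_subadditive[OF d])
          moreover have "(F \<inter> E) \<union> ((UNIV - F) \<inter> E) = E" by blast
          ultimately show ?thesis by simp
        qed
        ultimately show "?H (F \<inter> E) + ?H ((UNIV - F) \<inter> E) = ?H E" by (rule antisym)
      qed simp
    qed
  qed
  then have "sets borel \<subseteq> ?L"
    by (simp add: borel_eq_closed sets_measure_of)
  then show ?thesis
    using L sets.sigma_algebra_axioms[of borel]
    by (intro measure_down[OF L]) (auto simp: space_borel)
qed

text \<open>The normalised set function is countably additive on the Borel sets, so the generated measure takes
  its values there.\<close>

lemma emeasure_area_measure:
  assumes n: "CARD('n) \<ge> 2" and A: "(A :: (real^'n) set) \<in> sets borel"
  shows "emeasure area_measure A =
    hausdorff_outer (CARD('n) - 1) A / hausdorff_outer (CARD('n) - 1) (unit_face :: (real^'n) set)"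
proof -
  have ms: "measure_space UNIV (sets (borel :: (real^'n) measure)) (hausdorff_outer (CARD('n) - 1))"
    by (rule measure_space_hausdorff_outer) (use n in simp)
  let ?c = "hausdorff_outer (CARD('n) - 1) (unit_face :: (real^'n) set)"
  show ?thesis
    unfolding area_measure_def
  proof (rule emeasure_measure_of_sigma)
    show "sigma_algebra UNIV (sets (borel :: (real^'n) measure))"
      using ms by (simp add: measure_space_def)
    show "positive (sets borel) (\<lambda>A :: (real^'n) set. hausdorff_outer (CARD('n) - 1) A / ?c)"
      using ms by (auto simp: measure_space_def positive_def)
    show "countably_additive (sets borel) (\<lambda>A :: (real^'n) set. hausdorff_outer (CARD('n) - 1) A / ?c)"
      unfolding countably_additive_def
    proof safe
      fix B :: "nat \<Rightarrow> (real^'n) set"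
      assume B: "range B \<subseteq> sets borel" "disjoint_family B" "\<Union> (range B) \<in> sets borel"
      then have "(\<Sum>i. hausdorff_outer (CARD('n) - 1) (B i)) = hausdorff_outer (CARD('n) - 1) (\<Union> (range B))"
        using ms by (simp add: measure_space_def countably_additive_def)
      then show "(\<Sum>i. hausdorff_outer (CARD('n) - 1) (B i) / ?c) = hausdorff_outer (CARD('n) - 1) (\<Union> (range B)) / ?c"
        by (simp add: divide_ennreal_def ennreal_suminf_multc)
    qed
    show "A \<in> sets borel" by fact
  qed
qed

lemma sets_area_measure [simp, measurable_cong]: "sets (area_measure :: (real^'n) measure) = sets borel"
  unfolding area_measure_def
  by (metis sets.sigma_sets_eq sets_measure_of sets.space_closed space_borel)

lemma space_area_measure [simp]: "space (area_measure :: (real^'n) measure) = UNIV"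
  using sets_eq_imp_space_eq[OF sets_area_measure] by simp

text \<open>The image of a cover is a cover by sets whose diameters grow at most by the Lipschitz constant.\<close>

lemma hausdorff_outer_lipschitz_image:
  fixes f :: "'a::metric_space \<Rightarrow> 'b::metric_space"
  assumes d: "d > 0" and L: "L > 0" and f: "\<And>x y. x \<in> A \<Longrightarrow> y \<in> A \<Longrightarrow> dist (f x) (f y) \<le> L * dist x y"
  shows "hausdorff_outer d (f ` A) \<le> ennreal (L ^ d) * hausdorff_outer d A"
  unfolding hausdorff_outer_eq[of d "f ` A"]
proof (rule SUP_least)
  fix \<delta> :: real assume "\<delta> \<in> {0<..}"
  then have \<delta>: "\<delta> > 0" by simp
  have "hausdorff_pre d \<delta> (f ` A) \<le> ennreal (L ^ d) * hausdorff_pre d (\<delta> / L) A"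
  proof -
    have "hausdorff_pre d \<delta> (f ` A) \<le> ennreal (L ^ d) * (\<Sum>i. ennreal (diameter (C i) ^ d))"
      if C: "C \<in> thin_covers (\<delta> / L) A" for C
    proof -
      let ?D = "\<lambda>i. f ` (C i \<inter> A)"
      have bd: "bounded (?D i) \<and> diameter (?D i) \<le> L * diameter (C i)" for i
      proof -
        have le: "dist (f x) (f y) \<le> L * diameter (C i)" if "x \<in> C i \<inter> A" "y \<in> C i \<inter> A" for x y
        proof -
          have "dist x y \<le> diameter (C i)"
            using C that by (intro diameter_bounded_bound) (auto simp: thin_covers_def)
          then have "L * dist x y \<le> L * diameter (C i)" using L by simp
          then show ?thesis using f[of x y] that by auto
        qed
        have "bounded (?D i)"
          unfolding bounded_two_points using le by (intro exI[of _ "L * diameter (C i)"]) auto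
        moreover have "diameter (?D i) \<le> L * diameter (C i)"
        proof (cases "?D i = {}")
          case True
          then show ?thesis
            using L C by (auto simp: thin_covers_def intro!: mult_nonneg_nonneg diameter_ge_0)
        next
          case False
          then show ?thesis
            unfolding diameter_def[of "?D i"] using le by (auto intro!: cSUP_least)
        qed
        ultimately show ?thesis ..
      qed
      have "?D \<in> thin_covers \<delta> (f ` A)"
      proof -
        have "L * diameter (C i) \<le> \<delta>" for i
          using C L by (auto simp: thin_covers_def field_simps)
        moreover have "f ` A \<subseteq> (\<Union>i. ?D i)"
          using C by (fastforce simp: thin_covers_def)
        ultimately show ?thesis
          using bd order_trans unfolding thin_covers_def by blast
      qed
      then have "hausdorff_pre d \<delta> (f ` A) \<le> (\<Sum>i. ennreal (diameter (?D i) ^ d))"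
        by (rule hausdorff_pre_le)
      also have "\<dots> \<le> (\<Sum>i. ennreal (L ^ d) * ennreal (diameter (C i) ^ d))"
      proof (intro suminf_le)
        fix i
        have "diameter (?D i) ^ d \<le> (L * diameter (C i)) ^ d"
          using bd by (intro power_mono diameter_ge_0) auto
        then show "ennreal (diameter (?D i) ^ d) \<le> ennreal (L ^ d) * ennreal (diameter (C i) ^ d)"
          using L by (simp add: power_mult_distrib ennreal_leI flip: ennreal_mult')
      qed auto
      also have "\<dots> = ennreal (L ^ d) * (\<Sum>i. ennreal (diameter (C i) ^ d))"
        by (rule ennreal_suminf_cmult)
      finally show ?thesis .
    qed
    note le = this
    have cancel: "ennreal (1 / L ^ d) * (ennreal (L ^ d) * s) = s"
      "ennreal (L ^ d) * (ennreal (1 / L ^ d) * s) = s" for s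
      using L by (simp_all add: mult.assoc[symmetric] flip: ennreal_mult')
    have "ennreal (1 / L ^ d) * hausdorff_pre d \<delta> (f ` A) \<le> hausdorff_pre d (\<delta> / L) A"
      unfolding hausdorff_pre_def[of d "\<delta> / L"]
    proof (rule INF_greatest)
      fix C assume "C \<in> thin_covers (\<delta> / L) A"
      then have "ennreal (1 / L ^ d) * hausdorff_pre d \<delta> (f ` A) \<le>
          ennreal (1 / L ^ d) * (ennreal (L ^ d) * (\<Sum>i. ennreal (diameter (C i) ^ d)))"
        by (intro mult_left_mono le) auto
      then show "ennreal (1 / L ^ d) * hausdorff_pre d \<delta> (f ` A) \<le> (\<Sum>i. ennreal (diameter (C i) ^ d))"
        unfolding cancel .
    qed
    then have "ennreal (L ^ d) * (ennreal (1 / L ^ d) * hausdorff_pre d \<delta> (f ` A)) \<le> ennreal (L ^ d) * hausdorff_pre d (\<delta> / L) A"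
      by (rule mult_left_mono) simp
    then show ?thesis unfolding cancel .
  qed
  also have "\<dots> \<le> ennreal (L ^ d) * hausdorff_outer d A"
    using \<delta> L by (intro mult_left_mono hausdorff_pre_le_outer) auto
  finally show "hausdorff_pre d \<delta> (f ` A) \<le> ennreal (L ^ d) * hausdorff_outer d A" .
qed

text \<open>The distinguished coordinate, constant on the unit face.\<close>

definition height_index :: "'n::finite" where
  "height_index = (SOME k. True)"

lemma unit_face_iff:
  "x \<in> (unit_face :: (real^'n) set) \<longleftrightarrow> x $ height_index = 0 \<and> (\<forall>i. i \<noteq> height_index \<longrightarrow> 0 \<le> x $ i \<and> x $ i \<le> 1)"
  unfolding unit_face_def height_index_def[symmetric] mem_box_cart
  by (auto split: if_splits)

lemma hausdorff_pre_finite_union: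
  assumes d: "d > 0" "\<delta> \<ge> 0" and M: "finite M"
    and Q: "\<And>m. m \<in> M \<Longrightarrow> bounded (Q m) \<and> diameter (Q m) \<le> \<delta>"
  shows "hausdorff_pre d \<delta> (\<Union>m\<in>M. Q m) \<le> (\<Sum>m\<in>M. ennreal (diameter (Q m) ^ d))"
proof -
  obtain h where h: "bij_betw h {0..<card M} M"
    using M ex_bij_betw_nat_finite by blast
  let ?C = "\<lambda>i. if i < card M then Q (h i) else {}"
  have hM: "h i \<in> M" if "i < card M" for i
    using bij_betw_apply[OF h, of i] that by simp
  have "?C \<in> thin_covers \<delta> (\<Union>m\<in>M. Q m)"
  proof -
    have "(\<Union>m\<in>M. Q m) \<subseteq> (\<Union>i. ?C i)"
    proof
      fix x assume "x \<in> (\<Union>m\<in>M. Q m)"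
      then obtain m where m: "m \<in> M" "x \<in> Q m" by blast
      have "m \<in> h ` {0..<card M}" using m(1) h by (simp add: bij_betw_def)
      then obtain i where "i < card M" "h i = m" by auto
      then have "x \<in> ?C i" using m by simp
      then show "x \<in> (\<Union>i. ?C i)" by blast
    qed
    then show ?thesis
      using Q hM d by (auto simp: thin_covers_def)
  qed
  then have "hausdorff_pre d \<delta> (\<Union>m\<in>M. Q m) \<le> (\<Sum>i. ennreal (diameter (?C i) ^ d))"
    by (rule hausdorff_pre_le)
  also have "\<dots> = (\<Sum>i\<in>{0..<card M}. ennreal (diameter (?C i) ^ d))"
    using d by (intro suminf_finite) (auto simp: power_0_left)
  also have "\<dots> = (\<Sum>i\<in>{0..<card M}. ennreal (diameter (Q (h i)) ^ d))"
    by (intro sum.cong) auto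
  also have "\<dots> = (\<Sum>m\<in>M. ennreal (diameter (Q m) ^ d))"
    by (rule sum.reindex_bij_betw[OF h])
  finally show ?thesis .
qed

text \<open>A grid of \<open>N ^ (n - 1)\<close> cells of diameter at most \<open>n / N\<close> bounds the sum by \<open>n ^ (n - 1)\<close>,
  independently of \<open>N\<close>.\<close>

lemma hausdorff_outer_unit_face_finite:
  assumes n: "CARD('n) \<ge> 2"
  shows "hausdorff_outer (CARD('n) - 1) (unit_face :: (real^'n) set) < top"
proof -
  let ?d = "CARD('n) - 1" and ?n = "real CARD('n)" and ?k = "height_index :: 'n"
  have grid: "hausdorff_pre ?d (?n / real N) (unit_face :: (real^'n) set) \<le> ennreal (?n ^ ?d)" if N: "N > 0" for N :: nat
  proof -
    define M :: "('n \<Rightarrow> nat) set" where "M = PiE UNIV (\<lambda>i. if i = ?k then {0} else {..<N})"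
    define Q :: "('n \<Rightarrow> nat) \<Rightarrow> (real^'n) set" where
      "Q m = {x. x $ ?k = 0 \<and> (\<forall>i. i \<noteq> ?k \<longrightarrow> real (m i) / real N \<le> x $ i \<and> x $ i \<le> (real (m i) + 1) / real N)}" for m
    have M: "finite M" "card M = N ^ ?d"
    proof -
      show "finite M" unfolding M_def by (intro finite_PiE) auto
      have "card M = (\<Prod>i\<in>UNIV. card (if i = ?k then {0::nat} else {..<N}))"
        unfolding M_def by (rule card_PiE) simp
      also have "\<dots> = (\<Prod>i\<in>UNIV - {?k}. card (if i = ?k then {0::nat} else {..<N}))"
        by (subst prod.remove[of _ ?k]) auto
      also have "\<dots> = (\<Prod>i\<in>UNIV - {?k}. N)"
        by (rule prod.cong) auto
      finally show "card M = N ^ ?d" by (simp add: card_Diff_singleton)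
    qed
    have QD: "dist x y \<le> ?n / real N" if "x \<in> Q m" "y \<in> Q m" for x y m
    proof -
      have "\<bar>(x - y) $ i\<bar> \<le> 1 / real N" for i
      proof (cases "i = ?k")
        case False
        then have "real (m i) / real N \<le> x $ i" "x $ i \<le> (real (m i) + 1) / real N"
          "real (m i) / real N \<le> y $ i" "y $ i \<le> (real (m i) + 1) / real N"
          using that by (auto simp: Q_def)
        then show ?thesis by (simp add: add_divide_distrib)
      qed (use that in \<open>auto simp: Q_def\<close>)
      then have "(\<Sum>i\<in>UNIV. \<bar>(x - y) $ i\<bar>) \<le> (\<Sum>i\<in>(UNIV::'n set). 1 / real N)"
        by (rule sum_mono)
      then show ?thesis
        using norm_le_l1_cart[of "x - y"] by (simp add: dist_norm)
    qed
    have Qdiam: "bounded (Q m) \<and> diameter (Q m) \<le> ?n / real N" for m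
    proof -
      have "bounded (Q m)"
        unfolding bounded_two_points using QD by blast
      moreover have "diameter (Q m) \<le> ?n / real N"
        by (rule diameter_le) (use QD in \<open>auto simp: dist_norm\<close>)
      ultimately show ?thesis ..
    qed
    have "(unit_face :: (real^'n) set) \<subseteq> (\<Union>m\<in>M. Q m)"
    proof
      fix x :: "real^'n" assume x: "x \<in> unit_face"
      define m where "m i = (if i = ?k then 0 else if x $ i = 1 then N - 1 else nat \<lfloor>real N * x $ i\<rfloor>)" for i
      have mb: "m i < N \<and> real (m i) / real N \<le> x $ i \<and> x $ i \<le> (real (m i) + 1) / real N" if i: "i \<noteq> ?k" for i
      proof (cases "x $ i = 1")
        case True
        then show ?thesis using N i by (simp add: m_def of_nat_diff field_simps)
      next
        case False
        then have xi: "0 \<le> x $ i" "x $ i < 1" using x i by (auto simp: unit_face_iff order_less_le)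
        then have f: "m i = nat \<lfloor>real N * x $ i\<rfloor>" "0 \<le> real N * x $ i" "real N * x $ i < real N"
          using False i N by (auto simp: m_def)
        then have "real (m i) \<le> real N * x $ i" "real N * x $ i < real (m i) + 1"
          by (simp_all add: of_nat_floor)
        moreover from this f have "m i < N" by linarith
        ultimately show ?thesis using N by (simp add: field_simps less_imp_le)
      qed
      have "m \<in> M" using mb by (auto simp: M_def m_def)
      moreover have "x \<in> Q m" using mb x by (auto simp: Q_def unit_face_iff)
      ultimately show "x \<in> (\<Union>m\<in>M. Q m)" by blast
    qed
    then have "hausdorff_pre ?d (?n / real N) (unit_face :: (real^'n) set) \<le> hausdorff_pre ?d (?n / real N) (\<Union>m\<in>M. Q m)"
      by (rule hausdorff_pre_mono)
    also have "\<dots> \<le> (\<Sum>m\<in>M. ennreal (diameter (Q m) ^ ?d))"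
      by (rule hausdorff_pre_finite_union) (use n M Qdiam in auto)
    also have "\<dots> \<le> (\<Sum>m\<in>M. ennreal ((?n / real N) ^ ?d))"
      by (intro sum_mono ennreal_leI power_mono) (use Qdiam diameter_ge_0 in auto)
    also have "\<dots> = ennreal (real (card M) * (?n / real N) ^ ?d)"
      by (simp add: ennreal_mult' ennreal_of_nat_eq_real_of_nat)
    also have "real (card M) * (?n / real N) ^ ?d = ?n ^ ?d"
      using N by (simp add: M(2) power_divide)
    finally show ?thesis .
  qed
  have "hausdorff_outer ?d (unit_face :: (real^'n) set) \<le> ennreal (?n ^ ?d)"
    unfolding hausdorff_outer_eq
  proof (rule SUP_least)
    fix \<delta> :: real assume "\<delta> \<in> {0<..}"
    then have \<delta>: "\<delta> > 0" by simp
    obtain N :: nat where N: "?n / \<delta> < real N" using reals_Archimedean2 by blast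
    then have "real N > 0" using \<delta> by (smt (verit) divide_nonneg_pos of_nat_0_le_iff)
    then have "?n / real N \<le> \<delta>" using N \<delta> by (simp add: field_simps)
    then have "hausdorff_pre ?d \<delta> (unit_face :: (real^'n) set) \<le> hausdorff_pre ?d (?n / real N) (unit_face :: (real^'n) set)"
      by (rule hausdorff_pre_antimono)
    also have "\<dots> \<le> ennreal (?n ^ ?d)" using \<open>real N > 0\<close> by (intro grid) simp
    finally show "hausdorff_pre ?d \<delta> (unit_face :: (real^'n) set) \<le> ennreal (?n ^ ?d)" .
  qed
  then show ?thesis by (rule le_less_trans) simp
qed

text \<open>A cover of the unit face, thickened to boxes of height one, covers the unit cube.\<close>

lemma hausdorff_outer_unit_face_pos:
  assumes n: "CARD('n) \<ge> 2"
  shows "hausdorff_outer (CARD('n) - 1) (unit_face :: (real^'n) set) > 0"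
proof -
  let ?d = "CARD('n) - 1" and ?k = "height_index :: 'n"
  have "ennreal (1 / 2 ^ ?d) \<le> hausdorff_pre ?d 1 (unit_face :: (real^'n) set)"
    unfolding hausdorff_pre_def
  proof (rule INF_greatest)
    fix C :: "nat \<Rightarrow> (real^'n) set" assume C: "C \<in> thin_covers 1 unit_face"
    define c where "c i = (SOME x. x \<in> C i)" for i
    define l where "l i = (\<chi> j. if j = ?k then 0 else c i $ j - diameter (C i))" for i
    define u where "u i = (\<chi> j. if j = ?k then 1 else c i $ j + diameter (C i))" for i
    define Box where "Box i = cbox (l i) (u i)" for i
    have cover: "(cbox 0 1 :: (real^'n) set) \<subseteq> (\<Union>i. Box i)"
    proof
      fix x :: "real^'n" assume x: "x \<in> cbox 0 1"
      define y where "y = (\<chi> j. if j = ?k then 0 else x $ j)"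
      have "y \<in> unit_face" using x by (auto simp: unit_face_iff y_def mem_box_cart)
      then obtain i where i: "y \<in> C i" using C by (auto simp: thin_covers_def)
      then have ci: "c i \<in> C i" unfolding c_def by (rule someI)
      have "\<bar>x $ j - c i $ j\<bar> \<le> diameter (C i)" if "j \<noteq> ?k" for j
      proof -
        have "\<bar>x $ j - c i $ j\<bar> = \<bar>(y - c i) $ j\<bar>" using that by (simp add: y_def)
        also have "\<dots> \<le> dist y (c i)" unfolding dist_norm by (rule component_le_norm_cart)
        also have "\<dots> \<le> diameter (C i)"
          using C i ci by (intro diameter_bounded_bound) (auto simp: thin_covers_def)
        finally show ?thesis .
      qed
      then have "x \<in> Box i"
        using x by (force simp: Box_def l_def u_def mem_box_cart abs_le_iff)
      then show "x \<in> (\<Union>i. Box i)" by blast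
    qed
    have vol: "emeasure lborel (Box i) = ennreal (2 ^ ?d) * ennreal (diameter (C i) ^ ?d)" for i
    proof -
      have d0: "diameter (C i) \<ge> 0"
        using C by (intro diameter_ge_0) (auto simp: thin_covers_def)
      have "measure lborel (Box i) = (\<Prod>j\<in>UNIV. u i $ j - l i $ j)"
        unfolding Box_def using d0 by (subst content_cbox_cart) (auto simp: interval_eq_empty_cart l_def u_def)
      also have "\<dots> = (\<Prod>j\<in>UNIV - {?k}. u i $ j - l i $ j)"
        by (subst prod.remove[of _ ?k]) (auto simp: l_def u_def)
      also have "\<dots> = (\<Prod>j\<in>UNIV - {?k}. 2 * diameter (C i))"
        by (rule prod.cong) (auto simp: l_def u_def)
      also have "\<dots> = 2 ^ ?d * diameter (C i) ^ ?d"
        by (simp add: card_Diff_singleton power_mult_distrib)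
      finally have "measure lborel (Box i) = 2 ^ ?d * diameter (C i) ^ ?d" .
      moreover have "emeasure lborel (Box i) = ennreal (measure lborel (Box i))"
        unfolding Box_def using emeasure_lborel_cbox_finite[of "l i" "u i"]
        by (intro emeasure_eq_ennreal_measure) (simp add: top.not_eq_extremum)
      ultimately show ?thesis using d0 by (simp add: ennreal_mult')
    qed
    have "1 = emeasure lborel (cbox 0 1 :: (real^'n) set)"
    proof -
      have "measure lborel (cbox 0 1 :: (real^'n) set) = 1"
        by (subst content_cbox_cart) (auto simp: interval_eq_empty_cart)
      then show ?thesis
        using emeasure_lborel_cbox_finite[of "0 :: real^'n" 1] by (subst emeasure_eq_ennreal_measure) (auto simp: top.not_eq_extremum)
    qed
    also have "\<dots> \<le> emeasure lborel (\<Union>i. Box i)"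
      using cover by (intro emeasure_mono) (auto simp: Box_def)
    also have "\<dots> \<le> (\<Sum>i. emeasure lborel (Box i))"
      by (intro emeasure_subadditive_countably) (auto simp: Box_def)
    also have "\<dots> = ennreal (2 ^ ?d) * (\<Sum>i. ennreal (diameter (C i) ^ ?d))"
      unfolding vol by (rule ennreal_suminf_cmult)
    finally have "ennreal (1 / 2 ^ ?d) * 1 \<le> ennreal (1 / 2 ^ ?d) * (ennreal (2 ^ ?d) * (\<Sum>i. ennreal (diameter (C i) ^ ?d)))"
      by (rule mult_left_mono) simp
    also have "\<dots> = (\<Sum>i. ennreal (diameter (C i) ^ ?d))"
      by (simp add: mult.assoc[symmetric] flip: ennreal_mult')
    finally show "ennreal (1 / 2 ^ ?d) \<le> (\<Sum>i. ennreal (diameter (C i) ^ ?d))" by simp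
  qed
  also have "\<dots> \<le> hausdorff_outer ?d (unit_face :: (real^'n) set)"
    by (rule hausdorff_pre_le_outer) simp
  finally show ?thesis
    by (rule less_le_trans[rotated]) simp
qed

section \<open>Determinants and symmetric matrices\<close>

lemma matrix_add_rdistrib:
  fixes A B :: "real^'n^'m"
  shows "(A + B) ** C = A ** C + B ** C"
  by (simp add: matrix_matrix_mult_def vec_eq_iff distrib_right sum.distrib)

text \<open>After an orthogonal change of coordinates \<open>v\<close> is a multiple of a coordinate vector. The update then
  changes a single column of the identity, and the determinant is the diagonal entry of that column.\<close>

lemma det_rank_one_update:
  fixes u v :: "real^'n"
  shows "det (mat 1 + (\<chi> i j. u $ i * v $ j)) = 1 + u \<bullet> v"
proof (cases "v = 0")
  case True
  then show ?thesis by (simp add: det_I)  (simp add: vec_eq_iff zero_vec_def[symmetric])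
next
  case False
  fix k :: 'n
  obtain Q :: "real^'n^'n" where Q: "orthogonal_matrix Q" "Q *v axis k 1 = v /\<^sub>R norm v"
    using orthogonal_matrix_exists_basis[of "v /\<^sub>R norm v" k] False by auto
  have QQ: "transpose Q ** Q = mat 1" "Q ** transpose Q = mat 1"
    using Q(1) by (auto simp: orthogonal_matrix_def)
  let ?R = "\<lambda>u v :: real^'n. (\<chi> i j. u $ i * v $ j) :: real^'n^'n"
  have rank: "transpose Q ** ?R u v ** Q = ?R (transpose Q *v u) (transpose Q *v v)"
    by (simp add: matrix_matrix_mult_def matrix_vector_mult_def transpose_def vec_eq_iff
        sum_distrib_left sum_distrib_right mult_ac)
  have v: "transpose Q *v v = norm v *\<^sub>R axis k 1"
  proof -
    have "v = norm v *\<^sub>R (Q *v axis k 1)"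
      using Q(2) False by simp
    then have "transpose Q *v v = norm v *\<^sub>R (transpose Q *v (Q *v axis k 1))"
      by (metis matrix_vector_mult_scaleR)
    then show ?thesis
      by (simp add: matrix_vector_mul_assoc QQ)
  qed
  define w where "w = transpose Q *v u"
  have "det (mat 1 + ?R u v) = det (transpose Q ** (mat 1 + ?R u v) ** Q)"
  proof -
    have "det (transpose Q) * det Q = 1"
      by (metis QQ(1) det_I det_mul)
    then show ?thesis
      by (simp add: det_mul mult.commute)
  qed
  also have "transpose Q ** (mat 1 + ?R u v) ** Q = mat 1 + ?R w (norm v *\<^sub>R axis k 1)"
  proof -
    have "transpose Q ** (mat 1 + ?R u v) ** Q = transpose Q ** (mat 1 ** Q + ?R u v ** Q)"
      by (simp only: matrix_mul_assoc[symmetric] matrix_add_rdistrib)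
    also have "\<dots> = mat 1 + transpose Q ** ?R u v ** Q"
      by (simp only: matrix_add_ldistrib matrix_mul_lid QQ matrix_mul_assoc)
    finally show ?thesis
      by (simp only: rank v w_def)
  qed
  also have "\<dots> = (\<chi> i j. if j = k then (mat 1 *v (axis k 1 + norm v *\<^sub>R w)) $ i else (mat 1 :: real^'n^'n) $ i $ j)"
    unfolding matrix_vector_mul_lid by (simp add: vec_eq_iff mat_def axis_def)
  also have "det \<dots> = (axis k 1 + norm v *\<^sub>R w) $ k"
    by (subst cramer_lemma) (simp add: det_I)
  also have "\<dots> = 1 + w \<bullet> (norm v *\<^sub>R axis k 1)"
    by (simp add: inner_axis)
  also have "w \<bullet> (norm v *\<^sub>R axis k 1) = u \<bullet> v"
  proof -
    have "w \<bullet> (norm v *\<^sub>R axis k 1) = (u v* Q) \<bullet> (transpose Q *v v)"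
    proof -
      have "w = u v* Q" by (simp only: w_def transpose_matrix_vector)
      then show ?thesis by (simp only: v)
    qed
    also have "\<dots> = u \<bullet> (Q *v (transpose Q *v v))"
      by (rule dot_lmul_matrix)
    also have "\<dots> = u \<bullet> v"
      by (simp only: matrix_vector_mul_assoc QQ matrix_vector_mul_lid)
    finally show ?thesis .
  qed
  finally show ?thesis by simp
qed

text \<open>The quadratic form of \<open>f\<close> has a maximiser on the unit sphere of the invariant subspace, and a
  maximiser is an eigenvector.\<close>

lemma selfadjoint_eigenvector:
  fixes f :: "'a::euclidean_space \<Rightarrow> 'a"
  assumes f: "linear f" "\<And>x y. f x \<bullet> y = x \<bullet> f y"
    and S: "subspace S" "S \<noteq> {0}" "\<And>x. x \<in> S \<Longrightarrow> f x \<in> S"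
  obtains e c where "e \<in> S" "norm e = 1" "f e = c *\<^sub>R e"
proof -
  let ?U = "S \<inter> sphere 0 1"
  have "compact ?U"
    using closed_subspace[OF S(1)] by (simp add: closed_Int_compact)
  moreover have "?U \<noteq> {}"
  proof -
    obtain x where "x \<in> S" "x \<noteq> 0"
      using S(1,2) subspace_0 by blast
    then have "x /\<^sub>R norm x \<in> ?U"
      using S(1) by (simp add: subspace_scale)
    then show ?thesis by blast
  qed
  moreover have "continuous_on ?U (\<lambda>x. x \<bullet> f x)"
    using f(1) by (intro continuous_intros linear_continuous_on) (simp add: linear_conv_bounded_linear)
  ultimately obtain e where e: "e \<in> ?U" "\<And>x. x \<in> ?U \<Longrightarrow> x \<bullet> f x \<le> e \<bullet> f e"
    using continuous_attains_sup[of ?U "\<lambda>x. x \<bullet> f x"] by blast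
  define c where "c = e \<bullet> f e"
  have le: "x \<bullet> f x \<le> c * (norm x)\<^sup>2" if "x \<in> S" for x
  proof (cases "x = 0")
    case False
    then have "x /\<^sub>R norm x \<in> ?U"
      using S(1) that by (simp add: subspace_scale)
    then have "(x /\<^sub>R norm x) \<bullet> f (x /\<^sub>R norm x) \<le> c"
      using e(2) c_def by blast
    then have "x \<bullet> f x / (norm x)\<^sup>2 \<le> c"
      by (simp add: linear_scale[OF f(1)] power2_eq_square divide_inverse mult_ac)
    then show ?thesis
      using False by (simp add: divide_le_eq)
  qed (simp add: linear_0[OF f(1)])
  \<comment> \<open>First-order condition at the maximiser, tested against the residual itself.\<close>
  define w where "w = f e - c *\<^sub>R e"
  have eS: "e \<in> S" and e1: "norm e = 1" using e(1) by auto
  have wS: "w \<in> S"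
    unfolding w_def using eS S by (intro subspace_diff subspace_scale) auto
  have "2 * t * (w \<bullet> w) \<le> t\<^sup>2 * (c * (w \<bullet> w) - w \<bullet> f w)" for t :: real
  proof -
    have "(e + t *\<^sub>R w) \<bullet> f (e + t *\<^sub>R w) \<le> c * (norm (e + t *\<^sub>R w))\<^sup>2"
      using eS wS S(1) by (intro le subspace_add subspace_scale)
    moreover have "(norm (e + t *\<^sub>R w))\<^sup>2 = e \<bullet> e + 2 * t * (w \<bullet> e) + t\<^sup>2 * (w \<bullet> w)"
      by (simp add: power2_norm_eq_inner inner_add_left inner_add_right inner_commute algebra_simps)
         (simp add: power2_eq_square)
    moreover have "(e + t *\<^sub>R w) \<bullet> f (e + t *\<^sub>R w) = e \<bullet> f e + 2 * t * (w \<bullet> f e) + t\<^sup>2 * (w \<bullet> f w)"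
      using f(2)[of e w]
      by (simp add: linear_add[OF f(1)] linear_scale[OF f(1)] inner_add_left inner_add_right inner_commute algebra_simps)
         (simp add: power2_eq_square)
    ultimately have "e \<bullet> f e + 2 * t * (w \<bullet> f e) + t\<^sup>2 * (w \<bullet> f w)
       \<le> c * (e \<bullet> e) + 2 * t * (c * (w \<bullet> e)) + t\<^sup>2 * (c * (w \<bullet> w))"
      by (simp add: algebra_simps)
    moreover have "e \<bullet> e = 1"
      using e1 by (simp add: dot_square_norm)
    moreover have "w \<bullet> f e - c * (w \<bullet> e) = w \<bullet> w"
      by (simp add: w_def inner_diff_right)
    then have "2 * t * (w \<bullet> f e) = 2 * t * (c * (w \<bullet> e)) + 2 * t * (w \<bullet> w)"
      by (simp add: algebra_simps flip: distrib_left)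
    ultimately show ?thesis
      unfolding c_def by (simp add: algebra_simps)
  qed
  note quad = this
  have "w \<bullet> w = 0"
  proof (rule ccontr)
    assume "w \<bullet> w \<noteq> 0"
    then have pos: "w \<bullet> w > 0" by simp
    define B where "B = \<bar>c * (w \<bullet> w) - w \<bullet> f w\<bar> + 1"
    have "B > 0" by (simp add: B_def)
    define t where "t = (w \<bullet> w) / B"
    have t: "t > 0" using pos \<open>B > 0\<close> by (simp add: t_def)
    have "2 * t * (w \<bullet> w) \<le> t\<^sup>2 * B"
    proof -
      have "t\<^sup>2 * (c * (w \<bullet> w) - w \<bullet> f w) \<le> t\<^sup>2 * B"
        by (intro mult_left_mono) (auto simp: B_def)
      then show ?thesis using quad[of t] by linarith
    qed
    then have "2 * (w \<bullet> w) \<le> t * B"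
      using t by (simp add: power2_eq_square)
    then show False
      using pos \<open>B > 0\<close> by (simp add: t_def)
  qed
  then have "f e = c *\<^sub>R e"
    by (simp add: w_def)
  with eS e1 show ?thesis by (rule that)
qed

text \<open>Induction on the dimension: the orthogonal complement of an eigenvector is invariant again.\<close>

lemma selfadjoint_eigenbasis_subspace:
  fixes f :: "'a::euclidean_space \<Rightarrow> 'a"
  assumes f: "linear f" "\<And>x y. f x \<bullet> y = x \<bullet> f y"
    and S: "subspace S" "\<And>x. x \<in> S \<Longrightarrow> f x \<in> S"
  shows "\<exists>B. finite B \<and> B \<subseteq> S \<and> card B = dim S \<and> pairwise orthogonal B \<and>
    (\<forall>b\<in>B. norm b = 1 \<and> (\<exists>c. f b = c *\<^sub>R b))"
  using S
proof (induction "dim S" arbitrary: S)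
  case 0
  then show ?case by (intro exI[of _ "{}"]) auto
next
  case (Suc k)
  have "S \<noteq> {0}" using Suc.hyps(2) by auto
  obtain e c where e: "e \<in> S" "norm e = 1" "f e = c *\<^sub>R e"
    by (rule selfadjoint_eigenvector[OF f Suc.prems(1) \<open>S \<noteq> {0}\<close> Suc.prems(2)])
  define S' where "S' = {x \<in> S. orthogonal e x}"
  have S': "subspace S'"
    unfolding S'_def using Suc.prems(1)
    by (auto simp: subspace_def orthogonal_def inner_add_right)
  have inv: "f x \<in> S'" if "x \<in> S'" for x
  proof -
    have "e \<bullet> f x = c * (e \<bullet> x)"
      by (metis e(3) f(2) inner_scaleR_left)
    then show ?thesis
      using that Suc.prems(2)[of x] by (simp add: S'_def orthogonal_def)
  qed
  have "e \<noteq> 0" using e(2) by auto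
  have "dim S' + dim (span {e}) = dim (span S)"
  proof -
    have "S' = {x \<in> span S. \<forall>y \<in> span {e}. orthogonal y x}"
    proof -
      have "(\<forall>y\<in>span {e}. orthogonal y x) \<longleftrightarrow> orthogonal e x" for x
        by (auto simp: span_singleton orthogonal_def dest: spec[of _ 1])
      moreover have "span S = S"
        using Suc.prems(1) by (simp add: span_eq_iff)
      ultimately show ?thesis
        unfolding S'_def by (simp only:)
    qed
    moreover have "span {e} \<subseteq> span S"
      using e(1) by (simp add: span_mono)
    ultimately show ?thesis
      using dim_subspace_orthogonal_to_vectors[of "span {e}" "span S"] by simp
  qed
  then have "dim S' = k"
    using Suc.hyps(2) \<open>e \<noteq> 0\<close> by (simp add: dim_span)
  then obtain B where B: "finite B" "B \<subseteq> S'" "card B = k" "pairwise orthogonal B"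
      "\<forall>b\<in>B. norm b = 1 \<and> (\<exists>c. f b = c *\<^sub>R b)"
    using Suc.hyps(1)[OF _ S' inv] by auto
  have "e \<notin> B"
    using B(2) \<open>e \<noteq> 0\<close> by (auto simp: S'_def orthogonal_def)
  then have "card (insert e B) = dim S"
    using B(1,3) Suc.hyps(2) by simp
  moreover have "insert e B \<subseteq> S"
    using B(2) e(1) by (auto simp: S'_def)
  moreover have "pairwise orthogonal (insert e B)"
    using B(2,4) by (simp add: pairwise_insert S'_def subset_iff orthogonal_commute[of _ e])
  moreover have "\<forall>b\<in>insert e B. norm b = 1 \<and> (\<exists>c. f b = c *\<^sub>R b)"
    using B(5) e(2,3) by blast
  ultimately show ?case
    using B(1) by (intro exI[of _ "insert e B"]) blast
qed

definition diag_matrix :: "('n \<Rightarrow> real) \<Rightarrow> real^'n^'n" where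
  "diag_matrix d = (\<chi> i j. if i = j then d i else 0)"

lemma diag_matrix_mult: "diag_matrix a ** diag_matrix b = diag_matrix (\<lambda>i. a i * b i)"
proof -
  have "(\<Sum>k\<in>UNIV. (if i = k then a i else 0) * (if k = j then b k else 0)) =
      (\<Sum>k\<in>UNIV. if k = i then (if i = j then a i * b i else 0) else 0)" for i j
    by (intro sum.cong) auto
  then show ?thesis
    by (simp add: diag_matrix_def matrix_matrix_mult_def vec_eq_iff)
qed

lemma symmetric_matrix_diagonalisation:
  fixes A :: "real^'n^'n"
  assumes sym: "transpose A = A"
  obtains Q d where "orthogonal_matrix Q" "transpose Q ** A ** Q = diag_matrix d"
proof -
  have adj: "(A *v x) \<bullet> y = x \<bullet> (A *v y)" for x y :: "real^'n"
    by (metis dot_lmul_matrix sym transpose_matrix_vector)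
  obtain B where B: "finite B" "card B = CARD('n)" "pairwise orthogonal B"
      "\<And>b. b \<in> B \<Longrightarrow> norm b = 1" "\<And>b. b \<in> B \<Longrightarrow> \<exists>c. A *v b = c *\<^sub>R b"
    using selfadjoint_eigenbasis_subspace[OF matrix_vector_mul_linear[of A] adj subspace_UNIV] by auto
  obtain f where f: "bij_betw f (UNIV :: 'n set) B"
    using finite_same_card_bij[of "UNIV :: 'n set" B] B by auto
  have fB: "f i \<in> B" for i
    using bij_betw_apply[OF f] by simp
  obtain d where d: "\<And>i. A *v f i = d i *\<^sub>R f i"
    using B(5)[OF fB] that by metis
  have on: "f i \<bullet> f j = (if i = j then 1 else 0)" for i j
  proof (cases "i = j")
    case True
    have "norm (f i) = 1" using B(4)[OF fB] .
    then show ?thesis using True by (simp add: dot_square_norm)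
  next
    case False
    then have "f i \<noteq> f j" using f by (auto simp: bij_betw_def inj_on_def)
    then show ?thesis
      using False B(3) fB[of i] fB[of j] by (simp add: pairwise_def orthogonal_def)
  qed
  define Q :: "real^'n^'n" where "Q = (\<chi> i j. f j $ i)"
  have "transpose Q ** Q = mat 1"
    using on by (simp add: Q_def matrix_matrix_mult_def transpose_def mat_def vec_eq_iff inner_vec_def)
  then have "orthogonal_matrix Q"
    by (simp add: orthogonal_matrix)
  moreover have "transpose Q ** A ** Q = diag_matrix d"
  proof -
    have "(A ** Q) $ i $ j = d j * f j $ i" for i j
    proof -
      have "(A ** Q) $ i $ j = (A *v f j) $ i"
        by (simp add: Q_def matrix_matrix_mult_def matrix_vector_mult_def)
      then show ?thesis by (simp add: d)
    qed
    note AQ = this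
    have "(transpose Q ** (A ** Q)) $ i $ j = d j * (f i \<bullet> f j)" for i j
    proof -
      have "(transpose Q ** (A ** Q)) $ i $ j = (\<Sum>k\<in>UNIV. transpose Q $ i $ k * (A ** Q) $ k $ j)"
        by (simp add: matrix_matrix_mult_def)
      also have "\<dots> = d j * (f i \<bullet> f j)"
        unfolding AQ by (simp add: Q_def transpose_def inner_vec_def sum_distrib_left mult_ac)
      finally show ?thesis .
    qed
    then show ?thesis
      unfolding matrix_mul_assoc[symmetric] by (simp add: vec_eq_iff on diag_matrix_def)
  qed
  ultimately show ?thesis by (rule that)
qed

definition matrix_trace :: "real^'n^'n \<Rightarrow> real" where
  "matrix_trace A = (\<Sum>i\<in>UNIV. A $ i $ i)"

lemma matrix_trace_commute: "matrix_trace (A ** B) = matrix_trace (B ** A)"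
  unfolding matrix_trace_def matrix_matrix_mult_def
  unfolding vec_lambda_beta by (subst sum.swap) (simp only: mult.commute)

text \<open>Rescaling the vectors of an orthonormal eigenbasis by the inverse square roots of the eigenvalues.\<close>

lemma posdef_congruent_identity:
  fixes A :: "real^'n^'n"
  assumes sym: "transpose A = A" and psd: "\<And>x. 0 \<le> x \<bullet> (A *v x)" and det: "det A \<noteq> 0"
  obtains E :: "real^'n^'n" where "transpose E ** A ** E = mat 1"
proof -
  obtain Q d where Q: "orthogonal_matrix Q"
    and D: "transpose Q ** A ** Q = diag_matrix d"
    using symmetric_matrix_diagonalisation[OF sym] .
  have QQ: "transpose Q ** Q = mat 1"
    using Q by (simp add: orthogonal_matrix_def)
  have entry: "x \<bullet> ((transpose B ** A ** B) *v x) = (B *v x) \<bullet> (A *v (B *v x))" for B :: "real^'n^'n" and x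
    by (metis dot_lmul_matrix matrix_vector_mul_assoc transpose_matrix_vector transpose_transpose)
  have "d k \<ge> 0" for k
  proof -
    have "d k = axis k 1 \<bullet> ((transpose Q ** A ** Q) *v axis k 1)"
      by (simp add: D inner_axis' matrix_vector_mult_basis column_def diag_matrix_def)
    also have "\<dots> \<ge> 0"
      unfolding entry by (rule psd)
    finally show ?thesis .
  qed
  moreover have "d k \<noteq> 0" for k
  proof -
    have "(\<Prod>i\<in>UNIV. d i) = det (transpose Q ** A ** Q)"
      unfolding D by (subst det_diagonal) (auto simp: diag_matrix_def)
    also have "\<dots> = det A"
    proof -
      have "det (transpose Q) * det Q = 1"
        by (metis QQ det_I det_mul)
      then show ?thesis
        by (simp add: det_mul mult.commute)
    qed
    finally show ?thesis
      using det by (metis UNIV_I finite prod_zero)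
  qed
  ultimately have pos: "d k > 0" for k
    by (metis less_eq_real_def)
  define R :: "real^'n^'n" where "R = diag_matrix (\<lambda>i. 1 / sqrt (d i))"
  have "transpose R ** (transpose Q ** A ** Q) ** R = mat 1"
  proof -
    have "transpose R = R"
      by (simp add: R_def diag_matrix_def transpose_def vec_eq_iff)
    moreover have "R ** diag_matrix d ** R = mat 1"
    proof -
      have "1 / sqrt (d i) * d i * (1 / sqrt (d i)) = 1" for i
        using pos[of i] by (simp add: real_sqrt_mult_self)
      then have "R ** diag_matrix d ** R = diag_matrix (\<lambda>_. 1)"
        by (simp only: R_def diag_matrix_mult)
      then show ?thesis
        by (simp add: diag_matrix_def mat_def)
    qed
    ultimately show ?thesis by (simp only: D)
  qed
  then have "transpose (Q ** R) ** A ** (Q ** R) = mat 1"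
    by (simp add: matrix_transpose_mul matrix_mul_assoc)
  then show ?thesis by (rule that)
qed

text \<open>The eigenvalues are positive with product one. Summing \<open>ln d \<le> d - 1\<close> over them gives the inequality
  between their arithmetic and geometric means.\<close>

lemma card_le_trace_if_det_1:
  fixes C :: "real^'n^'n"
  assumes sym: "transpose C = C" and psd: "\<And>x. 0 \<le> x \<bullet> (C *v x)" and det: "det C = 1"
  shows "real CARD('n) \<le> matrix_trace C"
proof -
  obtain Q d where Q: "orthogonal_matrix Q"
    and D: "transpose Q ** C ** Q = diag_matrix d"
    using symmetric_matrix_diagonalisation[OF sym] .
  have QQ: "transpose Q ** Q = mat 1" "Q ** transpose Q = mat 1"
    using Q by (auto simp: orthogonal_matrix_def)
  have tr: "matrix_trace C = (\<Sum>i\<in>UNIV. d i)"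
  proof -
    have "matrix_trace (transpose Q ** C ** Q) = matrix_trace (Q ** (transpose Q ** C))"
      by (rule matrix_trace_commute)
    also have "\<dots> = matrix_trace C"
      by (simp add: matrix_mul_assoc QQ)
    finally show ?thesis
      by (simp add: D matrix_trace_def diag_matrix_def)
  qed
  have prod: "(\<Prod>i\<in>UNIV. d i) = 1"
  proof -
    have "(\<Prod>i\<in>UNIV. d i) = det (transpose Q ** C ** Q)"
      unfolding D by (subst det_diagonal) (auto simp: diag_matrix_def)
    also have "\<dots> = det (transpose Q) * det Q"
      by (simp add: det_mul det)
    also have "\<dots> = 1"
      by (metis QQ(1) det_I det_mul)
    finally show ?thesis .
  qed
  have pos: "d k > 0" for k
  proof -
    have "d k = axis k 1 \<bullet> ((transpose Q ** C ** Q) *v axis k 1)"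
      by (simp add: D inner_axis' matrix_vector_mult_basis column_def diag_matrix_def)
    also have "\<dots> = (Q *v axis k 1) \<bullet> (C *v (Q *v axis k 1))"
      by (metis dot_lmul_matrix matrix_vector_mul_assoc transpose_matrix_vector transpose_transpose)
    also have "\<dots> \<ge> 0"
      by (rule psd)
    finally have "d k \<ge> 0" .
    moreover have "d k \<noteq> 0"
      using prod by (metis UNIV_I finite prod_zero zero_neq_one)
    ultimately show ?thesis by simp
  qed
  have "0 = ln (\<Prod>i\<in>UNIV. d i)"
    by (simp add: prod)
  also have "\<dots> = (\<Sum>i\<in>UNIV. ln (d i))"
    by (rule ln_prod) (metis pos less_irrefl finite)+
  also have "\<dots> \<le> (\<Sum>i\<in>UNIV. d i - 1)"
    by (intro sum_mono ln_le_minus_one pos)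
  also have "\<dots> = matrix_trace C - real CARD('n)"
    by (simp add: tr sum_subtractf)
  finally show ?thesis by simp
qed

text \<open>The inequality between the arithmetic and geometric means for the eigenvalues of \<open>B\<close> relative to \<open>A\<close>.\<close>

lemma card_le_relative_trace:
  fixes A B E :: "real^'n^'n"
  assumes E: "transpose E ** A ** E = mat 1"
    and B: "transpose B = B" "\<And>x. 0 \<le> x \<bullet> (B *v x)" and det: "det B = det A"
  shows "real CARD('n) \<le> matrix_trace (transpose E ** B ** E)"
proof (rule card_le_trace_if_det_1)
  show "transpose (transpose E ** B ** E) = transpose E ** B ** E"
    by (simp add: matrix_transpose_mul B(1) matrix_mul_assoc)
  show "0 \<le> x \<bullet> ((transpose E ** B ** E) *v x)" for x
  proof -
    have "x \<bullet> ((transpose E ** B ** E) *v x) = (E *v x) \<bullet> (B *v (E *v x))"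
      by (metis dot_lmul_matrix matrix_vector_mul_assoc transpose_matrix_vector transpose_transpose)
    then show ?thesis using B(2) by simp
  qed
  have "det (transpose E ** B ** E) = det (transpose E ** A ** E)"
    by (simp add: det_mul det)
  then show "det (transpose E ** B ** E) = 1"
    by (simp add: E det_I)
qed

section \<open>Area on hyperplanes and the volume of cones\<close>

text \<open>Both sides are the double integral of \<open>indicator A (x + y) * indicator B y\<close>, computed in the two orders
  of integration. The set \<open>P\<close> admits measures that live on a subspace and are invariant under
  the translations of that subspace only.\<close>

lemma translation_invariant_measures_proportional:
  fixes M N :: "'a::euclidean_space measure"
  assumes [measurable_cong, simp]: "sets M = sets borel" "sets N = sets borel"
    and sf: "sigma_finite_measure M" "sigma_finite_measure N"
    and conc: "AE x in M. x \<in> P" "AE x in N. x \<in> P"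
    and P: "\<And>x. x \<in> P \<Longrightarrow> - x \<in> P"
    and invM: "\<And>w A. w \<in> P \<Longrightarrow> A \<in> sets borel \<Longrightarrow> emeasure M ((+) w -` A) = emeasure M A"
    and invN: "\<And>w A. w \<in> P \<Longrightarrow> A \<in> sets borel \<Longrightarrow> emeasure N ((+) w -` A) = emeasure N A"
    and [measurable]: "A \<in> sets borel" "B \<in> sets borel"
  shows "emeasure M A * emeasure N B = emeasure N A * emeasure M (uminus -` B)"
proof -
  have spc [simp]: "space M = UNIV" "space N = UNIV"
    using sets_eq_imp_space_eq[of M borel] sets_eq_imp_space_eq[of N borel] by simp_all
  interpret MN: pair_sigma_finite M N
    using sf by (simp add: pair_sigma_finite_def)
  have b: "{z \<in> A. z - x \<in> B} \<in> sets borel" "{z. - z \<in> B} \<in> sets borel" for x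
    by measurable
  have plus: "(+) x -` S \<in> sets borel" if "S \<in> sets borel" for x :: 'a and S
    using measurable_sets[of "(+) x" borel borel S] that by simp
  have "emeasure M A * emeasure N B = (\<integral>\<^sup>+y. emeasure M A * indicator B y \<partial>N)"
    by (simp add: nn_integral_cmult_indicator)
  also have "\<dots> = (\<integral>\<^sup>+y. (\<integral>\<^sup>+x. indicator A (x + y) * indicator B y \<partial>M) \<partial>N)"
  proof (rule nn_integral_cong_AE, use conc(2) in eventually_elim)
    fix y assume y: "y \<in> P"
    have "(\<integral>\<^sup>+x. indicator A (x + y) * indicator B y \<partial>M) = (\<integral>\<^sup>+x. indicator ((+) y -` A) x \<partial>M) * indicator B y"
      by (simp add: nn_integral_multc indicator_def add.commute)
    also have "(\<integral>\<^sup>+x. indicator ((+) y -` A) x \<partial>M) = emeasure M A"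
      using invM[OF y, of A] plus[of A y] by (subst nn_integral_indicator) auto
    finally show "emeasure M A * indicator B y = (\<integral>\<^sup>+x. indicator A (x + y) * indicator B y \<partial>M)" ..
  qed
  also have "\<dots> = (\<integral>\<^sup>+x. (\<integral>\<^sup>+y. indicator A (x + y) * indicator B y \<partial>N) \<partial>M)"
    by (rule MN.Fubini') measurable
  also have "\<dots> = (\<integral>\<^sup>+x. (\<integral>\<^sup>+z. indicator A z * indicator B (z - x) \<partial>N) \<partial>M)"
  proof (rule nn_integral_cong_AE, use conc(1) in eventually_elim)
    fix x assume x: "x \<in> P"
    have "(\<integral>\<^sup>+y. indicator A (x + y) * indicator B y \<partial>N) = (\<integral>\<^sup>+y. indicator ((+) x -` {z \<in> A. z - x \<in> B}) y \<partial>N)"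
      by (intro nn_integral_cong) (auto simp: indicator_def)
    also have "\<dots> = emeasure N ((+) x -` {z \<in> A. z - x \<in> B})"
      using plus[OF b(1)] by (subst nn_integral_indicator) auto
    also have "\<dots> = emeasure N {z \<in> A. z - x \<in> B}"
      by (rule invN[OF x b(1)])
    also have "\<dots> = (\<integral>\<^sup>+z. indicator {z \<in> A. z - x \<in> B} z \<partial>N)"
      using b(1) by (subst nn_integral_indicator) auto
    also have "\<dots> = (\<integral>\<^sup>+z. indicator A z * indicator B (z - x) \<partial>N)"
      by (intro nn_integral_cong) (auto simp: indicator_def)
    finally show "(\<integral>\<^sup>+y. indicator A (x + y) * indicator B y \<partial>N) = (\<integral>\<^sup>+z. indicator A z * indicator B (z - x) \<partial>N)" .
  qed
  also have "\<dots> = (\<integral>\<^sup>+z. (\<integral>\<^sup>+x. indicator A z * indicator B (z - x) \<partial>M) \<partial>N)"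
    by (rule MN.Fubini'[symmetric]) measurable
  also have "\<dots> = (\<integral>\<^sup>+z. indicator A z * emeasure M (uminus -` B) \<partial>N)"
  proof (rule nn_integral_cong_AE, use conc(2) in eventually_elim)
    fix z assume z: "z \<in> P"
    have "(\<integral>\<^sup>+x. indicator A z * indicator B (z - x) \<partial>M) = indicator A z * (\<integral>\<^sup>+x. indicator ((+) (- z) -` (uminus -` B)) x \<partial>M)"
      by (subst nn_integral_cmult[symmetric]) (auto intro!: nn_integral_cong simp: indicator_def)
    also have "(\<integral>\<^sup>+x. indicator ((+) (- z) -` (uminus -` B)) x \<partial>M) = emeasure M ((+) (- z) -` (uminus -` B))"
      using plus[OF b(2)] by (subst nn_integral_indicator) (auto simp: vimage_def)
    also have "\<dots> = emeasure M (uminus -` B)"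
      using b(2) by (intro invM P z) (auto simp: vimage_def)
    finally show "(\<integral>\<^sup>+x. indicator A z * indicator B (z - x) \<partial>M) = indicator A z * emeasure M (uminus -` B)" .
  qed
  also have "\<dots> = emeasure N A * emeasure M (uminus -` B)"
    by (simp add: nn_integral_multc)
  finally show ?thesis .
qed

lemma emeasure_density_indicator:
  assumes "A \<in> sets M" "B \<in> sets M"
  shows "emeasure (density M (indicator A)) B = emeasure M (A \<inter> B)"
proof -
  have "emeasure (density M (indicator A)) B = (\<integral>\<^sup>+x. indicator A x * indicator B x \<partial>M)"
    using assms by (intro emeasure_density) auto
  also have "\<dots> = (\<integral>\<^sup>+x. indicator (A \<inter> B) x \<partial>M)"
    by (intro nn_integral_cong) (auto simp: indicator_def)
  finally show ?thesis
    using assms by simp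
qed

lemma area_measure_unit_face:
  assumes n: "CARD('n) \<ge> 2"
  shows "emeasure area_measure (unit_face :: (real^'n) set) = 1"
proof -
  have "(unit_face :: (real^'n) set) \<in> sets borel" by (simp add: unit_face_def)
  then show ?thesis
    using hausdorff_outer_unit_face_pos[OF n] hausdorff_outer_unit_face_finite[OF n]
    unfolding emeasure_area_measure[OF n \<open>unit_face \<in> sets borel\<close>]
    by (intro ennreal_divide_self) (simp_all add: less_top)
qed

lemma area_measure_lipschitz_image:
  fixes A :: "(real^'n) set" and f :: "real^'n \<Rightarrow> real^'n"
  assumes n: "CARD('n) \<ge> 2" and A: "A \<in> sets borel" "f ` A \<in> sets borel"
    and L: "L > 0" "\<And>x y. x \<in> A \<Longrightarrow> y \<in> A \<Longrightarrow> dist (f x) (f y) \<le> L * dist x y"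
  shows "emeasure area_measure (f ` A) \<le> ennreal (L ^ (CARD('n) - 1)) * emeasure area_measure A"
proof -
  have "hausdorff_outer (CARD('n) - 1) (f ` A) \<le> ennreal (L ^ (CARD('n) - 1)) * hausdorff_outer (CARD('n) - 1) A"
    by (rule hausdorff_outer_lipschitz_image) (use n L in auto)
  then show ?thesis
    by (simp add: emeasure_area_measure[OF n A(1)] emeasure_area_measure[OF n A(2)] divide_ennreal_def
        mult.assoc[symmetric] mult_right_mono)
qed

text \<open>The Lipschitz bound, applied to the map and to its inverse.\<close>

lemma area_measure_similarity_image:
  fixes A :: "(real^'n) set" and f :: "real^'n \<Rightarrow> real^'n"
  assumes n: "CARD('n) \<ge> 2" and A: "A \<in> sets borel" "f ` A \<in> sets borel"
    and L: "L > 0" "\<And>x y. x \<in> A \<Longrightarrow> y \<in> A \<Longrightarrow> dist (f x) (f y) = L * dist x y"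
  shows "emeasure area_measure (f ` A) = ennreal (L ^ (CARD('n) - 1)) * emeasure area_measure A"
proof (rule antisym)
  show "emeasure area_measure (f ` A) \<le> ennreal (L ^ (CARD('n) - 1)) * emeasure area_measure A"
    by (rule area_measure_lipschitz_image[OF n A]) (use L in auto)
  have inj: "inj_on f A"
    using L by (intro inj_onI) (metis dist_eq_0_iff less_irrefl mult_eq_0_iff)
  let ?g = "inv_into A f"
  have im: "?g ` (f ` A) = A"
    using inj by (simp add: inv_into_image_cancel)
  have "emeasure area_measure (?g ` (f ` A)) \<le> ennreal ((1 / L) ^ (CARD('n) - 1)) * emeasure area_measure (f ` A)"
  proof (rule area_measure_lipschitz_image[OF n A(2)])
    show "?g ` f ` A \<in> sets borel" using A im by simp
    fix x y assume "x \<in> f ` A" "y \<in> f ` A"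
    then show "dist (?g x) (?g y) \<le> 1 / L * dist x y"
      using L inj by (auto simp: inv_into_f_f)
  qed (use L in auto)
  then have "ennreal (L ^ (CARD('n) - 1)) * emeasure area_measure A \<le>
      ennreal (L ^ (CARD('n) - 1)) * (ennreal ((1 / L) ^ (CARD('n) - 1)) * emeasure area_measure (f ` A))"
    unfolding im by (rule mult_left_mono) simp
  also have "\<dots> = emeasure area_measure (f ` A)"
    using L(1) by (simp add: mult.assoc[symmetric] power_one_over flip: ennreal_mult')
  finally show "ennreal (L ^ (CARD('n) - 1)) * emeasure area_measure A \<le> emeasure area_measure (f ` A)" .
qed

text \<open>Up to a null set the cube is the disjoint union of the cones with apex at the origin over its facets not
  containing the origin. These are permuted by exchanging coordinates.\<close>

lemma emeasure_pyramid:
  fixes k :: "'n::finite"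
  assumes n: "CARD('n) \<ge> 2"
  shows "of_nat CARD('n) * emeasure lborel {x :: real^'n. 0 < x $ k \<and> x $ k \<le> 1 \<and> (\<forall>i. 0 \<le> x $ i \<and> x $ i \<le> x $ k)} = 1"
proof -
  define W where "W k = {x :: real^'n. 0 < x $ k \<and> x $ k \<le> 1 \<and> (\<forall>i. 0 \<le> x $ i \<and> x $ i \<le> x $ k)}" for k
  have W [measurable]: "W k \<in> sets borel" for k
    unfolding W_def by measurable
  have swap: "emeasure lborel (W j) = emeasure lborel (W k)" for j
  proof -
    define p where "p = Transposition.transpose j k"
    define s :: "real^'n \<Rightarrow> real^'n" where "s x = (\<chi> i. x $ p i)" for x
    have p: "p permutes UNIV" "p (p i) = i" for i
      by (simp_all add: p_def permutes_swap_id)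
    have lin: "linear s"
      by (rule linearI) (simp_all add: s_def vec_eq_iff)
    have "matrix s = (\<chi> i. mat 1 $ p i)"
      by (auto simp: matrix_def s_def vec_eq_iff mat_def axis_def)
    then have "det (matrix s) = of_int (sign p)"
      using det_permute_rows[OF p(1), of "mat 1 :: real^'n^'n"] by simp
    then have "\<bar>det (matrix s)\<bar> = 1"
      by (simp add: sign_def)
    then have "emeasure lborel (W k) = emeasure (distr lborel borel s) (W k)"
      by (simp add: lborel_distr_linear[OF lin])
    also have "\<dots> = emeasure lborel (s -` W k)"
      using lin by (subst emeasure_distr) (auto intro!: borel_measurable_continuous_onI linear_continuous_on simp: linear_conv_bounded_linear)
    also have "s -` W k = W j"
    proof -
      have "(\<forall>i. Q (p i)) \<longleftrightarrow> (\<forall>i. Q i)" for Q :: "'n \<Rightarrow> bool"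
        using p(2) by metis
      from this[of "\<lambda>i. 0 \<le> x $ i \<and> x $ i \<le> x $ j" for x] show ?thesis
        by (auto simp: W_def s_def p_def)
    qed
    finally show ?thesis ..
  qed
  have distinct: "AE x in lborel. \<forall>i j. i \<noteq> j \<longrightarrow> (x :: real^'n) $ i \<noteq> x $ j"
  proof -
    have "AE x in lborel. (x :: real^'n) $ i \<noteq> x $ j" if "i \<noteq> j" for i j
    proof -
      have "axis i 1 - axis j (1::real) \<noteq> 0"
        using that by (auto simp: vec_eq_iff axis_def)
      then have "negligible {x :: real^'n. (axis i 1 - axis j 1) \<bullet> x = 0}"
        by (intro negligible_hyperplane) auto
      moreover have "{x :: real^'n. (axis i 1 - axis j 1) \<bullet> x = 0} = {x. x $ i = x $ j}"
        by (auto simp: inner_diff_left inner_axis')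
      ultimately have "emeasure lborel {x :: real^'n. x $ i = x $ j} = 0"
        by (simp add: negligible_iff_emeasure0)
      then show ?thesis
        by (subst AE_iff_measurable[of "{x. x $ i = x $ j}"]) auto
    qed
    then show ?thesis by (simp add: AE_all_countable)
  qed
  have "1 = emeasure lborel (cbox 0 1 :: (real^'n) set)"
  proof -
    have "measure lborel (cbox 0 1 :: (real^'n) set) = 1"
      by (subst content_cbox_cart) (auto simp: interval_eq_empty_cart)
    then show ?thesis
      using emeasure_lborel_cbox_finite[of "0 :: real^'n" 1] by (subst emeasure_eq_ennreal_measure) (auto simp: top.not_eq_extremum)
  qed
  also have "\<dots> = (\<integral>\<^sup>+x. indicator (cbox 0 1) x \<partial>(lborel :: (real^'n) measure))"
    by simp
  also have "\<dots> = (\<integral>\<^sup>+x. (\<Sum>j\<in>UNIV. indicator (W j) x) \<partial>lborel)"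
  proof (rule nn_integral_cong_AE, use distinct in eventually_elim)
    fix x :: "real^'n" assume x: "\<forall>i j. i \<noteq> j \<longrightarrow> x $ i \<noteq> x $ j"
    show "indicator (cbox 0 1) x = (\<Sum>j\<in>UNIV. indicator (W j) x :: ennreal)"
    proof (cases "x \<in> cbox 0 1")
      case False
      then have "x \<notin> W j" for j
        by (auto simp: W_def mem_box_cart) (meson order_trans)
      then show ?thesis using False by simp
    next
      case True
      define m where "m = Max (range (\<lambda>i. x $ i))"
      have "m \<in> range (\<lambda>i. x $ i)" unfolding m_def by (rule Max_in) auto
      then obtain a where a: "x $ a = m" by auto
      have le: "x $ i \<le> x $ a" for i unfolding a m_def by (rule Max_ge) auto
      obtain b where "b \<noteq> a"
      proof -
        have "\<not> (UNIV :: 'n set) \<subseteq> {a}"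
        proof
          assume "(UNIV :: 'n set) \<subseteq> {a}"
          then have "CARD('n) \<le> card {a}" by (rule card_mono[rotated]) simp
          then show False using n by simp
        qed
        then show ?thesis using that by blast
      qed
      then have "x $ a > 0"
        using le[of b] x True by (metis less_eq_real_def mem_box_cart(2) order_less_le_trans zero_index)
      then have "x \<in> W a"
        using le True by (auto simp: W_def mem_box_cart)
      moreover have "x \<notin> W j" if "j \<noteq> a" for j
      proof
        assume "x \<in> W j"
        then have "x $ a = x $ j" using le[of j] by (auto simp: W_def intro: antisym)
        then show False using x that by metis
      qed
      ultimately have "(\<Sum>j\<in>UNIV. indicator (W j) x) = (\<Sum>j\<in>UNIV. if j = a then 1 else (0::ennreal))"
        by (intro sum.cong) (auto simp: indicator_def)
      then show ?thesis using True by simp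
    qed
  qed
  also have "\<dots> = (\<Sum>j\<in>UNIV. emeasure lborel (W j))"
    by (subst nn_integral_sum) auto
  also have "\<dots> = (\<Sum>j\<in>(UNIV::'n set). emeasure lborel (W k))"
    by (intro sum.cong refl swap)
  also have "\<dots> = of_nat CARD('n) * emeasure lborel (W k)"
    by simp
  finally show ?thesis by (simp add: W_def)
qed

text \<open>For a hyperplane at height one, both the area and the volume of the cone are invariant under
  translations within the hyperplane, the latter because a shear maps the cones to each other.
  The constant of proportionality is that of the unit face, whose cone is a pyramid.\<close>

lemma area_measure_coordinate_hyperplane:
  fixes k :: "'n::finite"
  defines "k \<equiv> height_index"
  assumes n: "CARD('n) \<ge> 2" and A: "A \<in> sets borel" "\<And>x. x \<in> A \<Longrightarrow> x $ k = 1"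
  shows "emeasure area_measure (A :: (real^'n) set) =
    of_nat CARD('n) * emeasure lborel {x. 0 < x $ k \<and> x $ k \<le> 1 \<and> (1 / x $ k) *\<^sub>R x \<in> A}"
proof -
  define P :: "(real^'n) set" where "P = {x. x $ k = 0}"
  define M :: "(real^'n) measure" where "M = density area_measure (indicator P)"
  define S :: "(real^'n) set" where "S = {x. 0 < x $ k \<and> x $ k \<le> 1}"
  \<comment> \<open>Radial projection to the hyperplane at height one, followed by the translation to height zero.\<close>
  define \<psi> :: "real^'n \<Rightarrow> real^'n" where "\<psi> x = (1 / x $ k) *\<^sub>R x - axis k 1" for x
  define N :: "(real^'n) measure" where "N = distr (density lborel (indicator S)) borel \<psi>"
  have P [measurable]: "P \<in> sets borel" unfolding P_def by measurable
  have S [measurable]: "S \<in> sets borel" unfolding S_def by measurable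
  have \<psi> [measurable]: "\<psi> \<in> borel_measurable borel" unfolding \<psi>_def by measurable
  have sM: "sets M = sets borel" by (simp add: M_def)
  have sN: "sets N = sets borel" by (simp add: N_def)
  have eM: "emeasure M B = emeasure area_measure (P \<inter> B)" if "B \<in> sets borel" for B
    unfolding M_def using that by (subst emeasure_density_indicator) auto
  have eN: "emeasure N B = emeasure lborel {x \<in> S. \<psi> x \<in> B}" if [measurable]: "B \<in> sets borel" for B
  proof -
    have "emeasure N B = emeasure (density lborel (indicator S)) (\<psi> -` B)"
      unfolding N_def by (subst emeasure_distr) auto
    also have "\<dots> = emeasure lborel (S \<inter> \<psi> -` B)"
      using measurable_sets[OF \<psi>, of B] by (subst emeasure_density_indicator) auto
    also have "S \<inter> \<psi> -` B = {x \<in> S. \<psi> x \<in> B}" by auto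
    finally show ?thesis .
  qed
  have plus: "(+) x -` T \<in> sets borel" if "T \<in> sets borel" for x :: "real^'n" and T
    using measurable_sets[of "(+) x" borel borel T] that by simp
  have unit: "(unit_face :: (real^'n) set) \<subseteq> P" "(unit_face :: (real^'n) set) \<in> sets borel"
    by (auto simp: unit_face_iff P_def k_def) (simp add: unit_face_def)
  let ?F = "unit_face :: (real^'n) set"
  have key: "emeasure M B * emeasure N ?F = emeasure N B * emeasure M (uminus -` ?F)" if B: "B \<in> sets borel" for B
  proof (rule translation_invariant_measures_proportional[OF sM sN])
    show "sigma_finite_measure M"
    proof
      define C :: "nat \<Rightarrow> (real^'n) set" where "C i = cbox (\<chi> j. - real i) (\<chi> j. real i)" for i :: nat
      have cover: "(\<Union>i. C i) = UNIV"
      proof -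
        have "x \<in> (\<Union>i. C i)" for x :: "real^'n"
        proof -
          obtain i :: nat where i: "norm x \<le> real i" using real_arch_simple by blast
          have "\<bar>x $ j\<bar> \<le> real i" for j
            using component_le_norm_cart[of x j] i by linarith
          then have "x \<in> C i"
            by (auto simp: C_def mem_box_cart abs_le_iff minus_le_iff)
          then show ?thesis by blast
        qed
        then show ?thesis by auto
      qed
      have "emeasure M (C i) \<noteq> top" for i
      proof -
        define f where "f x = (2 * real (Suc i)) *\<^sub>R x - (\<chi> j. if j = k then 0 else real (Suc i))" for x :: "real^'n"
        have fF: "f ` ?F \<in> sets borel"
          unfolding f_def unit_face_def
          by (intro borel_compact compact_continuous_image continuous_intros compact_cbox)
        have "P \<inter> C i \<subseteq> f ` ?F"
        proof
          fix x assume x: "x \<in> P \<inter> C i"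
          define y where "y = (1 / (2 * real (Suc i))) *\<^sub>R (x + (\<chi> j. if j = k then 0 else real (Suc i)))"
          have "x = f y" by (simp add: f_def y_def)
          moreover have "y \<in> ?F"
            unfolding unit_face_iff k_def[symmetric]
          proof (intro conjI allI impI)
            show "y $ k = 0" using x by (simp add: y_def P_def)
            fix j assume "j \<noteq> k"
            then have "y $ j = (x $ j + real (Suc i)) / (2 * real (Suc i))"
              by (simp add: y_def)
            moreover have "- real i \<le> x $ j" "x $ j \<le> real i"
              using x by (auto simp: C_def mem_box_cart)
            ultimately show "0 \<le> y $ j" "y $ j \<le> 1"
              by (simp_all add: divide_le_eq)
          qed
          ultimately show "x \<in> f ` ?F" by blast
        qed
        then have "emeasure M (C i) \<le> emeasure area_measure (f ` ?F)"
        proof -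
          have "emeasure M (C i) = emeasure area_measure (P \<inter> C i)"
            by (rule eM) (simp add: C_def)
          then show ?thesis
            using \<open>P \<inter> C i \<subseteq> f ` ?F\<close> fF by (auto intro: emeasure_mono)
        qed
        also have "\<dots> = ennreal ((2 * real (Suc i)) ^ (CARD('n) - 1)) * emeasure area_measure ?F"
        proof (rule area_measure_similarity_image[OF n unit(2) fF])
          fix x y :: "real^'n"
          have "f x - f y = (2 * real (Suc i)) *\<^sub>R (x - y)" by (simp add: f_def algebra_simps)
          then show "dist (f x) (f y) = 2 * real (Suc i) * dist x y" by (simp add: dist_norm)
        qed simp
        also have "\<dots> < top"
          by (simp add: area_measure_unit_face[OF n])
        finally show ?thesis by simp
      qed
      then show "\<exists>A. countable A \<and> A \<subseteq> sets M \<and> \<Union> A = space M \<and> (\<forall>a\<in>A. emeasure M a \<noteq> \<infinity>)"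
        using cover by (intro exI[of _ "range C"]) (auto simp: sM C_def M_def)
    qed
    show "sigma_finite_measure N"
    proof
      have cover: "(\<Union>i. ball (0::real^'n) (real i)) = UNIV"
        using reals_Archimedean2 by (auto simp: set_eq_iff)
      have "emeasure N (ball 0 (real i)) \<noteq> top" for i
      proof -
        have "{x \<in> S. \<psi> x \<in> ball 0 (real i)} \<subseteq> cball 0 (real i + 1)"
        proof
          fix x assume "x \<in> {x \<in> S. \<psi> x \<in> ball 0 (real i)}"
          then have x: "0 < x $ k" "x $ k \<le> 1" "norm (\<psi> x) \<le> real i" by (auto simp: S_def)
          have "x = (x $ k) *\<^sub>R (\<psi> x + axis k 1)" using x by (simp add: \<psi>_def)
          then have "norm x = x $ k * norm (\<psi> x + axis k 1)"
            using x by (metis abs_of_pos norm_scaleR)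
          also have "\<dots> \<le> 1 * (norm (\<psi> x) + norm (axis k (1::real) :: real^'n))"
            using x by (intro mult_mono norm_triangle_ineq) auto
          also have "\<dots> \<le> real i + 1" using x by simp
          finally show "x \<in> cball 0 (real i + 1)" by simp
        qed
        then have "emeasure N (ball 0 (real i)) \<le> emeasure lborel (cball (0::real^'n) (real i + 1))"
          by (subst eN) (auto intro!: emeasure_mono)
        also have "\<dots> < top" using emeasure_bounded_finite[OF bounded_cball, of "0::real^'n" "real i + 1"] by simp
        finally show ?thesis by simp
      qed
      then show "\<exists>A. countable A \<and> A \<subseteq> sets N \<and> \<Union> A = space N \<and> (\<forall>a\<in>A. emeasure N a \<noteq> \<infinity>)"
        using cover by (intro exI[of _ "range (\<lambda>i. ball (0::real^'n) (real i))"]) (auto simp: sN N_def)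
    qed
    show "AE x in M. x \<in> P"
      unfolding M_def by (subst AE_density) (auto intro!: AE_I2 simp: indicator_def split: if_splits)
    show "AE x in N. x \<in> P"
    proof -
      have "\<psi> x \<in> P" if "x \<in> S" for x
        using that by (simp add: \<psi>_def P_def S_def)
      then show ?thesis
        unfolding N_def by (subst AE_distr_iff) (auto intro!: AE_I2 simp: AE_density indicator_def split: if_splits)
    qed
    show "- x \<in> P" if "x \<in> P" for x using that by (simp add: P_def)
    show "emeasure M ((+) w -` B) = emeasure M B" if w: "w \<in> P" and B: "B \<in> sets borel" for w B
    proof -
      have eq: "P \<inter> B = (+) w ` (P \<inter> (+) w -` B)"
      proof (intro subset_antisym subsetI)
        fix x assume "x \<in> P \<inter> B"
        then show "x \<in> (+) w ` (P \<inter> (+) w -` B)"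
          using w by (intro image_eqI[of _ _ "x - w"]) (auto simp: P_def)
      qed (use w in \<open>auto simp: P_def\<close>)
      have "emeasure area_measure ((+) w ` (P \<inter> (+) w -` B)) = ennreal (1 ^ (CARD('n) - 1)) * emeasure area_measure (P \<inter> (+) w -` B)"
        by (rule area_measure_similarity_image[OF n]) (use plus B eq[symmetric] in auto)
      then show ?thesis
        using eM[OF B] eM[OF plus[OF B]] by (simp add: eq[symmetric])
    qed
    show "emeasure N ((+) w -` B) = emeasure N B" if w: "w \<in> P" and B: "B \<in> sets borel" for w B
    proof -
      \<comment> \<open>The shear that acts on the hyperplane at height one as the translation by \<open>w\<close>.\<close>
      define \<sigma> where "\<sigma> x = x + (x $ k) *\<^sub>R w" for x :: "real^'n"
      have lin: "linear \<sigma>"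
        by (rule linearI) (simp_all add: \<sigma>_def algebra_simps)
      have "matrix \<sigma> = mat 1 + (\<chi> i j. w $ i * axis k 1 $ j)"
        by (simp add: matrix_def \<sigma>_def vec_eq_iff mat_def axis_def)
      then have det: "det (matrix \<sigma>) = 1"
        using w by (simp add: det_rank_one_update inner_axis P_def)
      have [measurable]: "\<sigma> \<in> borel_measurable borel"
        unfolding \<sigma>_def by measurable
      have "emeasure N B = emeasure (distr lborel borel \<sigma>) {x \<in> S. \<psi> x \<in> B}"
        unfolding eN[OF B] by (simp add: lborel_distr_linear[OF lin] det)
      also have "\<dots> = emeasure lborel (\<sigma> -` {x \<in> S. \<psi> x \<in> B})"
        using B by (subst emeasure_distr) auto
      also have "\<sigma> -` {x \<in> S. \<psi> x \<in> B} = {x \<in> S. \<psi> x \<in> (+) w -` B}"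
      proof -
        have "\<sigma> x $ k = x $ k" for x
          using w by (simp add: \<sigma>_def P_def)
        moreover have "\<psi> (\<sigma> x) = w + \<psi> x" if "x \<in> S" for x
          using that calculation[of x] by (simp add: \<psi>_def S_def) (simp add: \<sigma>_def scaleR_add_right)
        ultimately show ?thesis by (auto simp: S_def)
      qed
      finally show ?thesis
        by (simp add: eN plus B)
    qed
  qed (use B unit in auto)
  have uF: "emeasure M (uminus -` ?F) = 1"
  proof -
    have im: "uminus -` ?F = uminus ` ?F"
    proof (intro subset_antisym subsetI)
      fix x assume "x \<in> uminus -` ?F"
      then show "x \<in> uminus ` ?F" by (intro image_eqI[of _ _ "- x"]) auto
    qed auto
    have b: "uminus ` ?F \<in> sets borel"
      using measurable_sets[of uminus borel borel ?F] unit(2) unfolding im[symmetric] by simp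
    have "emeasure area_measure (uminus ` ?F) = ennreal (1 ^ (CARD('n) - 1)) * emeasure area_measure ?F"
      by (rule area_measure_similarity_image[OF n unit(2) b]) (auto simp: dist_minus)
    moreover have "P \<inter> uminus ` ?F = uminus ` ?F"
      using unit(1) by (auto simp: P_def)
    ultimately show ?thesis
      using b by (simp add: im eM area_measure_unit_face[OF n])
  qed
  have pyr: "of_nat CARD('n) * emeasure N ?F = 1"
  proof -
    have "{x \<in> S. \<psi> x \<in> ?F} = {x. 0 < x $ k \<and> x $ k \<le> 1 \<and> (\<forall>i. 0 \<le> x $ i \<and> x $ i \<le> x $ k)}"
    proof -
      have "\<psi> x \<in> ?F \<longleftrightarrow> (\<forall>i. 0 \<le> x $ i \<and> x $ i \<le> x $ k)" if "0 < x $ k" for x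
      proof -
        have "\<psi> x $ k = 0" using that by (simp add: \<psi>_def)
        moreover have "\<psi> x $ i = x $ i / x $ k" if "i \<noteq> k" for i
          using that by (simp add: \<psi>_def axis_def)
        ultimately have "\<psi> x \<in> ?F \<longleftrightarrow> (\<forall>i. i \<noteq> k \<longrightarrow> 0 \<le> x $ i / x $ k \<and> x $ i / x $ k \<le> 1)"
          unfolding unit_face_iff k_def[symmetric] by auto
        also have "\<dots> \<longleftrightarrow> (\<forall>i. i \<noteq> k \<longrightarrow> 0 \<le> x $ i \<and> x $ i \<le> x $ k)"
          using that by (simp add: zero_le_divide_iff)
        also have "\<dots> \<longleftrightarrow> (\<forall>i. 0 \<le> x $ i \<and> x $ i \<le> x $ k)"
          using that by (metis less_imp_le order_refl)
        finally show ?thesis .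
      qed
      then show ?thesis by (auto simp: S_def)
    qed
    then show ?thesis
      using emeasure_pyramid[OF n, of k] by (simp add: eN unit)
  qed
  define B where "B = (+) (axis k 1) -` A"
  have B: "B \<in> sets borel" unfolding B_def by (rule plus) (rule A(1))
  have AB: "A = (+) (axis k 1) ` B"
  proof (intro subset_antisym subsetI)
    fix x assume "x \<in> A"
    then show "x \<in> (+) (axis k 1) ` B"
      by (intro image_eqI[of _ _ "x - axis k 1"]) (auto simp: B_def)
  qed (auto simp: B_def)
  have BP: "B \<subseteq> P"
    using A(2) by (auto simp: B_def P_def) force
  have "emeasure area_measure A = ennreal (1 ^ (CARD('n) - 1)) * emeasure area_measure B"
    unfolding AB by (rule area_measure_similarity_image[OF n B]) (use A(1) AB in auto)
  also have "\<dots> = emeasure M B"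
    using BP by (simp add: eM B Int_absorb1)
  also have "\<dots> = of_nat CARD('n) * (emeasure M B * emeasure N ?F)"
    using pyr by (metis mult.left_commute mult.right_neutral)
  also have "\<dots> = of_nat CARD('n) * emeasure N B"
    using key[OF B] uF by simp
  also have "emeasure N B = emeasure lborel {x. 0 < x $ k \<and> x $ k \<le> 1 \<and> (1 / x $ k) *\<^sub>R x \<in> A}"
    unfolding eN[OF B] by (rule arg_cong[of _ _ "emeasure lborel"]) (auto simp: S_def \<psi>_def B_def)
  finally show ?thesis .
qed

lemma emeasure_lborel_scale_vimage:
  fixes S :: "'a::euclidean_space set"
  assumes c: "c > 0" and S: "S \<in> sets borel"
  shows "emeasure lborel S = ennreal (c ^ DIM('a)) * emeasure lborel ((\<lambda>x. c *\<^sub>R x) -` S)"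
proof -
  have "emeasure lborel S = emeasure (density (distr lborel borel (\<lambda>x :: 'a. c *\<^sub>R x)) (\<lambda>_. \<bar>c\<bar> ^ DIM('a))) S"
    using lborel_affine[of c "0 :: 'a"] c by simp
  also have "\<dots> = ennreal (c ^ DIM('a)) * emeasure (distr lborel borel (\<lambda>x :: 'a. c *\<^sub>R x)) S"
    using S c by (subst emeasure_density_const) auto
  also have "emeasure (distr lborel borel (\<lambda>x :: 'a. c *\<^sub>R x)) S = emeasure lborel ((\<lambda>x. c *\<^sub>R x) -` S)"
    using S by (subst emeasure_distr) auto
  finally show ?thesis .
qed

text \<open>A rotation and a dilation reduce the claim to the coordinate hyperplane at height one.\<close>

lemma area_measure_hyperplane:
  fixes u :: "real^'n"
  assumes n: "CARD('n) \<ge> 2" and u: "norm u = 1" and h: "h > 0"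
    and B: "B \<in> sets borel" "\<And>x. x \<in> B \<Longrightarrow> x \<bullet> u = h"
  shows "ennreal h * emeasure area_measure B =
    of_nat CARD('n) * emeasure lborel {x. 0 < x \<bullet> u \<and> x \<bullet> u \<le> h \<and> (h / (x \<bullet> u)) *\<^sub>R x \<in> B}"
proof -
  let ?k = "height_index :: 'n"
  obtain Q :: "real^'n^'n" where Q: "orthogonal_matrix Q" "Q *v axis ?k 1 = u"
    using orthogonal_matrix_exists_basis[OF u] .
  have QQ: "transpose Q ** Q = mat 1" "Q ** transpose Q = mat 1"
    using Q(1) by (auto simp: orthogonal_matrix_def)
  have ortho: "orthogonal_transformation ((*v) Q)"
    using Q(1) by (simp add: orthogonal_transformation_matrix)
  have nQ: "norm (Q *v x) = norm x" for x
    using ortho by (rule orthogonal_transformation_norm)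
  have inQ: "(Q *v x) \<bullet> u = x $ ?k" for x
  proof -
    have "(Q *v x) \<bullet> (Q *v axis ?k 1) = x \<bullet> axis ?k 1"
      using ortho by (simp add: orthogonal_transformation_def)
    then show ?thesis by (simp add: Q(2) inner_axis)
  qed
  define g where "g x = h *\<^sub>R (Q *v x)" for x
  have gu: "g x \<bullet> u = h * x $ ?k" for x by (simp add: g_def inQ)
  have gm: "g \<in> borel_measurable borel"
    unfolding g_def by (intro borel_measurable_continuous_onI continuous_intros)
  define A where "A = g -` B"
  have A: "A \<in> sets borel" using measurable_sets[OF gm B(1)] by (simp add: A_def)
  have gA: "g ` A = B"
  proof (intro subset_antisym subsetI)
    fix x assume x: "x \<in> B"
    have "x = g ((1 / h) *\<^sub>R (transpose Q *v x))"
    proof -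
      have "Q *v (transpose Q *v x) = x"
        by (simp only: matrix_vector_mul_assoc QQ matrix_vector_mul_lid)
      then show ?thesis
        using h by (simp add: g_def matrix_vector_mult_scaleR del: transpose_matrix_vector)
    qed
    then show "x \<in> g ` A" using x by (metis A_def image_eqI vimageI)
  qed (auto simp: A_def)
  have Ak: "x $ ?k = 1" if "x \<in> A" for x
    using that B(2)[of "g x"] gu[of x] h by (simp add: A_def)
  let ?WA = "{x. 0 < x $ ?k \<and> x $ ?k \<le> 1 \<and> (1 / x $ ?k) *\<^sub>R x \<in> A}"
  define WB where "WB = {x. 0 < x \<bullet> u \<and> x \<bullet> u \<le> h \<and> (h / (x \<bullet> u)) *\<^sub>R x \<in> B}"
  have WB: "WB \<in> sets borel" unfolding WB_def using B(1) by measurable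
  have "emeasure area_measure B = ennreal (h ^ (CARD('n) - 1)) * emeasure area_measure A"
    unfolding gA[symmetric]
  proof (rule area_measure_similarity_image[OF n A])
    show "g ` A \<in> sets borel" using gA B by simp
    fix x y
    have "g x - g y = h *\<^sub>R (Q *v (x - y))"
      by (simp add: g_def matrix_vector_mult_diff_distrib algebra_simps)
    then show "dist (g x) (g y) = h * dist x y" using h by (simp add: dist_norm nQ)
  qed (rule h)
  also have "emeasure area_measure A = of_nat CARD('n) * emeasure lborel ?WA"
    by (rule area_measure_coordinate_hyperplane[OF n A Ak])
  finally have 1: "ennreal h * emeasure area_measure B = ennreal (h ^ CARD('n)) * (of_nat CARD('n) * emeasure lborel ?WA)"
    using h n by (simp add: mult.assoc[symmetric] flip: ennreal_mult' power_Suc)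
  have "emeasure lborel WB = ennreal (h ^ CARD('n)) * emeasure lborel ((\<lambda>x. h *\<^sub>R x) -` WB)"
    using emeasure_lborel_scale_vimage[OF h WB] by simp
  also have "emeasure lborel ((\<lambda>x. h *\<^sub>R x) -` WB) = emeasure (distr lborel borel ((*v) Q)) ((\<lambda>x. h *\<^sub>R x) -` WB)"
    using Q(1) by (subst lborel_distr_linear) (auto dest: det_orthogonal_matrix)
  also have "\<dots> = emeasure lborel ((*v) Q -` ((\<lambda>x. h *\<^sub>R x) -` WB))"
  proof -
    have "(\<lambda>x. h *\<^sub>R x) -` WB \<in> sets borel"
      using measurable_sets[of "\<lambda>x. h *\<^sub>R x" borel borel WB] WB by simp
    moreover have "(*v) Q \<in> borel_measurable borel"
      by (intro borel_measurable_continuous_onI linear_continuous_on matrix_vector_mul_bounded_linear)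
    ultimately show ?thesis by (subst emeasure_distr) auto
  qed
  also have "(*v) Q -` ((\<lambda>x. h *\<^sub>R x) -` WB) = ?WA"
  proof -
    have "g x \<in> WB \<longleftrightarrow> x \<in> ?WA" for x
    proof -
      have "(h / (g x \<bullet> u)) *\<^sub>R g x \<in> B \<longleftrightarrow> (1 / x $ ?k) *\<^sub>R x \<in> A"
        using h by (simp add: gu A_def) (simp add: g_def matrix_vector_mult_scaleR)
      then show ?thesis using h by (simp add: WB_def gu zero_less_mult_iff)
    qed
    moreover have "(*v) Q -` ((\<lambda>x. h *\<^sub>R x) -` WB) = {x. g x \<in> WB}"
      by (simp add: vimage_def g_def)
    ultimately show ?thesis by blast
  qed
  finally show ?thesis
    unfolding 1 WB_def by (simp only: mult.left_commute)
qed

section \<open>The gauge of a convex body\<close>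

lemma support_function_upper:
  assumes "bounded M" "z \<in> M"
  shows "z \<bullet> y \<le> support_function M y"
proof -
  obtain b where b: "\<And>x. x \<in> M \<Longrightarrow> norm x \<le> b"
    using assms(1) by (auto simp: bounded_iff)
  have "bdd_above ((\<lambda>x. x \<bullet> y) ` M)"
  proof (rule bdd_aboveI2)
    fix x assume "x \<in> M"
    have "x \<bullet> y \<le> norm x * norm y" by (rule norm_cauchy_schwarz)
    also have "\<dots> \<le> b * norm y" using b[OF \<open>x \<in> M\<close>] by (rule mult_right_mono) simp
    finally show "x \<bullet> y \<le> b * norm y" .
  qed
  then show ?thesis
    unfolding support_function_def using assms(2) by (intro cSUP_upper)
qed

lemma support_function_least:
  assumes "M \<noteq> {}" "\<And>z. z \<in> M \<Longrightarrow> z \<bullet> y \<le> c"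
  shows "support_function M y \<le> c"
  unfolding support_function_def using assms by (intro cSUP_least) auto

lemma support_function_scale:
  assumes M: "bounded M" "M \<noteq> {}" and t: "0 \<le> t"
  shows "support_function M (t *\<^sub>R y) = t * support_function M y"
proof (cases "t = 0")
  case True
  then show ?thesis using M by (simp add: support_function_def)
next
  case False
  then have t: "t > 0" using t by simp
  show ?thesis
  proof (rule antisym)
    show "support_function M (t *\<^sub>R y) \<le> t * support_function M y"
      using t by (intro support_function_least M) (simp add: support_function_upper M)
    have "support_function M y \<le> support_function M (t *\<^sub>R y) / t"
    proof (rule support_function_least[OF M(2)])
      fix z assume "z \<in> M"
      then have "t * (z \<bullet> y) \<le> support_function M (t *\<^sub>R y)"
        using support_function_upper[OF M(1), of z "t *\<^sub>R y"] by simp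
      then show "z \<bullet> y \<le> support_function M (t *\<^sub>R y) / t" using t by (simp add: field_simps)
    qed
    then show "t * support_function M y \<le> support_function M (t *\<^sub>R y)"
      using t by (simp add: field_simps)
  qed
qed

lemma continuous_on_support_function:
  assumes M: "bounded M" "M \<noteq> {}"
  shows "continuous_on UNIV (support_function M)"
proof -
  obtain b where b: "b > 0" "\<And>x. x \<in> M \<Longrightarrow> norm x \<le> b"
    using M(1) by (auto simp: bounded_pos)
  have le: "support_function M x \<le> support_function M y + b * norm (x - y)" for x y
  proof (rule support_function_least[OF M(2)])
    fix z assume z: "z \<in> M"
    have "z \<bullet> x = z \<bullet> y + z \<bullet> (x - y)" by (simp add: inner_diff_right)
    also have "z \<bullet> y \<le> support_function M y" by (rule support_function_upper[OF M(1) z])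
    also have "z \<bullet> (x - y) \<le> norm z * norm (x - y)" by (rule norm_cauchy_schwarz)
    also have "\<dots> \<le> b * norm (x - y)" using b(2)[OF z] by (rule mult_right_mono) simp
    finally show "z \<bullet> x \<le> support_function M y + b * norm (x - y)" by simp
  qed
  have "b-lipschitz_on UNIV (support_function M)"
  proof (rule lipschitz_onI)
    fix x y
    show "dist (support_function M x) (support_function M y) \<le> b * dist x y"
      using le[of x y] le[of y x] by (simp add: dist_norm norm_minus_commute abs_le_iff)
  qed (use b in simp)
  then show ?thesis by (rule lipschitz_on_continuous_on)
qed

text \<open>The gauge of a convex body is the support function of its polar body; in this form the
  symmetry between a body and its polar is manifest.\<close>

definition body_gauge :: "(real^'n) set \<Rightarrow> real^'n \<Rightarrow> real" where
  "body_gauge L = support_function (polar_body L)"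

locale centered_body =
  fixes L :: "(real^'n) set"
  assumes body: "convex_body L" and zero_interior: "0 \<in> interior L"
begin

lemma body_props: "convex L" "compact L" "closed L" "bounded L" "0 \<in> L"
  using body zero_interior interior_subset[of L]
  by (auto simp: convex_body_def intro: compact_imp_closed compact_imp_bounded)

lemma inner_radius: obtains r where "r > 0" "cball 0 r \<subseteq> L"
  using zero_interior by (auto simp: mem_interior_cball)

lemma outer_radius: obtains R where "R > 0" "\<And>x. x \<in> L \<Longrightarrow> norm x \<le> R"
  using body_props(4) by (auto simp: bounded_pos)

lemma polar_props: "convex (polar_body L)" "compact (polar_body L)" "0 \<in> polar_body L"
    "0 \<in> interior (polar_body L)" "bounded (polar_body L)" "polar_body L \<noteq> {}"
proof -
  have eq: "polar_body L = (\<Inter>x\<in>L. {y. x \<bullet> y \<le> 1})" by (auto simp: polar_body_def)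
  show "convex (polar_body L)"
    unfolding eq by (intro convex_INT convex_halfspace_le)
  have cl: "closed (polar_body L)"
    unfolding eq by (intro closed_INT ballI closed_halfspace_le)
  obtain r where r: "r > 0" "cball 0 r \<subseteq> L" by (rule inner_radius)
  have "norm y \<le> 1 / r" if y: "y \<in> polar_body L" for y
  proof (cases "y = 0")
    case False
    have "(r / norm y) *\<^sub>R y \<in> L"
      using r False by (intro subsetD[OF r(2)]) simp
    then have "((r / norm y) *\<^sub>R y) \<bullet> y \<le> 1" using y by (auto simp: polar_body_def)
    then have "r * norm y \<le> 1" using False by (simp add: dot_square_norm power2_eq_square)
    then show ?thesis using r(1) by (simp add: field_simps)
  qed (use r in simp)
  then show bd: "bounded (polar_body L)" by (auto simp: bounded_iff)
  show "compact (polar_body L)" using cl bd by (simp add: compact_eq_bounded_closed)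
  show 0: "0 \<in> polar_body L" by (simp add: polar_body_def)
  then show "polar_body L \<noteq> {}" by auto
  obtain R where R: "R > 0" "\<And>x. x \<in> L \<Longrightarrow> norm x \<le> R" by (rule outer_radius) blast
  have "cball 0 (1 / R) \<subseteq> polar_body L"
  proof
    fix y :: "real^'n" assume y: "y \<in> cball 0 (1 / R)"
    show "y \<in> polar_body L"
      unfolding polar_body_def
    proof safe
      fix x assume "x \<in> L"
      have "x \<bullet> y \<le> norm x * norm y" by (rule norm_cauchy_schwarz)
      also have "\<dots> \<le> R * (1 / R)" using R(2)[OF \<open>x \<in> L\<close>] y R(1) by (intro mult_mono) auto
      finally show "x \<bullet> y \<le> 1" using R(1) by simp
    qed
  qed
  then show "0 \<in> interior (polar_body L)"
    unfolding mem_interior_cball using R(1) by (intro exI[of _ "1 / R"]) simp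
qed

lemma centered_body_polar: "centered_body (polar_body L)"
  using polar_props by unfold_locales (auto simp: convex_body_def)

lemma gauge_upper: "z \<in> polar_body L \<Longrightarrow> z \<bullet> y \<le> body_gauge L y"
  unfolding body_gauge_def by (rule support_function_upper[OF polar_props(5)])

lemma gauge_least: "(\<And>z. z \<in> polar_body L \<Longrightarrow> z \<bullet> y \<le> c) \<Longrightarrow> body_gauge L y \<le> c"
  unfolding body_gauge_def by (rule support_function_least[OF polar_props(6)])

lemma gauge_scale: "0 \<le> t \<Longrightarrow> body_gauge L (t *\<^sub>R y) = t * body_gauge L y"
  unfolding body_gauge_def by (rule support_function_scale[OF polar_props(5,6)])

lemma gauge_0 [simp]: "body_gauge L 0 = 0"
  using gauge_scale[of 0 0] by simp

lemma continuous_on_gauge: "continuous_on S (body_gauge L)"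
  unfolding body_gauge_def by (rule continuous_on_subset[OF continuous_on_support_function[OF polar_props(5,6)] subset_UNIV])

lemma measurable_gauge [measurable]: "body_gauge L \<in> borel_measurable borel"
  by (intro borel_measurable_continuous_onI continuous_on_gauge)

lemma gauge_pos: "y \<noteq> 0 \<Longrightarrow> body_gauge L y > 0"
proof -
  assume y: "y \<noteq> 0"
  obtain r where r: "r > 0" "cball 0 r \<subseteq> polar_body L"
    using polar_props(4) by (auto simp: mem_interior_cball)
  have "(r / norm y) *\<^sub>R y \<in> polar_body L"
    using r y by (intro subsetD[OF r(2)]) simp
  then have "((r / norm y) *\<^sub>R y) \<bullet> y \<le> body_gauge L y" by (rule gauge_upper)
  moreover have "((r / norm y) *\<^sub>R y) \<bullet> y = r * norm y"
    using y by (simp add: dot_square_norm power2_eq_square)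
  ultimately show ?thesis using r(1) y by (metis mult_pos_pos order_less_le_trans zero_less_norm_iff)
qed

lemma gauge_nonneg: "body_gauge L y \<ge> 0"
  using gauge_pos[of y] by (cases "y = 0") auto

lemma gauge_eq_0_iff [simp]: "body_gauge L y = 0 \<longleftrightarrow> y = 0"
  using gauge_pos[of y] by (cases "y = 0") auto

text \<open>A point outside the body is separated from it by a hyperplane, whose suitably normalised normal
  belongs to the polar body.\<close>

lemma gauge_le_1_iff: "body_gauge L y \<le> 1 \<longleftrightarrow> y \<in> L"
proof
  assume "y \<in> L"
  then show "body_gauge L y \<le> 1"
    by (intro gauge_least) (auto simp: polar_body_def inner_commute)
next
  assume le: "body_gauge L y \<le> 1"
  show "y \<in> L"
  proof (rule ccontr)
    assume "y \<notin> L"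
    then obtain a b where ab: "a \<bullet> y < b" "\<And>x. x \<in> L \<Longrightarrow> b < a \<bullet> x"
      using separating_hyperplane_closed_point[OF body_props(1,3)] by blast
    have b: "b < 0" using ab(2)[OF body_props(5)] by simp
    have "(1 / b) *\<^sub>R a \<in> polar_body L"
      unfolding polar_body_def
    proof safe
      fix x assume "x \<in> L"
      then show "x \<bullet> ((1 / b) *\<^sub>R a) \<le> 1"
        using ab(2)[of x] b by (simp add: inner_commute divide_le_eq)
    qed
    then have "((1 / b) *\<^sub>R a) \<bullet> y \<le> 1"
      using gauge_upper[of "(1 / b) *\<^sub>R a" y] le by linarith
    then show False
      using ab(1) b by (simp add: divide_le_eq)
  qed
qed

lemma polar_polar: "polar_body (polar_body L) = L"
proof -
  have "y \<in> polar_body (polar_body L) \<longleftrightarrow> body_gauge L y \<le> 1" for y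
  proof
    assume y: "y \<in> polar_body (polar_body L)"
    show "body_gauge L y \<le> 1"
      by (rule gauge_least) (use y in \<open>auto simp: polar_body_def[of "polar_body L"]\<close>)
  next
    assume "body_gauge L y \<le> 1"
    then have "z \<bullet> y \<le> 1" if "z \<in> polar_body L" for z
      using gauge_upper[OF that, of y] by linarith
    then show "y \<in> polar_body (polar_body L)"
      by (simp add: polar_body_def[of "polar_body L"])
  qed
  then show ?thesis by (auto simp: gauge_le_1_iff)
qed

lemma gauge_polar: "body_gauge (polar_body L) = support_function L"
  unfolding body_gauge_def polar_polar ..

lemma interior_eq: "interior L = {y. body_gauge L y < 1}"
proof
  have "open {y. body_gauge L y < 1}"
    using continuous_on_gauge by (intro open_Collect_less) auto
  moreover have "{y. body_gauge L y < 1} \<subseteq> L"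
    by (auto simp flip: gauge_le_1_iff)
  ultimately show "{y. body_gauge L y < 1} \<subseteq> interior L" by (simp add: interior_maximal)
  show "interior L \<subseteq> {y. body_gauge L y < 1}"
  proof safe
    fix y assume "y \<in> interior L"
    then obtain e where e: "e > 0" "cball y e \<subseteq> L" by (auto simp: mem_interior_cball)
    show "body_gauge L y < 1"
    proof (cases "y = 0")
      case False
      let ?t = "1 + e / norm y"
      have "dist y (?t *\<^sub>R y) = e"
        using False e by (simp add: dist_norm algebra_simps)
      then have "?t *\<^sub>R y \<in> L" using e by (intro subsetD[OF e(2)]) simp
      then have "?t * body_gauge L y \<le> 1"
        using gauge_scale[of ?t y] e by (simp flip: gauge_le_1_iff)
      moreover have "?t > 1" using e False by simp
      ultimately show ?thesis
        using mult_strict_right_mono[OF _ gauge_pos[OF False], of 1 ?t] by linarith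
    qed simp
  qed
qed

lemma frontier_eq: "frontier L = {y. body_gauge L y = 1}"
proof -
  have "frontier L = L - {y. body_gauge L y < 1}"
    using body_props(3) by (simp add: frontier_def interior_eq)
  also have "\<dots> = {y. body_gauge L y = 1}"
    unfolding set_eq_iff Diff_iff gauge_le_1_iff[symmetric] by auto
  finally show ?thesis .
qed

lemma frontier_nonzero: "x \<in> frontier L \<Longrightarrow> x \<noteq> 0"
  by (auto simp: frontier_eq)

lemma radial_frontier: "y \<noteq> 0 \<Longrightarrow> (1 / body_gauge L y) *\<^sub>R y \<in> frontier L"
  using gauge_pos[of y] by (simp add: frontier_eq gauge_scale)

lemma compact_frontier: "compact (frontier L)"
  using body_props(4) by (rule compact_frontier_bounded)

lemma frontier_subset: "frontier L \<subseteq> L"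
  using body_props(3) by (rule frontier_subset_closed)

end

section \<open>The cone measure as the volume of cones\<close>

text \<open>A continuous Gauss map is all the regularity that the formula for the cone measure takes.\<close>

locale smooth_normal_body = centered_body L for L :: "(real^'n) set" +
  assumes dim: "CARD('n) \<ge> 2"
    and cont_normal: "continuous_on (frontier L) (outer_normal L)"
    and normal: "\<And>x. x \<in> frontier L \<Longrightarrow> norm (outer_normal L x) = 1"
      "\<And>x y. x \<in> frontier L \<Longrightarrow> y \<in> L \<Longrightarrow> y \<bullet> outer_normal L x \<le> x \<bullet> outer_normal L x"
begin

abbreviation height :: "real^'n \<Rightarrow> real" where
  "height x \<equiv> x \<bullet> outer_normal L x"

lemma support_normal: "x \<in> frontier L \<Longrightarrow> support_function L (outer_normal L x) = height x"
proof (rule antisym)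
  assume x: "x \<in> frontier L"
  show "support_function L (outer_normal L x) \<le> height x"
    using body_props(5) normal(2)[OF x] by (intro support_function_least) auto
  show "height x \<le> support_function L (outer_normal L x)"
    using x frontier_subset by (intro support_function_upper body_props) auto
qed

lemma height_pos: "x \<in> frontier L \<Longrightarrow> height x > 0"
proof -
  assume x: "x \<in> frontier L"
  obtain r where r: "r > 0" "cball 0 r \<subseteq> L" by (rule inner_radius)
  have "r *\<^sub>R outer_normal L x \<in> L"
    using r normal(1)[OF x] by (intro subsetD[OF r(2)]) simp
  then have "(r *\<^sub>R outer_normal L x) \<bullet> outer_normal L x \<le> height x" by (rule normal(2)[OF x])
  then show ?thesis using r normal(1)[OF x] by (simp add: dot_square_norm)
qed

definition cone_part :: "(real^'n) set \<Rightarrow> (real^'n) set" where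
  "cone_part A = {x \<in> L - {0}. (1 / body_gauge L x) *\<^sub>R x \<in> A}"

lemma measurable_cone_part: "A \<in> sets borel \<Longrightarrow> cone_part A \<in> sets borel"
proof -
  assume [measurable]: "A \<in> sets borel"
  have [measurable]: "L \<in> sets borel" using body_props by simp
  have "cone_part A = {x \<in> space borel. x \<in> L \<and> x \<noteq> 0 \<and> (1 / body_gauge L x) *\<^sub>R x \<in> A}"
    by (auto simp: cone_part_def)
  also have "\<dots> \<in> sets borel" by measurable
  finally show ?thesis .
qed

lemma sets_surface: "sets (cone_measure L) = sets (restrict_space borel (frontier L))"
  "sets (surface_measure L) = sets (restrict_space borel (frontier L))"
  by (simp_all add: cone_measure_def surface_measure_def sets_restrict_space)

lemma frontier_borel [measurable]: "frontier L \<in> sets borel"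
  using compact_frontier by (simp add: borel_compact)

lemma emeasure_cone_measure_bounds:
  assumes A: "A \<in> sets borel" "A \<subseteq> frontier L"
    and a: "0 \<le> a" "\<And>x. x \<in> A \<Longrightarrow> a \<le> height x" "\<And>x. x \<in> A \<Longrightarrow> height x \<le> b"
  shows "ennreal a * emeasure area_measure A \<le> emeasure (cone_measure L) A"
    "emeasure (cone_measure L) A \<le> ennreal b * emeasure area_measure A"
proof -
  have A': "A \<in> sets (surface_measure L)"
    unfolding sets_surface using A by (auto simp: sets_restrict_space_iff)
  have area: "emeasure (surface_measure L) A = emeasure area_measure A"
    unfolding surface_measure_def using A by (subst emeasure_restrict_space) auto
  have "height \<in> borel_measurable (restrict_space borel (frontier L))"
    by (intro borel_measurable_continuous_on_restrict continuous_intros cont_normal)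
  then have "height \<in> borel_measurable (surface_measure L)"
    using measurable_cong_sets[OF sets_surface(2) refl] by blast
  then have m: "(\<lambda>x. ennreal (support_function L (outer_normal L x))) \<in> borel_measurable (surface_measure L)"
    by (subst measurable_cong[where g = "\<lambda>x. ennreal (height x)"])
       (auto simp: support_normal surface_measure_def space_restrict_space)
  have e: "emeasure (cone_measure L) A = (\<integral>\<^sup>+x. ennreal (height x) * indicator A x \<partial>surface_measure L)"
  proof -
    have "emeasure (cone_measure L) A = (\<integral>\<^sup>+x. ennreal (support_function L (outer_normal L x)) * indicator A x \<partial>surface_measure L)"
      unfolding cone_measure_def by (rule emeasure_density[OF m A'])
    also have "\<dots> = (\<integral>\<^sup>+x. ennreal (height x) * indicator A x \<partial>surface_measure L)"
      using A(2) support_normal by (intro nn_integral_cong) (auto simp: indicator_def)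
    finally show ?thesis .
  qed
  have "ennreal a * emeasure area_measure A = (\<integral>\<^sup>+x. ennreal a * indicator A x \<partial>surface_measure L)"
    using A' by (simp add: nn_integral_cmult_indicator area)
  also have "\<dots> \<le> (\<integral>\<^sup>+x. ennreal (height x) * indicator A x \<partial>surface_measure L)"
    using a by (intro nn_integral_mono) (auto simp: indicator_def ennreal_leI)
  finally show "ennreal a * emeasure area_measure A \<le> emeasure (cone_measure L) A" by (simp only: e)
  have "(\<integral>\<^sup>+x. ennreal (height x) * indicator A x \<partial>surface_measure L) \<le> (\<integral>\<^sup>+x. ennreal b * indicator A x \<partial>surface_measure L)"
    using a by (intro nn_integral_mono) (auto simp: indicator_def ennreal_leI)
  also have "\<dots> = ennreal b * emeasure area_measure A"
    using A' by (simp add: nn_integral_cmult_indicator area)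
  finally show "emeasure (cone_measure L) A \<le> ennreal b * emeasure area_measure A" by (simp only: e)
qed

text \<open>Near a boundary point the radial projection to the tangent hyperplane distorts area, height
  and cone volume by factors close to one: by continuity of the normal, boundary chords are almost
  orthogonal to the normal at the point.\<close>

lemma cone_measure_local:
  assumes x0: "x0 \<in> frontier L" and c: "c > 1"
  obtains V where "open V" "x0 \<in> V"
    "\<And>A. A \<in> sets borel \<Longrightarrow> A \<subseteq> V \<inter> frontier L \<Longrightarrow>
      emeasure (cone_measure L) A \<le> ennreal c * (of_nat CARD('n) * emeasure lborel (cone_part A)) \<and>
      of_nat CARD('n) * emeasure lborel (cone_part A) \<le> ennreal c * emeasure (cone_measure L) A"
proof -
  let ?n = "CARD('n)"
  \<comment> \<open>The projection to the tangent hyperplane costs a factor \<open>\<kappa>\<^sup>2\<close> in lengths, hence \<open>\<kappa> ^ (2 * (n - 1))\<close>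
    in area; the height costs a factor \<open>\<kappa>\<close> and the volume of the cone a factor \<open>\<kappa> ^ n\<close>.\<close>
  define \<kappa> where "\<kappa> = root (3 * ?n) c"
  have n0: "?n > 0" by simp
  have \<kappa>: "\<kappa> > 1" "\<kappa> ^ (3 * ?n) = c"
    using c n0 unfolding \<kappa>_def by (simp_all add: real_root_pow_pos2)
  have \<kappa>_le: "\<kappa> ^ m \<le> c" if "m \<le> 3 * ?n" for m
    using power_increasing[OF that, of \<kappa>] \<kappa> by simp
  define u where "u = outer_normal L x0"
  define h where "h = x0 \<bullet> u"
  have u: "norm u = 1" and h: "h > 0"
    using normal(1)[OF x0] height_pos[OF x0] by (simp_all add: u_def h_def)
  obtain R where R: "R > 0" "\<And>x. x \<in> L \<Longrightarrow> norm x \<le> R" by (rule outer_radius) blast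
  \<comment> \<open>If the normal varies by less than \<open>\<epsilon>\<close>, the vector \<open>w\<close> below is at most \<open>(\<kappa> - 1) / \<kappa>\<^sup>2\<close> times the chord.\<close>
  define \<epsilon> where "\<epsilon> = (\<kappa> - 1) * h / (R * \<kappa> ^ 4)"
  have \<epsilon>: "\<epsilon> > 0" using \<kappa> h R by (simp add: \<epsilon>_def)
  have hk: "h / \<kappa> < h" "h < \<kappa> * h" using \<kappa> h by (simp_all add: field_simps)
  obtain V where V: "open V" "x0 \<in> V"
    and Vu: "\<And>y. y \<in> V \<inter> frontier L \<Longrightarrow> h / \<kappa> < y \<bullet> u \<and> y \<bullet> u < \<kappa> * h"
    and Vh: "\<And>y. y \<in> V \<inter> frontier L \<Longrightarrow> h / \<kappa> < height y \<and> height y < \<kappa> * h"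
    and Vn: "\<And>y. y \<in> V \<inter> frontier L \<Longrightarrow> dist (outer_normal L y) u < \<epsilon>"
  proof -
    have tn: "(outer_normal L \<longlongrightarrow> u) (at x0 within frontier L)"
      using cont_normal x0 unfolding u_def continuous_on_def by blast
    have ti: "((\<lambda>y. y) \<longlongrightarrow> x0) (at x0 within frontier L)" by (rule tendsto_ident_at)
    have tu: "((\<lambda>y. y \<bullet> u) \<longlongrightarrow> h) (at x0 within frontier L)"
      unfolding h_def by (intro tendsto_intros ti)
    have th: "(height \<longlongrightarrow> h) (at x0 within frontier L)"
      unfolding h_def by (intro tendsto_intros ti tn)
    have "eventually (\<lambda>y. (h / \<kappa> < y \<bullet> u \<and> y \<bullet> u < \<kappa> * h) \<and> (h / \<kappa> < height y \<and> height y < \<kappa> * h) \<and>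
        dist (outer_normal L y) u < \<epsilon>) (at x0 within frontier L)"
      by (intro eventually_conj order_tendstoD[OF tu] order_tendstoD[OF th] tendstoD[OF tn] hk \<epsilon>)
    then obtain V where V: "open V" "x0 \<in> V" "\<And>y. y \<in> V \<Longrightarrow> y \<noteq> x0 \<Longrightarrow> y \<in> frontier L \<Longrightarrow>
        (h / \<kappa> < y \<bullet> u \<and> y \<bullet> u < \<kappa> * h) \<and> (h / \<kappa> < height y \<and> height y < \<kappa> * h) \<and> dist (outer_normal L y) u < \<epsilon>"
      unfolding eventually_at_topological by blast
    have "h / \<kappa> < x0 \<bullet> u \<and> x0 \<bullet> u < \<kappa> * h" "h / \<kappa> < height x0 \<and> height x0 < \<kappa> * h" "dist (outer_normal L x0) u < \<epsilon>"
      using hk \<epsilon> by (simp_all add: h_def[symmetric] u_def[symmetric])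
    with V show ?thesis by (intro that[of V]) blast+
  qed
  define P where "P y = (h / (y \<bullet> u)) *\<^sub>R y" for y
  have chord: "\<bar>(y - z) \<bullet> u\<bar> \<le> \<epsilon> * dist y z" if "y \<in> V \<inter> frontier L" "z \<in> V \<inter> frontier L" for y z
  proof -
    have "(y - z) \<bullet> u \<le> \<epsilon> * dist y z" if y: "y \<in> V \<inter> frontier L" and z: "z \<in> V \<inter> frontier L" for y z
    proof -
      have "(y - z) \<bullet> outer_normal L z \<le> 0"
        using normal(2)[of z y] y z frontier_subset by (auto simp: inner_diff_left)
      then have "(y - z) \<bullet> u \<le> (y - z) \<bullet> (u - outer_normal L z)" by (simp add: inner_diff_right)
      also have "\<dots> \<le> norm (y - z) * norm (u - outer_normal L z)" by (rule norm_cauchy_schwarz)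
      also have "\<dots> \<le> norm (y - z) * \<epsilon>"
        using Vn[OF z] by (intro mult_left_mono) (auto simp: dist_norm norm_minus_commute)
      finally show ?thesis by (simp add: dist_norm mult.commute)
    qed
    from this[OF that] this[OF that(2,1)] show ?thesis
      by (simp add: inner_diff_left dist_commute abs_le_iff)
  qed
  have distort: "dist (P y) (P z) \<le> \<kappa>\<^sup>2 * dist y z \<and> dist y z \<le> \<kappa>\<^sup>2 * dist (P y) (P z)"
    if y: "y \<in> V \<inter> frontier L" and z: "z \<in> V \<inter> frontier L" for y z
  proof -
    define s where "s = h / (y \<bullet> u)"
    define w where "w = (h / (y \<bullet> u) - h / (z \<bullet> u)) *\<^sub>R z"
    have yu: "y \<bullet> u > h / \<kappa>" "z \<bullet> u > h / \<kappa>" "y \<bullet> u < \<kappa> * h" using Vu[OF y] Vu[OF z] by auto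
    have hk0: "h / \<kappa> > 0" using h \<kappa> by simp
    have pos: "y \<bullet> u > 0" "z \<bullet> u > 0" using yu hk0 by linarith+
    have s: "s \<le> \<kappa>" "1 / \<kappa> \<le> s"
      using yu pos \<kappa> h by (simp_all add: s_def field_simps)
    have eq: "P y - P z = s *\<^sub>R (y - z) + w"
      by (simp add: P_def s_def w_def algebra_simps)
    have "norm w \<le> ((\<kappa> - 1) / \<kappa>\<^sup>2) * dist y z"
    proof -
      have "\<bar>h / (y \<bullet> u) - h / (z \<bullet> u)\<bar> = h * \<bar>(y - z) \<bullet> u\<bar> / ((y \<bullet> u) * (z \<bullet> u))"
      proof -
        have "h / (y \<bullet> u) - h / (z \<bullet> u) = - (h * ((y - z) \<bullet> u)) / ((y \<bullet> u) * (z \<bullet> u))"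
          using pos by (simp add: field_simps inner_diff_left)
        then show ?thesis using pos h by (simp add: abs_mult)
      qed
      also have "\<dots> \<le> h * (\<epsilon> * dist y z) / ((h / \<kappa>) * (h / \<kappa>))"
        using chord[OF y z] yu h hk0 \<epsilon> pos \<kappa>(1) by (intro frac_le mult_mono mult_nonneg_nonneg) auto
      also have "\<dots> = ((\<kappa> - 1) / \<kappa>\<^sup>2) * dist y z / R"
        using h \<kappa> R by (simp add: \<epsilon>_def field_simps power2_eq_square power4_eq_xxxx)
      finally have "\<bar>h / (y \<bullet> u) - h / (z \<bullet> u)\<bar> * norm z \<le> (((\<kappa> - 1) / \<kappa>\<^sup>2) * dist y z / R) * R"
        using R(2)[of z] z frontier_subset \<kappa> R(1) by (intro mult_mono) auto
      then show ?thesis using R by (simp add: w_def)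
    qed
    note w = this
    have "dist (P y) (P z) \<le> norm (s *\<^sub>R (y - z)) + norm w"
      unfolding dist_norm eq by (rule norm_triangle_ineq)
    also have "\<dots> \<le> \<kappa> * dist y z + ((\<kappa> - 1) / \<kappa>\<^sup>2) * dist y z"
    proof (intro add_mono w)
      have "\<bar>s\<bar> \<le> \<kappa>" using s pos h by (simp add: s_def)
      then show "norm (s *\<^sub>R (y - z)) \<le> \<kappa> * dist y z"
        by (simp add: dist_norm mult_right_mono)
    qed
    also have "\<dots> = (\<kappa> + (\<kappa> - 1) / \<kappa>\<^sup>2) * dist y z" by (simp add: distrib_right)
    also have "\<dots> \<le> \<kappa>\<^sup>2 * dist y z"
    proof (rule mult_right_mono)
      have "(\<kappa> - 1) / \<kappa>\<^sup>2 \<le> (\<kappa> - 1) * \<kappa>"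
      proof -
        have "1 / \<kappa>\<^sup>2 \<le> 1" using \<kappa> by simp
        then have "(\<kappa> - 1) * (1 / \<kappa>\<^sup>2) \<le> (\<kappa> - 1) * \<kappa>"
          using \<kappa> by (intro mult_left_mono) linarith+
        then show ?thesis by simp
      qed
      then show "\<kappa> + (\<kappa> - 1) / \<kappa>\<^sup>2 \<le> \<kappa>\<^sup>2" by (simp add: power2_eq_square algebra_simps)
    qed simp
    finally have 1: "dist (P y) (P z) \<le> \<kappa>\<^sup>2 * dist y z" .
    have "(1 / \<kappa>) * dist y z \<le> norm (s *\<^sub>R (y - z))"
    proof -
      have "1 / \<kappa> \<le> \<bar>s\<bar>" using s by linarith
      then show ?thesis by (simp only: dist_norm norm_scaleR mult_right_mono norm_ge_zero)
    qed
    also have "\<dots> \<le> norm (P y - P z) + norm w"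
      unfolding eq by (metis add_diff_cancel_right' norm_triangle_ineq4)
    also have "\<dots> \<le> dist (P y) (P z) + ((\<kappa> - 1) / \<kappa>\<^sup>2) * dist y z"
      using w by (simp add: dist_norm)
    finally have "(1 / \<kappa> - (\<kappa> - 1) / \<kappa>\<^sup>2) * dist y z \<le> dist (P y) (P z)"
      by (simp add: left_diff_distrib)
    moreover have "1 / \<kappa> - (\<kappa> - 1) / \<kappa>\<^sup>2 = 1 / \<kappa>\<^sup>2"
      using \<kappa> by (simp add: field_simps power2_eq_square)
    ultimately have "dist y z \<le> \<kappa>\<^sup>2 * dist (P y) (P z)"
      using \<kappa> by (simp add: field_simps)
    with 1 show ?thesis ..
  qed
  show ?thesis
  proof (rule that[OF V])
    fix A assume A: "A \<in> sets borel" "A \<subseteq> V \<inter> frontier L"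
    let ?M = "emeasure (cone_measure L) A" and ?C = "emeasure lborel (cone_part A)"
    have pos: "y \<bullet> u > 0" if "y \<in> A" for y
    proof -
      have "h / \<kappa> > 0" using h \<kappa>(1) by simp
      moreover have "h / \<kappa> < y \<bullet> u" using Vu[of y] A that by blast
      ultimately show ?thesis by linarith
    qed
    have g1: "body_gauge L y = 1" if "y \<in> A" for y
      using A that by (auto simp: frontier_eq)
    have PA: "P ` A = {z. z \<bullet> u = h \<and> (1 / body_gauge L z) *\<^sub>R z \<in> A}"
    proof (intro subset_antisym subsetI)
      fix z assume "z \<in> P ` A"
      then obtain y where y: "y \<in> A" "z = P y" by blast
      have "body_gauge L z = h / (y \<bullet> u)"
        using pos[OF y(1)] h g1[OF y(1)] by (simp add: y(2) P_def gauge_scale)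
      then have "(1 / body_gauge L z) *\<^sub>R z = y"
        using pos[OF y(1)] h by (simp add: y(2) P_def)
      then show "z \<in> {z. z \<bullet> u = h \<and> (1 / body_gauge L z) *\<^sub>R z \<in> A}"
        using y pos[OF y(1)] by (simp add: P_def)
    next
      fix z assume "z \<in> {z. z \<bullet> u = h \<and> (1 / body_gauge L z) *\<^sub>R z \<in> A}"
      then have z: "z \<bullet> u = h" "(1 / body_gauge L z) *\<^sub>R z \<in> A" by auto
      then have "z \<noteq> 0" using h by auto
      then have "P ((1 / body_gauge L z) *\<^sub>R z) = z"
        using z h by (simp add: P_def)
      then show "z \<in> P ` A" using z(2) by (metis image_eqI)
    qed
    have PAb: "P ` A \<in> sets borel"
      unfolding PA using A(1) by measurable
    define W where "W = {x. 0 < x \<bullet> u \<and> x \<bullet> u \<le> h \<and> (h / (x \<bullet> u)) *\<^sub>R x \<in> P ` A}"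
    have Wb: "W \<in> sets borel" unfolding W_def using PAb by measurable
    have hyp: "ennreal h * emeasure area_measure (P ` A) = of_nat ?n * emeasure lborel W"
      unfolding W_def by (rule area_measure_hyperplane[OF dim u h PAb]) (auto simp: PA)
    have k2: "\<kappa>\<^sup>2 > 0" using \<kappa> by simp
    have lip: "emeasure area_measure (P ` A) \<le> ennreal ((\<kappa>\<^sup>2) ^ (?n - 1)) * emeasure area_measure A"
      by (rule area_measure_lipschitz_image[OF dim A(1) PAb k2]) (use distort A(2) in blast)
    have inj: "inj_on P A"
    proof (rule inj_onI)
      fix y z assume "y \<in> A" "z \<in> A" "P y = P z"
      then show "y = z" using distort[of y z] A(2) by auto
    qed
    have lip': "emeasure area_measure A \<le> ennreal ((\<kappa>\<^sup>2) ^ (?n - 1)) * emeasure area_measure (P ` A)"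
    proof -
      have im: "inv_into A P ` (P ` A) = A" using inj by (simp add: inv_into_image_cancel)
      have "emeasure area_measure (inv_into A P ` (P ` A)) \<le> ennreal ((\<kappa>\<^sup>2) ^ (?n - 1)) * emeasure area_measure (P ` A)"
      proof (rule area_measure_lipschitz_image[OF dim PAb _ k2])
        show "inv_into A P ` (P ` A) \<in> sets borel" using A(1) im by simp
        fix a b assume "a \<in> P ` A" "b \<in> P ` A"
        then obtain y z where "y \<in> A" "a = P y" "z \<in> A" "b = P z" by blast
        then show "dist (inv_into A P a) (inv_into A P b) \<le> \<kappa>\<^sup>2 * dist a b"
          using distort[of y z] A(2) inj by (auto simp: inv_into_f_f)
      qed
      then show ?thesis by (simp only: im)
    qed
    have bounds: "ennreal (h / \<kappa>) * emeasure area_measure A \<le> ?M" "?M \<le> ennreal (\<kappa> * h) * emeasure area_measure A"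
      using emeasure_cone_measure_bounds[OF A(1), of "h / \<kappa>" "\<kappa> * h"] A(2) Vh h \<kappa> by (force intro: less_imp_le)+
    have Cb: "cone_part A \<in> sets borel" by (rule measurable_cone_part[OF A(1)])
    have k0: "\<kappa> > 0" using \<kappa> by simp
    have CW: "?C \<le> ennreal (\<kappa> ^ ?n) * emeasure lborel W"
    proof -
      have "(\<lambda>x. \<kappa> *\<^sub>R x) -` cone_part A \<subseteq> W"
      proof
        fix x assume "x \<in> (\<lambda>x. \<kappa> *\<^sub>R x) -` cone_part A"
        then have x: "\<kappa> *\<^sub>R x \<in> L" "x \<noteq> 0" and y: "(1 / body_gauge L x) *\<^sub>R x \<in> A"
          using k0 by (auto simp: cone_part_def gauge_scale)
        define g where "g = body_gauge L x"
        have g: "g > 0" "\<kappa> * g \<le> 1"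
          using x k0 gauge_pos[OF x(2)] by (auto simp: g_def gauge_scale simp flip: gauge_le_1_iff)
        have p: "((1 / g) *\<^sub>R x) \<bullet> u > 0" using pos[OF y] by (simp add: g_def)
        then have xu: "x \<bullet> u > 0" using g by (simp add: zero_less_divide_iff)
        have "((1 / g) *\<^sub>R x) \<bullet> u < \<kappa> * h" using Vu[of "(1 / g) *\<^sub>R x"] y A(2) by (auto simp: g_def)
        then have "x \<bullet> u < \<kappa> * h * g" using g by (simp add: divide_less_eq)
        also have "\<dots> = (\<kappa> * g) * h" by simp
        also have "\<dots> \<le> 1 * h" using g h by (intro mult_right_mono) auto
        finally have "x \<bullet> u \<le> h" by simp
        moreover have "(h / (x \<bullet> u)) *\<^sub>R x = P ((1 / g) *\<^sub>R x)"
          using g xu by (simp add: P_def)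
        ultimately show "x \<in> W" using xu y by (auto simp: W_def g_def)
      qed
      then have "emeasure lborel ((\<lambda>x. \<kappa> *\<^sub>R x) -` cone_part A) \<le> emeasure lborel W"
        using Wb by (intro emeasure_mono) auto
      then show ?thesis
        using emeasure_lborel_scale_vimage[OF k0 Cb] by (simp add: mult_left_mono)
    qed
    have WC: "emeasure lborel W \<le> ennreal (\<kappa> ^ ?n) * ?C"
    proof -
      have "(\<lambda>x. \<kappa> *\<^sub>R x) -` W \<subseteq> cone_part A"
      proof
        fix x assume "x \<in> (\<lambda>x. \<kappa> *\<^sub>R x) -` W"
        then have x: "0 < x \<bullet> u" "\<kappa> * (x \<bullet> u) \<le> h" "(h / (x \<bullet> u)) *\<^sub>R x \<in> P ` A"
          using k0 by (auto simp: W_def zero_less_mult_iff)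
        then obtain y where y: "y \<in> A" "(h / (x \<bullet> u)) *\<^sub>R x = P y" by auto
        define t where "t = (x \<bullet> u) / (y \<bullet> u)"
        have yu: "y \<bullet> u > 0" by (rule pos[OF y(1)])
        have "(x \<bullet> u / h) *\<^sub>R ((h / (x \<bullet> u)) *\<^sub>R x) = (x \<bullet> u / h) *\<^sub>R P y" using y by simp
        then have xt: "x = t *\<^sub>R y" using x h by (simp add: P_def t_def)
        have t: "t > 0" using x yu by (simp add: t_def)
        have g: "body_gauge L x = t" using t g1[OF y(1)] by (simp add: xt gauge_scale)
        have "t * (y \<bullet> u) * \<kappa> \<le> h" using x yu by (simp add: t_def mult.commute)
        moreover have "h / \<kappa> < y \<bullet> u" using Vu[of y] y(1) A(2) by auto
        then have "h < (y \<bullet> u) * \<kappa>" using k0 by (simp add: divide_less_eq)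
        then have "t * h \<le> t * ((y \<bullet> u) * \<kappa>)" using t by (intro mult_left_mono) auto
        ultimately have "t * h \<le> 1 * h" by (simp add: mult.assoc)
        then have "t \<le> 1" using h by (simp only: mult_le_cancel_right_pos)
        then have "x \<in> L" using g by (simp flip: gauge_le_1_iff)
        moreover have "x \<noteq> 0" using x by auto
        moreover have "(1 / body_gauge L x) *\<^sub>R x = y" unfolding g using t by (simp add: xt)
        ultimately show "x \<in> cone_part A" using y(1) by (simp add: cone_part_def)
      qed
      then have "emeasure lborel ((\<lambda>x. \<kappa> *\<^sub>R x) -` W) \<le> ?C"
        using Cb by (intro emeasure_mono) auto
      then show ?thesis
        using emeasure_lborel_scale_vimage[OF k0 Wb] by (simp add: mult_left_mono)
    qed
    have pw: "(\<kappa>\<^sup>2) ^ (?n - 1) = \<kappa> ^ (2 * (?n - 1))" by (simp add: power_mult)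
    have em: "ennreal (\<kappa> ^ a) * (ennreal (\<kappa> ^ b) * x) = ennreal (\<kappa> ^ (a + b)) * x" for a b x
      using k0 by (simp add: mult.assoc[symmetric] power_add flip: ennreal_mult')
    have "?M \<le> ennreal (\<kappa> * h) * (ennreal ((\<kappa>\<^sup>2) ^ (?n - 1)) * emeasure area_measure (P ` A))"
      using bounds(2) mult_left_mono[OF lip', of "ennreal (\<kappa> * h)"] by (meson order_trans zero_le)
    also have "\<dots> = ennreal (\<kappa> ^ 1) * (ennreal (\<kappa> ^ (2 * (?n - 1))) * (ennreal h * emeasure area_measure (P ` A)))"
      unfolding pw using k0 h by (simp add: ennreal_mult' mult_ac)
    also have "\<dots> = ennreal (\<kappa> ^ (1 + 2 * (?n - 1))) * (of_nat ?n * emeasure lborel W)"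
      unfolding em hyp ..
    also have "\<dots> \<le> ennreal (\<kappa> ^ (1 + 2 * (?n - 1))) * (of_nat ?n * (ennreal (\<kappa> ^ ?n) * ?C))"
      by (intro mult_left_mono WC) auto
    also have "\<dots> = ennreal (\<kappa> ^ (1 + 2 * (?n - 1))) * (ennreal (\<kappa> ^ ?n) * (of_nat ?n * ?C))"
      by (simp add: mult_ac)
    also have "\<dots> = ennreal (\<kappa> ^ (1 + 2 * (?n - 1) + ?n)) * (of_nat ?n * ?C)"
      by (rule em)
    also have "\<dots> \<le> ennreal c * (of_nat ?n * ?C)"
      by (intro mult_right_mono ennreal_leI \<kappa>_le) (use dim in auto)
    finally have 1: "?M \<le> ennreal c * (of_nat ?n * ?C)" .
    have "of_nat ?n * ?C \<le> of_nat ?n * (ennreal (\<kappa> ^ ?n) * emeasure lborel W)"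
      by (intro mult_left_mono CW) auto
    also have "\<dots> = ennreal (\<kappa> ^ ?n) * (ennreal h * emeasure area_measure (P ` A))"
      unfolding hyp by (simp add: mult_ac)
    also have "\<dots> \<le> ennreal (\<kappa> ^ ?n) * (ennreal h * (ennreal (\<kappa> ^ (2 * (?n - 1))) * emeasure area_measure A))"
      using lip unfolding pw by (intro mult_left_mono) auto
    also have "\<dots> = ennreal (\<kappa> ^ ?n) * (ennreal (\<kappa> ^ (2 * (?n - 1))) * (ennreal (\<kappa> ^ 1) * (ennreal (h / \<kappa>) * emeasure area_measure A)))"
    proof -
      have "ennreal h = ennreal (\<kappa> ^ 1) * ennreal (h / \<kappa>)"
        using k0 h by (simp flip: ennreal_mult')
      then show ?thesis by (simp add: mult_ac)
    qed
    also have "\<dots> = ennreal (\<kappa> ^ (?n + (2 * (?n - 1) + 1))) * (ennreal (h / \<kappa>) * emeasure area_measure A)"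
      unfolding em ..
    also have "\<dots> \<le> ennreal (\<kappa> ^ (?n + (2 * (?n - 1) + 1))) * ?M"
      by (intro mult_left_mono bounds(1)) auto
    also have "\<dots> \<le> ennreal c * ?M"
      by (intro mult_right_mono ennreal_leI \<kappa>_le) (use dim in auto)
    finally show "?M \<le> ennreal c * (of_nat ?n * ?C) \<and> of_nat ?n * ?C \<le> ennreal c * ?M"
      using 1 by blast
  qed
qed


text \<open>By compactness the local comparison extends to all Borel subsets of the boundary, with a constant
  arbitrarily close to one.\<close>

lemma emeasure_cone_measure:
  assumes A: "A \<in> sets borel" "A \<subseteq> frontier L"
  shows "emeasure (cone_measure L) A = of_nat CARD('n) * emeasure lborel (cone_part A)"
proof -
  let ?M = "\<lambda>A. emeasure (cone_measure L) A" and ?C = "\<lambda>A. of_nat CARD('n) * emeasure lborel (cone_part A)"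
  have addM: "?M A = ?M (A \<inter> V) + ?M (A - V)" if A: "A \<in> sets borel" "A \<subseteq> frontier L" and V: "open V" for A V
  proof -
    have "A \<inter> V \<in> sets (cone_measure L)" "A - V \<in> sets (cone_measure L)"
      unfolding sets_surface using A V by (auto simp: sets_restrict_space_iff)
    then have "?M ((A \<inter> V) \<union> (A - V)) = ?M (A \<inter> V) + ?M (A - V)"
      by (intro plus_emeasure[symmetric]) auto
    then show ?thesis by (simp add: Int_Diff_Un)
  qed
  have addC: "?C A = ?C (A \<inter> V) + ?C (A - V)" if A: "A \<in> sets borel" and V: "open V" for A V
  proof -
    have "cone_part A = cone_part (A \<inter> V) \<union> cone_part (A - V)"
      "cone_part (A \<inter> V) \<inter> cone_part (A - V) = {}"
      by (auto simp: cone_part_def)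
    moreover have "cone_part (A \<inter> V) \<in> sets borel" "cone_part (A - V) \<in> sets borel"
      using A V by (auto intro!: measurable_cone_part)
    ultimately have "emeasure lborel (cone_part A) = emeasure lborel (cone_part (A \<inter> V)) + emeasure lborel (cone_part (A - V))"
      by (simp add: plus_emeasure)
    then show ?thesis by (simp add: distrib_left)
  qed
  have approx: "?M A \<le> ennreal c * ?C A \<and> ?C A \<le> ennreal c * ?M A" if c: "c > 1" for c
  proof -
    define ok where "ok A \<longleftrightarrow> ?M A \<le> ennreal c * ?C A \<and> ?C A \<le> ennreal c * ?M A" for A
    have "\<exists>V. open V \<and> x \<in> V \<and> (\<forall>A. A \<in> sets borel \<longrightarrow> A \<subseteq> V \<inter> frontier L \<longrightarrow> ok A)" if x: "x \<in> frontier L" for x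
      unfolding ok_def by (rule cone_measure_local[OF x c]) (intro exI conjI allI impI; assumption?; blast)
    then obtain V where V: "\<And>x. x \<in> frontier L \<Longrightarrow> open (V x)" "\<And>x. x \<in> frontier L \<Longrightarrow> x \<in> V x"
      "\<And>x A. x \<in> frontier L \<Longrightarrow> A \<in> sets borel \<Longrightarrow> A \<subseteq> V x \<inter> frontier L \<Longrightarrow> ok A"
      by metis
    have cov: "frontier L \<subseteq> (\<Union>x\<in>frontier L. V x)" using V(2) by blast
    obtain D where D: "D \<subseteq> frontier L" "finite D" "frontier L \<subseteq> (\<Union>x\<in>D. V x)"
      by (rule compactE_image[OF compact_frontier V(1) cov])
    have "A \<in> sets borel \<Longrightarrow> A \<subseteq> (\<Union>x\<in>D. V x) \<inter> frontier L \<Longrightarrow> ok A" for A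
      using D(2,1)
    proof (induction D arbitrary: A rule: finite_induct)
      case empty
      then have "A = {}" by auto
      then show ?case by (simp add: ok_def cone_part_def)
    next
      case (insert x D)
      have x: "x \<in> frontier L" using insert.prems by simp
      have A1: "A \<inter> V x \<in> sets borel" "A - V x \<in> sets borel"
        using insert.prems(1) borel_open[OF V(1)[OF x]] by (simp_all only: sets.Int sets.Diff)
      have 1: "ok (A \<inter> V x)"
        by (rule V(3)[OF x A1(1)]) (use insert.prems(2) in blast)
      have 2: "ok (A - V x)"
        by (rule insert.IH[OF A1(2)]) (use insert.prems(2,3) in blast)+
      have M: "?M A = ?M (A \<inter> V x) + ?M (A - V x)"
        by (rule addM) (use insert.prems(1,2) V(1)[OF x] in blast)+
      have C: "?C A = ?C (A \<inter> V x) + ?C (A - V x)"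
        by (rule addC) (use insert.prems(1) V(1)[OF x] in blast)+
      show ?case
        using 1 2 unfolding ok_def M C distrib_left[of "ennreal c"] by (blast intro: add_mono)
    qed
    then have "ok A" using A D(3) by blast
    then show ?thesis unfolding ok_def .
  qed
  have lim: "a \<le> b" if ab: "\<And>c. c > 1 \<Longrightarrow> a \<le> ennreal c * b" for a b :: ennreal
  proof (cases b)
    case (real r)
    show ?thesis
    proof (rule ennreal_le_epsilon)
      fix e :: real assume e: "0 < e"
      have "a \<le> ennreal (1 + e / (r + 1)) * b" using e real(1) by (intro ab) (simp add: divide_pos_pos)
      also have "\<dots> = ennreal ((1 + e / (r + 1)) * r)" using e real by (simp add: ennreal_mult'')
      also have "(1 + e / (r + 1)) * r \<le> r + e" using e real by (simp add: field_simps)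
      finally show "a \<le> b + ennreal e" using e real by (simp add: ennreal_leI)
    qed
  qed simp
  show ?thesis
    by (rule antisym; rule lim) (use approx in blast)+
qed

text \<open>The cone measure is the image of \<open>n\<close> times Lebesgue measure on the body under the radial projection.\<close>

theorem nn_integral_cone_measure:
  assumes F [measurable]: "F \<in> borel_measurable (restrict_space borel (frontier L))"
  shows "(\<integral>\<^sup>+x. F x \<partial>cone_measure L) =
    of_nat CARD('n) * (\<integral>\<^sup>+x. F ((1 / body_gauge L x) *\<^sub>R x) * indicator (L - {0}) x \<partial>lborel)"
proof -
  let ?p = "\<lambda>x. (1 / body_gauge L x) *\<^sub>R x"
  let ?S = "restrict_space lborel (L - {0})" and ?T = "restrict_space borel (frontier L)"
  define N where "N = distr ?S ?T ?p"
  have Lb: "L - {0} \<in> sets borel" using body_props by auto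
  have p: "?p \<in> measurable ?S ?T"
  proof (rule measurable_restrict_space2)
    show "?p \<in> space ?S \<rightarrow> frontier L"
      using radial_frontier by (auto simp: space_restrict_space)
    have "?p \<in> borel_measurable (lborel :: (real^'n) measure)" by measurable
    then show "?p \<in> borel_measurable ?S" by (rule measurable_restrict_space1)
  qed
  have "cone_measure L = scale_measure (of_nat CARD('n)) N"
  proof (rule measure_eqI)
    show "sets (cone_measure L) = sets (scale_measure (of_nat CARD('n)) N)"
      by (simp add: N_def sets_surface)
    fix A assume "A \<in> sets (cone_measure L)"
    then have A: "A \<in> sets borel" "A \<subseteq> frontier L" and AT: "A \<in> sets ?T"
      unfolding sets_surface by (auto simp: sets_restrict_space_iff)
    have "emeasure N A = emeasure ?S (?p -` A \<inter> space ?S)"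
      unfolding N_def by (rule emeasure_distr[OF p AT])
    also have "?p -` A \<inter> space ?S = cone_part A"
      by (auto simp: space_restrict_space cone_part_def)
    also have "emeasure ?S (cone_part A) = emeasure lborel (cone_part A)"
      using Lb by (intro emeasure_restrict_space) (auto simp: cone_part_def)
    finally show "emeasure (cone_measure L) A = emeasure (scale_measure (of_nat CARD('n)) N) A"
      using emeasure_cone_measure[OF A] by simp
  qed
  then have "(\<integral>\<^sup>+x. F x \<partial>cone_measure L) = of_nat CARD('n) * (\<integral>\<^sup>+x. F x \<partial>N)"
    using F by (simp add: nn_integral_scale_measure N_def)
  also have "(\<integral>\<^sup>+x. F x \<partial>N) = (\<integral>\<^sup>+x. F (?p x) \<partial>?S)"
    unfolding N_def using F by (intro nn_integral_distr[OF p]) simp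
  also have "\<dots> = (\<integral>\<^sup>+x. F (?p x) * indicator (L - {0}) x \<partial>lborel)"
    using Lb by (intro nn_integral_restrict_space) simp
  finally show ?thesis .
qed

end

section \<open>Duality and the Gauss curvature\<close>

lemma det_rank_one_map:
  fixes u \<alpha> :: "real^'n"
  shows "det (matrix (\<lambda>w. w + (w \<bullet> \<alpha>) *\<^sub>R u)) = 1 + u \<bullet> \<alpha>"
proof -
  have "matrix (\<lambda>w. w + (w \<bullet> \<alpha>) *\<^sub>R u) = mat 1 + (\<chi> i j. u $ i * \<alpha> $ j)"
    by (simp add: matrix_def vec_eq_iff mat_def inner_axis' mult.commute) (simp add: axis_def)
  then show ?thesis by (simp add: det_rank_one_update)
qed

text \<open>Block triangular elimination in coordinate-free form: composing the differential with the shear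
  that moves the normal line to the radial line leaves only the tangential block.\<close>

lemma det_tangential_part:
  fixes D :: "real^'n \<Rightarrow> real^'n" and x \<nu> :: "real^'n"
  assumes D: "linear D" and \<nu>: "norm \<nu> = 1" and h: "x \<bullet> \<nu> = h" "h > 0" and Dx: "D x = (1 / h) *\<^sub>R \<nu>"
  defines "pr \<equiv> \<lambda>w. w - (w \<bullet> \<nu>) *\<^sub>R \<nu>"
  shows "det (matrix (\<lambda>w. h *\<^sub>R (D (pr w) - (D (pr w) \<bullet> \<nu>) *\<^sub>R \<nu>) + (w \<bullet> \<nu>) *\<^sub>R \<nu>)) =
    h ^ (CARD('n) + 1) * det (matrix D)"
proof -
  define M where "M w = h *\<^sub>R (D (pr w) - (D (pr w) \<bullet> \<nu>) *\<^sub>R \<nu>) + (w \<bullet> \<nu>) *\<^sub>R \<nu>" for w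
  have \<nu>\<nu>: "\<nu> \<bullet> \<nu> = 1" using \<nu> by (simp add: dot_square_norm)
  have pr: "linear pr"
    unfolding pr_def by (rule linearI) (simp_all add: algebra_simps inner_add_left)
  have pr_normal: "pr \<nu> = 0" by (simp add: pr_def \<nu>\<nu>)
  have Dpr: "linear (\<lambda>w. D (pr w))" using linear_compose[OF pr D] by (simp add: o_def)
  have M: "linear M"
    unfolding M_def
    by (rule linearI) (simp_all add: linear_add[OF Dpr] linear_scale[OF Dpr] algebra_simps inner_add_left)
  define a where "a w = h * (D (pr w) \<bullet> \<nu>)" for w
  have a: "linear a"
    unfolding a_def by (rule linearI) (simp_all add: linear_add[OF Dpr] linear_scale[OF Dpr] algebra_simps inner_add_left)
  define \<alpha> :: "real^'n" where "\<alpha> = adjoint a 1"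
  have a\<alpha>: "w \<bullet> \<alpha> = a w" for w
    using adjoint_works[OF a, of w 1] by (simp add: \<alpha>_def)
  define S where "S w = w + (w \<bullet> \<alpha>) *\<^sub>R \<nu>" for w
  define F where "F w = w + (w \<bullet> \<nu>) *\<^sub>R (x - \<nu>)" for w
  have S: "linear S" "det (matrix S) = 1"
  proof -
    show "linear S" unfolding S_def by (rule linearI) (simp_all add: algebra_simps inner_add_left)
    have "\<nu> \<bullet> \<alpha> = 0" by (simp add: a\<alpha> a_def pr_normal linear_0[OF D])
    then show "det (matrix S) = 1" unfolding S_def by (simp add: det_rank_one_map)
  qed
  have F: "linear F" "det (matrix F) = h"
  proof -
    show "linear F" unfolding F_def by (rule linearI) (simp_all add: algebra_simps inner_add_left)
    show "det (matrix F) = h" unfolding F_def by (simp add: det_rank_one_map inner_diff_left h \<nu>\<nu>)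
  qed
  have M\<nu>: "M \<nu> = \<nu>" by (simp add: M_def pr_normal linear_0[OF D] \<nu>\<nu>)
  have eq: "(\<lambda>w. h *\<^sub>R w) \<circ> (D \<circ> F) = M \<circ> S"
  proof
    fix w
    have "F w = pr w + (w \<bullet> \<nu>) *\<^sub>R x" by (simp add: F_def pr_def algebra_simps)
    then have "h *\<^sub>R D (F w) = h *\<^sub>R D (pr w) + (w \<bullet> \<nu>) *\<^sub>R \<nu>"
      using h(2) by (simp add: linear_add[OF D] linear_scale[OF D] Dx scaleR_add_right)
    also have "\<dots> = M w + a w *\<^sub>R \<nu>" by (simp add: M_def a_def algebra_simps)
    also have "\<dots> = M (S w)" by (simp add: S_def a\<alpha> linear_add[OF M] linear_scale[OF M] M\<nu>)
    finally show "((\<lambda>w. h *\<^sub>R w) \<circ> (D \<circ> F)) w = (M \<circ> S) w" by simp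
  qed
  have "det (matrix ((\<lambda>w :: real^'n. h *\<^sub>R w) \<circ> (D \<circ> F))) = det (matrix (\<lambda>w :: real^'n. h *\<^sub>R w)) * (det (matrix D) * det (matrix F))"
    using D F(1) by (simp add: matrix_compose linear_compose linear_scaleR det_mul)
  moreover have "det (matrix (M \<circ> S)) = det (matrix M) * det (matrix S)"
    using M S(1) by (simp add: matrix_compose det_mul)
  ultimately have "det (matrix M) = h ^ CARD('n) * (det (matrix D) * h)"
    unfolding eq by (simp add: S F)
  then show ?thesis by (simp add: M_def[abs_def] mult_ac)
qed

text \<open>The map \<open>T\<close> is the gradient of half the squared gauge, described by its duality properties.\<close>

locale dual_body = centered_body L for L :: "(real^'n) set" +
  fixes T :: "real^'n \<Rightarrow> real^'n"
  assumes dim: "CARD('n) \<ge> 2"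
    and T_inner: "\<And>y. y \<noteq> 0 \<Longrightarrow> y \<bullet> T y = (body_gauge L y)\<^sup>2"
    and T_le: "\<And>y z. y \<noteq> 0 \<Longrightarrow> z \<bullet> T y \<le> body_gauge L z * body_gauge L y"
    and T_scale: "\<And>y t. y \<noteq> 0 \<Longrightarrow> t > 0 \<Longrightarrow> T (t *\<^sub>R y) = t *\<^sub>R T y"
    and T_unique: "\<And>x w. x \<in> frontier L \<Longrightarrow> w \<in> polar_body L \<Longrightarrow> x \<bullet> w = 1 \<Longrightarrow> w = T x"
    and T_cont: "continuous_on (- {0}) T"
begin

lemma T_frontier: "x \<in> frontier L \<Longrightarrow> x \<bullet> T x = 1"
  using T_inner[of x] frontier_nonzero[of x] by (simp add: frontier_eq)

lemma T_polar: "x \<in> frontier L \<Longrightarrow> T x \<in> polar_body L"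
proof -
  assume x: "x \<in> frontier L"
  have "z \<bullet> T x \<le> 1" if "z \<in> L" for z
  proof -
    have "z \<bullet> T x \<le> body_gauge L z * body_gauge L x" using frontier_nonzero[OF x] by (rule T_le)
    also have "\<dots> \<le> 1" using that x by (simp add: frontier_eq gauge_le_1_iff)
    finally show ?thesis .
  qed
  then show ?thesis by (simp add: polar_body_def)
qed

lemma T_nonzero: "y \<noteq> 0 \<Longrightarrow> T y \<noteq> 0"
  using T_inner[of y] gauge_pos[of y] by auto

lemma gauge_polar_T: "y \<noteq> 0 \<Longrightarrow> body_gauge (polar_body L) (T y) = body_gauge L y"
proof (rule antisym)
  assume y: "y \<noteq> 0"
  show "body_gauge (polar_body L) (T y) \<le> body_gauge L y"
    unfolding gauge_polar
  proof (rule support_function_least)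
    fix z assume "z \<in> L"
    then have "body_gauge L z * body_gauge L y \<le> 1 * body_gauge L y"
      using gauge_nonneg[of y] by (intro mult_right_mono) (simp_all add: gauge_le_1_iff)
    then show "z \<bullet> T y \<le> body_gauge L y" using T_le[OF y, of z] by simp
  qed (use body_props in auto)
  have "((1 / body_gauge L y) *\<^sub>R y) \<bullet> T y \<le> body_gauge (polar_body L) (T y)"
    unfolding gauge_polar using radial_frontier[OF y] frontier_subset body_props
    by (intro support_function_upper) auto
  then show "body_gauge L y \<le> body_gauge (polar_body L) (T y)"
    using gauge_pos[OF y] y by (simp add: T_inner[OF y] power2_eq_square)
qed

text \<open>A unit outer normal at \<open>x\<close>, divided by its inner product with \<open>x\<close>, is a point of the polar body dual to
  \<open>x\<close>, hence equal to \<open>T x\<close>.\<close>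

lemma outer_normal_eq: "x \<in> frontier L \<Longrightarrow> outer_normal L x = (1 / norm (T x)) *\<^sub>R T x"
proof -
  assume x: "x \<in> frontier L"
  have Tx: "norm (T x) > 0" using T_nonzero[OF frontier_nonzero[OF x]] by simp
  show ?thesis
    unfolding outer_normal_def
  proof (rule the_equality)
    show "norm ((1 / norm (T x)) *\<^sub>R T x) = 1 \<and>
        (\<forall>y\<in>L. y \<bullet> ((1 / norm (T x)) *\<^sub>R T x) \<le> x \<bullet> ((1 / norm (T x)) *\<^sub>R T x))"
      using Tx T_polar[OF x] by (simp add: polar_body_def T_frontier[OF x] divide_right_mono)
    fix u assume u: "norm u = 1 \<and> (\<forall>y\<in>L. y \<bullet> u \<le> x \<bullet> u)"
    obtain r where r: "r > 0" "cball 0 r \<subseteq> L" by (rule inner_radius)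
    have "r *\<^sub>R u \<in> L" using r u by (intro subsetD[OF r(2)]) simp
    then have "(r *\<^sub>R u) \<bullet> u \<le> x \<bullet> u" using u by blast
    then have "x \<bullet> u \<ge> r" using u by (simp add: dot_square_norm)
    then have xu: "x \<bullet> u > 0" using r(1) by linarith
    have "(1 / (x \<bullet> u)) *\<^sub>R u \<in> polar_body L"
      using u xu by (simp add: polar_body_def divide_le_eq)
    then have "(1 / (x \<bullet> u)) *\<^sub>R u = T x" using xu by (intro T_unique[OF x]) auto
    then have *: "u = (x \<bullet> u) *\<^sub>R T x" using xu by (metis divide_inverse mult_1 scaleR_one scaleR_scaleR right_inverse less_irrefl)
    then have "1 = (x \<bullet> u) * norm (T x)" using u xu by (metis abs_of_pos norm_scaleR)
    then have "x \<bullet> u = 1 / norm (T x)" using Tx by (simp add: field_simps)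
    then show "u = (1 / norm (T x)) *\<^sub>R T x" using * by simp
  qed
qed

lemma support_outer_normal: "x \<in> frontier L \<Longrightarrow> support_function L (outer_normal L x) = 1 / norm (T x)"
proof -
  assume x: "x \<in> frontier L"
  have Tx: "norm (T x) > 0" using T_nonzero[OF frontier_nonzero[OF x]] by simp
  have "support_function L (outer_normal L x) = support_function L ((1 / norm (T x)) *\<^sub>R T x)"
    by (simp add: outer_normal_eq[OF x])
  also have "\<dots> = (1 / norm (T x)) * support_function L (T x)"
    using Tx body_props by (intro support_function_scale) auto
  also have "support_function L (T x) = 1"
    using gauge_polar_T[OF frontier_nonzero[OF x]] x by (simp add: gauge_polar frontier_eq)
  finally show ?thesis by simp
qed

text \<open>Duality bounds the error of the linear approximation at \<open>y\<close> by the oscillation of the normalised gradient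
  \<open>N\<close>, which tends to zero by continuity.\<close>

lemma has_derivative_gauge:
  assumes y: "y \<noteq> 0"
  shows "(body_gauge L has_derivative (\<lambda>v. (T y \<bullet> v) / body_gauge L y)) (at y)"
proof -
  define N where "N z = (1 / body_gauge L z) *\<^sub>R T z" for z
  have N: "z \<bullet> N y \<le> body_gauge L z" "y \<bullet> N y = body_gauge L y" if "y \<noteq> 0" for y z
    using T_le[OF that, of z] T_inner[OF that] gauge_pos[OF that]
    by (simp_all add: N_def divide_le_eq power2_eq_square)
  have "(body_gauge L has_derivative (\<lambda>v. N y \<bullet> v)) (at y within UNIV)"
  proof (rule has_derivativeI_sandwich)
    show "norm y > 0" using y by simp
    show "bounded_linear (\<lambda>v. N y \<bullet> v)" by (rule bounded_linear_inner_right)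
    show "((\<lambda>z. norm (N z - N y)) \<longlongrightarrow> 0) (at y within UNIV)"
    proof -
      have "(T \<longlongrightarrow> T y) (at y)"
        using T_cont y by (simp add: continuous_on_eq_continuous_at open_delete open_Compl isCont_def)
      moreover have "(body_gauge L \<longlongrightarrow> body_gauge L y) (at y)"
        using continuous_on_gauge[of UNIV] by (simp add: continuous_on_eq_continuous_at isCont_def)
      ultimately have "(N \<longlongrightarrow> N y) (at y)"
        unfolding N_def using y by (intro tendsto_intros) auto
      then show ?thesis by (simp add: tendsto_norm_zero_iff LIM_zero_iff)
    qed
    fix z assume zy: "z \<noteq> y" "dist z y < norm y"
    have z: "z \<noteq> 0" using zy by auto
    have "body_gauge L z - body_gauge L y - N y \<bullet> (z - y) = body_gauge L z - z \<bullet> N y"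
      using N(2)[OF y] by (simp add: inner_diff_right inner_commute)
    moreover have "\<dots> \<ge> 0" using N(1)[OF y, of z] by simp
    moreover have "body_gauge L z - z \<bullet> N y \<le> (z - y) \<bullet> (N z - N y)"
      using N(1)[OF z, of y] N(2)[OF z] N(2)[OF y] by (simp add: inner_diff_left inner_diff_right)
    moreover have "(z - y) \<bullet> (N z - N y) \<le> norm (z - y) * norm (N z - N y)" by (rule norm_cauchy_schwarz)
    ultimately have "norm (body_gauge L z - body_gauge L y - N y \<bullet> (z - y)) \<le> norm (N z - N y) * norm (z - y)"
      by (simp add: mult.commute)
    then show "norm (body_gauge L z - body_gauge L y - N y \<bullet> (z - y)) / norm (z - y) \<le> norm (N z - N y)"
      using zy by (simp add: divide_le_eq)
  qed
  then show ?thesis by (simp add: N_def)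
qed

text \<open>Every tangent vector is the velocity of a curve on the boundary, obtained by radial projection
  of a straight line.\<close>

lemma frontier_derivative_unique_tangent:
  assumes x: "x \<in> frontier L" and v: "v \<bullet> T x = 0"
    and D: "(f has_derivative D1) (at x within frontier L)" "(f has_derivative D2) (at x within frontier L)"
  shows "D1 v = D2 v"
proof -
  have nz: "x + s *\<^sub>R v \<noteq> 0" for s
  proof
    assume "x + s *\<^sub>R v = 0"
    then have "(x + s *\<^sub>R v) \<bullet> T x = 0" by simp
    then show False using v T_frontier[OF x] by (simp add: inner_add_left)
  qed
  define c where "c s = (1 / body_gauge L (x + s *\<^sub>R v)) *\<^sub>R (x + s *\<^sub>R v)" for s :: real
  have g1: "body_gauge L x = 1" using x by (simp add: frontier_eq)
  have c0: "c 0 = x" using g1 by (simp add: c_def)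
  have cf: "range c \<subseteq> frontier L" using radial_frontier[OF nz] by (auto simp: c_def)
  have line: "((\<lambda>s. x + s *\<^sub>R v) has_derivative (\<lambda>s. s *\<^sub>R v)) (at 0)"
    by (auto intro!: derivative_eq_intros)
  have "((\<lambda>s. body_gauge L (x + s *\<^sub>R v)) has_derivative (\<lambda>s. (T (x + 0 *\<^sub>R v) \<bullet> (s *\<^sub>R v)) / body_gauge L (x + 0 *\<^sub>R v))) (at 0)"
    by (rule has_derivative_compose[OF line has_derivative_gauge[OF nz]])
  then have g: "((\<lambda>s. body_gauge L (x + s *\<^sub>R v)) has_derivative (\<lambda>s. 0)) (at 0)"
    using v by (simp add: inner_commute)
  have "((\<lambda>s. 1 / body_gauge L (x + s *\<^sub>R v)) has_derivative (\<lambda>s. 0)) (at 0)"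
    using g1 by (auto intro!: derivative_eq_intros g)
  then have c: "(c has_derivative (\<lambda>s. s *\<^sub>R v)) (at 0)"
    unfolding c_def using has_derivative_scaleR[OF _ line] g1 by fastforce
  have "((\<lambda>s. f (c s)) has_derivative (\<lambda>s. D (s *\<^sub>R v))) (at 0)"
    if "(f has_derivative D) (at x within frontier L)" for D
  proof -
    have "(f has_derivative D) (at (c 0) within range c)"
      unfolding c0 using that cf by (rule has_derivative_subset)
    from diff_chain_within[OF c this] show ?thesis by (simp add: o_def)
  qed
  from has_derivative_unique[OF this[OF D(1)] this[OF D(2)]]
  have "D1 (1 *\<^sub>R v) = D2 (1 *\<^sub>R v)" by (rule fun_cong)
  then show ?thesis by simp
qed

end

locale smooth_dual_body = dual_body L T for L :: "(real^'n) set" and T +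
  fixes DT :: "real^'n \<Rightarrow> real^'n \<Rightarrow> real^'n"
  assumes T_deriv: "\<And>y. y \<noteq> 0 \<Longrightarrow> (T has_derivative DT y) (at y)"
begin

lemma linear_DT: "y \<noteq> 0 \<Longrightarrow> linear (DT y)"
  using T_deriv has_derivative_linear by blast

text \<open>Euler's relation for a homogeneous map of degree one.\<close>

lemma DT_radial: assumes y: "y \<noteq> 0" shows "DT y y = T y"
proof -
  have line: "((\<lambda>s. y + s *\<^sub>R y) has_derivative (\<lambda>s. s *\<^sub>R y)) (at (0::real))"
    by (auto intro!: derivative_eq_intros)
  have "((\<lambda>s. T (y + s *\<^sub>R y)) has_derivative (\<lambda>s. DT y (s *\<^sub>R y))) (at (0::real))"
    using has_derivative_compose[OF line, of T "DT y"] T_deriv[OF y] by simp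
  moreover have "((\<lambda>s. T (y + s *\<^sub>R y)) has_derivative (\<lambda>s. s *\<^sub>R T y)) (at (0::real))"
  proof (rule has_derivative_transform_within_open[of "\<lambda>s. (1 + s) *\<^sub>R T y"])
    show "((\<lambda>s. (1 + s) *\<^sub>R T y) has_derivative (\<lambda>s. s *\<^sub>R T y)) (at 0)"
      by (auto intro!: derivative_eq_intros)
    show "open {-1<..<1::real}" by simp
    fix s :: real assume "s \<in> {-1<..<1}"
    then show "(1 + s) *\<^sub>R T y = T (y + s *\<^sub>R y)"
      using T_scale[OF y, of "1 + s"] by (simp add: scaleR_add_left)
  qed simp
  ultimately have "(\<lambda>s. DT y (s *\<^sub>R y)) = (\<lambda>s::real. s *\<^sub>R T y)"
    by (rule has_derivative_unique)
  from fun_cong[OF this, of 1] show ?thesis by simp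
qed

lemma DT_scale: assumes y: "y \<noteq> 0" and t: "t > 0" shows "DT (t *\<^sub>R y) = DT y"
proof -
  have "((\<lambda>z. T (t *\<^sub>R z)) has_derivative (\<lambda>v. DT (t *\<^sub>R y) (t *\<^sub>R v))) (at y)"
  proof (rule has_derivative_compose[of "\<lambda>z. t *\<^sub>R z" "\<lambda>v. t *\<^sub>R v"])
    show "((\<lambda>z. t *\<^sub>R z) has_derivative (\<lambda>v. t *\<^sub>R v)) (at y)"
      by (auto intro!: derivative_eq_intros)
    show "(T has_derivative DT (t *\<^sub>R y)) (at (t *\<^sub>R y))" using T_deriv y t by simp
  qed
  moreover have "((\<lambda>z. T (t *\<^sub>R z)) has_derivative (\<lambda>v. t *\<^sub>R DT y v)) (at y)"
  proof (rule has_derivative_transform_within_open[of "\<lambda>z. t *\<^sub>R T z"])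
    show "((\<lambda>z. t *\<^sub>R T z) has_derivative (\<lambda>v. t *\<^sub>R DT y v)) (at y)"
      by (rule has_derivative_scaleR_right[OF T_deriv[OF y]])
    show "open (- {0 :: real^'n})" by (simp add: open_Compl)
  qed (use y t in \<open>auto simp: T_scale\<close>)
  ultimately have "(\<lambda>v. DT (t *\<^sub>R y) (t *\<^sub>R v)) = (\<lambda>v. t *\<^sub>R DT y v)"
    by (rule has_derivative_unique)
  then have "DT (t *\<^sub>R y) (t *\<^sub>R v) = t *\<^sub>R DT y v" for v by (rule fun_cong)
  moreover have "DT (t *\<^sub>R y) (t *\<^sub>R v) = t *\<^sub>R DT (t *\<^sub>R y) v" for v
    using linear_DT[of "t *\<^sub>R y"] y t by (simp add: linear_scale)
  ultimately show ?thesis using t by (intro ext) (metis less_irrefl scaleR_cancel_left)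
qed

text \<open>On the boundary the Gauss map is \<open>T / |T|\<close>. Derivatives of it within the boundary agree on tangent
  vectors with the derivative of this formula, and \<open>det_tangential_part\<close> evaluates the determinant.\<close>

lemma gauss_curvature_eq:
  assumes x: "x \<in> frontier L"
  shows "gauss_curvature L x = (1 / norm (T x)) ^ (CARD('n) + 1) * det (matrix (DT x))"
proof -
  have x0: "x \<noteq> 0" by (rule frontier_nonzero[OF x])
  define m where "m = norm (T x)"
  have m: "m > 0" using T_nonzero[OF x0] by (simp add: m_def)
  define \<nu> where "\<nu> = outer_normal L x"
  have \<nu>: "\<nu> = (1 / m) *\<^sub>R T x" unfolding \<nu>_def m_def by (rule outer_normal_eq[OF x])
  have T\<nu>: "T x = m *\<^sub>R \<nu>" using m by (simp add: \<nu>)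
  have n\<nu>: "norm \<nu> = 1" using m by (simp add: \<nu>) (simp add: m_def)
  define D0 where "D0 v = (1 / m) *\<^sub>R (DT x v - (DT x v \<bullet> \<nu>) *\<^sub>R \<nu>)" for v
  have D0: "(outer_normal L has_derivative D0) (at x within frontier L)"
  proof -
    have dn: "((\<lambda>y. norm (T y)) has_derivative (\<lambda>v. DT x v \<bullet> \<nu>)) (at x)"
      using has_derivative_compose[OF T_deriv[OF x0] has_derivative_norm[OF T_nonzero[OF x0]]] m
      by (simp add: sgn_div_norm \<nu> m_def divide_inverse)
    have di: "((\<lambda>y. 1 / norm (T y)) has_derivative (\<lambda>v. - (DT x v \<bullet> \<nu>) / (m * m))) (at x)"
      using m by (auto intro!: derivative_eq_intros dn simp: m_def)
    have "((\<lambda>y. (1 / norm (T y)) *\<^sub>R T y) has_derivative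
        (\<lambda>v. (1 / norm (T x)) *\<^sub>R DT x v + (- (DT x v \<bullet> \<nu>) / (m * m)) *\<^sub>R T x)) (at x)"
      by (rule has_derivative_scaleR[OF di T_deriv[OF x0]])
    also have "(\<lambda>v. (1 / norm (T x)) *\<^sub>R DT x v + (- (DT x v \<bullet> \<nu>) / (m * m)) *\<^sub>R T x) = D0"
      using m by (simp add: fun_eq_iff D0_def T\<nu> n\<nu> scaleR_diff_right)
    finally have "((\<lambda>y. (1 / norm (T y)) *\<^sub>R T y) has_derivative D0) (at x within frontier L)"
      by (rule has_derivative_at_withinI)
    then show ?thesis
      by (rule has_derivative_transform[OF x outer_normal_eq, rotated])
  qed
  define D where "D = (SOME D. (outer_normal L has_derivative D) (at x within frontier L))"
  have D: "(outer_normal L has_derivative D) (at x within frontier L)"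
    unfolding D_def by (rule someI[of _ D0]) (rule D0)
  have \<nu>\<nu>: "\<nu> \<bullet> \<nu> = 1" using n\<nu> by (simp add: dot_square_norm)
  have DD0: "D (v - (v \<bullet> \<nu>) *\<^sub>R \<nu>) = D0 (v - (v \<bullet> \<nu>) *\<^sub>R \<nu>)" for v
    by (rule frontier_derivative_unique_tangent[OF x _ D D0]) (simp add: T\<nu> inner_diff_left \<nu>\<nu>)
  have "gauss_curvature L x = det (matrix (\<lambda>v. D (v - (v \<bullet> \<nu>) *\<^sub>R \<nu>) + (v \<bullet> \<nu>) *\<^sub>R \<nu>))"
    unfolding gauss_curvature_def Let_def \<nu>_def[symmetric] D_def[symmetric] ..
  also have "\<dots> = (1 / m) ^ (CARD('n) + 1) * det (matrix (DT x))"
    unfolding DD0 D0_def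
  proof (rule det_tangential_part[OF linear_DT[OF x0] n\<nu>])
    show "x \<bullet> \<nu> = 1 / m" using T_frontier[OF x] by (simp add: \<nu>)
    show "DT x x = (1 / (1 / m)) *\<^sub>R \<nu>" by (simp add: DT_radial[OF x0] T\<nu>)
  qed (use m in simp)
  finally show ?thesis by (simp add: m_def)
qed

end

section \<open>Affine surface area as an integral over the body\<close>

locale positive_body = smooth_dual_body L T DT for L :: "(real^'n) set" and T DT +
  assumes det_pos: "\<And>y. y \<noteq> 0 \<Longrightarrow> det (matrix (DT y)) > 0"
    and det_cont: "continuous_on (- {0}) (\<lambda>y. det (matrix (DT y)))"
begin

abbreviation curv :: "real^'n \<Rightarrow> real" where
  "curv y \<equiv> det (matrix (DT y))"

lemma inj_DT: "y \<noteq> 0 \<Longrightarrow> inj (DT y)"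
  using det_pos[of y] det_nz_iff_inj[OF linear_DT[of y]] by simp

text \<open>If two boundary points had the same image, the segment between them would lie in the boundary and
  \<open>T\<close> would be constant along it, in contradiction to the injectivity of its derivative.\<close>

lemma T_inj_frontier:
  assumes x: "x \<in> frontier L" and y: "y \<in> frontier L" and eq: "T x = T y"
  shows "x = y"
proof -
  define m where "m = (1/2) *\<^sub>R (x + y)"
  define d where "d = (1/2) *\<^sub>R (y - x)"
  have T: "T (m + s *\<^sub>R d) = T x" "m + s *\<^sub>R d \<noteq> 0" if s: "s \<in> {-1<..<1}" for s :: real
  proof -
    have z: "m + s *\<^sub>R d = ((1 - s) / 2) *\<^sub>R x + ((1 + s) / 2) *\<^sub>R y"
      by (simp add: m_def d_def algebra_simps diff_divide_distrib add_divide_distrib)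
    have zL: "m + s *\<^sub>R d \<in> L"
      unfolding z using x y frontier_subset s by (intro convexD[OF body_props(1)]) (auto simp: field_simps)
    have zT: "(m + s *\<^sub>R d) \<bullet> T x = 1"
      unfolding z using T_frontier[OF x] T_frontier[OF y]
      by (simp add: inner_add_left eq) (simp add: field_simps)
    then have "1 \<le> body_gauge L (m + s *\<^sub>R d)"
      using gauge_upper[OF T_polar[OF x], of "m + s *\<^sub>R d"] by (simp add: inner_commute)
    then have zf: "m + s *\<^sub>R d \<in> frontier L"
      using zL by (simp add: frontier_eq antisym flip: gauge_le_1_iff)
    show "T (m + s *\<^sub>R d) = T x"
      using T_unique[OF zf T_polar[OF x] zT] by simp
    show "m + s *\<^sub>R d \<noteq> 0" by (rule frontier_nonzero[OF zf])
  qed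
  have m0: "m \<noteq> 0" using T(2)[of 0] by simp
  have line: "((\<lambda>s. m + s *\<^sub>R d) has_derivative (\<lambda>s. s *\<^sub>R d)) (at (0::real))"
    by (auto intro!: derivative_eq_intros)
  have "((\<lambda>s. T (m + s *\<^sub>R d)) has_derivative (\<lambda>s. DT m (s *\<^sub>R d))) (at (0::real))"
    using has_derivative_compose[OF line, of T "DT m"] T_deriv[OF m0] by simp
  moreover have "((\<lambda>s. T (m + s *\<^sub>R d)) has_derivative (\<lambda>s. 0)) (at (0::real))"
  proof (rule has_derivative_transform_within_open[of "\<lambda>s. T x"])
    show "((\<lambda>s. T x) has_derivative (\<lambda>s. 0)) (at (0::real))" by (rule has_derivative_const)
    show "open {-1<..<1::real}" by simp
  qed (use T in auto)
  ultimately have "(\<lambda>s. DT m (s *\<^sub>R d)) = (\<lambda>s::real. 0)"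
    by (rule has_derivative_unique)
  from fun_cong[OF this, of 1] have "DT m d = DT m 0"
    by (simp add: linear_0[OF linear_DT[OF m0]])
  then have "d = 0" using inj_DT[OF m0] by (rule injD[rotated])
  then show ?thesis by (simp add: d_def)
qed

text \<open>By injectivity of the Gauss map the boundary point with the given normal is \<open>x\<close>. The powers of
  \<open>|T x|\<close> in the curvature and in the support function cancel.\<close>

lemma centro_affine_curvature_eq:
  assumes x: "x \<in> frontier L"
  shows "centro_affine_curvature L (outer_normal L x) = curv x"
proof -
  have nz: "norm (T y) > 0" if "y \<in> frontier L" for y
    using T_nonzero[OF frontier_nonzero[OF that]] by simp
  have inj: "y = x" if y: "y \<in> frontier L" "outer_normal L y = outer_normal L x" for y
  proof -
    have "1 / norm (T y) = 1 / norm (T x)"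
      using support_outer_normal[OF y(1)] support_outer_normal[OF x] y(2) by simp
    then have "norm (T y) = norm (T x)" using nz[OF x] nz[OF y(1)] by (simp add: field_simps)
    then have "(1 / norm (T x)) *\<^sub>R T y = (1 / norm (T x)) *\<^sub>R T x"
      using y(2) outer_normal_eq[OF y(1)] outer_normal_eq[OF x] by simp
    then have "T y = T x" using nz[OF x] by simp
    then show ?thesis by (rule T_inj_frontier[OF y(1) x])
  qed
  have "(THE y. y \<in> frontier L \<and> outer_normal L y = outer_normal L x) = x"
    by (rule the_equality) (use x inj in auto)
  then have "centro_affine_curvature L (outer_normal L x) =
      (1 / norm (T x)) ^ (CARD('n) + 1) * curv x / (1 / norm (T x)) ^ (CARD('n) + 1)"
    unfolding centro_affine_curvature_def gauss_curvature_at_normal_def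
    by (simp only: gauss_curvature_eq[OF x] support_outer_normal[OF x])
  also have "\<dots> = curv x" using nz[OF x] by simp
  finally show ?thesis .
qed

text \<open>A nonzero point \<open>w\<close> is a positive multiple of \<open>T x\<close> for a maximiser \<open>x\<close> of \<open>\<lambda>x. x \<bullet> w\<close> on the body.\<close>

lemma T_image: "T ` (- {0}) = - {0}" and T_inj: "inj_on T (- {0})"
proof -
  show "inj_on T (- {0})"
  proof (rule inj_onI)
    fix y z assume yz: "y \<in> - {0}" "z \<in> - {0}" "T y = T z"
    then have nz: "y \<noteq> 0" "z \<noteq> 0" by auto
    have g: "body_gauge L y = body_gauge L z"
      using gauge_polar_T[OF nz(1)] gauge_polar_T[OF nz(2)] yz(3) by simp
    let ?t = "1 / body_gauge L y"
    have t: "?t > 0" using gauge_pos[OF nz(1)] by simp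
    have "?t *\<^sub>R y = ?t *\<^sub>R z"
    proof (rule T_inj_frontier)
      show "?t *\<^sub>R y \<in> frontier L" by (rule radial_frontier[OF nz(1)])
      show "?t *\<^sub>R z \<in> frontier L" using radial_frontier[OF nz(2)] by (simp add: g)
      show "T (?t *\<^sub>R y) = T (?t *\<^sub>R z)" using T_scale t nz yz(3) by simp
    qed
    then show "y = z" using t by (metis less_irrefl scaleR_cancel_left)
  qed
  show "T ` (- {0}) = - {0}"
  proof (intro subset_antisym subsetI)
    fix w assume "w \<in> - {0 :: real^'n}"
    then have w: "w \<noteq> 0" by simp
    have "continuous_on L (\<lambda>x. x \<bullet> w)" by (intro continuous_intros)
    moreover have "L \<noteq> {}" using body_props by auto
    ultimately obtain x where x: "x \<in> L" "\<And>y. y \<in> L \<Longrightarrow> y \<bullet> w \<le> x \<bullet> w"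
      using continuous_attains_sup[OF body_props(2), of "\<lambda>x. x \<bullet> w"] by blast
    obtain r where r: "r > 0" "cball 0 r \<subseteq> L" by (rule inner_radius)
    have "(r / norm w) *\<^sub>R w \<in> L" using r w by (intro subsetD[OF r(2)]) simp
    then have "((r / norm w) *\<^sub>R w) \<bullet> w \<le> x \<bullet> w" by (rule x(2))
    moreover have "((r / norm w) *\<^sub>R w) \<bullet> w = r * norm w"
      using w by (simp add: dot_square_norm power2_eq_square)
    moreover have "r * norm w > 0" using r w by simp
    ultimately have h: "x \<bullet> w > 0" by linarith
    have p: "(1 / (x \<bullet> w)) *\<^sub>R w \<in> polar_body L"
      using x(2) h by (simp add: polar_body_def divide_le_eq)
    have 1: "x \<bullet> ((1 / (x \<bullet> w)) *\<^sub>R w) = 1" using h by simp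
    have "1 \<le> body_gauge L x" using gauge_upper[OF p, of x] 1 by (simp add: inner_commute)
    then have xf: "x \<in> frontier L"
      using x(1) by (simp add: frontier_eq antisym flip: gauge_le_1_iff)
    have "T x = (1 / (x \<bullet> w)) *\<^sub>R w" using T_unique[OF xf p 1] by simp
    then have "T ((x \<bullet> w) *\<^sub>R x) = w"
      using T_scale[OF frontier_nonzero[OF xf] h] h by simp
    then show "w \<in> T ` (- {0})" using frontier_nonzero[OF xf] h by (intro image_eqI[of _ _ "(x \<bullet> w) *\<^sub>R x"]) auto
  qed (use T_nonzero in auto)
qed

definition T_inverse :: "real^'n \<Rightarrow> real^'n" where
  "T_inverse = inv_into (- {0}) T"

definition DT_inverse :: "real^'n \<Rightarrow> real^'n \<Rightarrow> real^'n" where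
  "DT_inverse w v = matrix_inv (matrix (DT (T_inverse w))) *v v"

lemma T_inverse:
  "w \<noteq> 0 \<Longrightarrow> T (T_inverse w) = w" "w \<noteq> 0 \<Longrightarrow> T_inverse w \<noteq> 0" "y \<noteq> 0 \<Longrightarrow> T_inverse (T y) = y"
proof -
  show "T (T_inverse w) = w" if "w \<noteq> 0"
    unfolding T_inverse_def using T_image that by (intro f_inv_into_f) auto
  show "T_inverse w \<noteq> 0" if "w \<noteq> 0"
    unfolding T_inverse_def using inv_into_into[of w T "- {0}"] T_image that by auto
  show "T_inverse (T y) = y" if "y \<noteq> 0"
    unfolding T_inverse_def using T_inj that by (intro inv_into_f_f) auto
qed

lemma gauge_T_inverse: "w \<noteq> 0 \<Longrightarrow> body_gauge L (T_inverse w) = body_gauge (polar_body L) w"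
  using gauge_polar_T[OF T_inverse(2)[of w]] T_inverse(1)[of w] by simp

lemma cauchy_schwarz_gauge: "z \<bullet> y \<le> body_gauge (polar_body L) z * body_gauge L y"
proof (cases "y = 0")
  case False
  have "((1 / body_gauge L y) *\<^sub>R y) \<bullet> z \<le> body_gauge (polar_body L) z"
    unfolding gauge_polar using radial_frontier[OF False] frontier_subset body_props
    by (intro support_function_upper) auto
  then show ?thesis
    using gauge_pos[OF False] by (simp add: divide_le_eq inner_commute mult.commute)
qed simp

lemma matrix_DT_inverse:
  assumes w: "w \<noteq> 0"
  shows "matrix (DT_inverse w) = matrix_inv (matrix (DT (T_inverse w)))"
    "matrix_inv (matrix (DT (T_inverse w))) ** matrix (DT (T_inverse w)) = mat 1"
    "det (matrix (DT_inverse w)) = 1 / curv (T_inverse w)"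
proof -
  let ?A = "matrix (DT (T_inverse w))"
  have A: "invertible ?A"
    using det_pos[OF T_inverse(2)[OF w]] by (simp add: invertible_det_nz)
  show 1: "matrix (DT_inverse w) = matrix_inv ?A"
    by (simp add: DT_inverse_def[abs_def])
  show 2: "matrix_inv ?A ** ?A = mat 1"
    using A unfolding invertible_def matrix_inv_def by (rule someI2_ex) blast
  have "det (matrix_inv ?A) * det ?A = 1"
    by (metis 2 det_I det_mul)
  then show "det (matrix (DT_inverse w)) = 1 / curv (T_inverse w)"
    unfolding 1 using det_pos[OF T_inverse(2)[OF w]] by (simp add: field_simps)
qed

lemma continuous_on_T_inverse: "continuous_on (- {0}) T_inverse"
  using continuous_on_inverse_open[OF _ T_cont, of T_inverse] T_inverse(3)
  by (simp add: T_image open_Compl)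

text \<open>Duality is symmetric: the inverse of \<open>T\<close> is for the polar body what \<open>T\<close> is for the body.\<close>

lemma polar_positive_body: "positive_body (polar_body L) T_inverse DT_inverse"
proof -
  interpret pol: centered_body "polar_body L" by (rule centered_body_polar)
  show ?thesis
  proof
    show "CARD('n) \<ge> 2" by (rule dim)
    fix y :: "real^'n" assume y: "y \<noteq> 0"
    show "y \<bullet> T_inverse y = (body_gauge (polar_body L) y)\<^sup>2"
      using T_inner[OF T_inverse(2)[OF y]] T_inverse(1)[OF y] gauge_T_inverse[OF y] by (simp add: inner_commute)
    show "z \<bullet> T_inverse y \<le> body_gauge (polar_body L) z * body_gauge (polar_body L) y" for z
      using cauchy_schwarz_gauge[of z "T_inverse y"] gauge_T_inverse[OF y] by simp
    show "T_inverse (t *\<^sub>R y) = t *\<^sub>R T_inverse y" if t: "t > 0" for t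
    proof -
      have "T (t *\<^sub>R T_inverse y) = t *\<^sub>R y"
        using T_scale[OF T_inverse(2)[OF y] t] T_inverse(1)[OF y] by simp
      then show ?thesis
        using T_inverse(3)[of "t *\<^sub>R T_inverse y"] T_inverse(2)[OF y] t by simp
    qed
    show "(T_inverse has_derivative DT_inverse y) (at y)"
    proof (rule has_derivative_inverse_basic[where g = T_inverse and y = y, OF T_deriv[OF T_inverse(2)[OF y]]])
      show "bounded_linear (DT_inverse y)"
        unfolding DT_inverse_def[abs_def] by (rule matrix_vector_mul_bounded_linear)
      show "DT_inverse y \<circ> DT (T_inverse y) = id"
      proof
        fix v
        have "DT (T_inverse y) v = matrix (DT (T_inverse y)) *v v"
          using fun_cong[OF matrix_vector_mul(2)[OF linear_DT[OF T_inverse(2)[OF y]]], of v] by simp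
        then show "(DT_inverse y \<circ> DT (T_inverse y)) v = id v"
          using matrix_DT_inverse(2)[OF y] by (simp add: DT_inverse_def matrix_vector_mul_assoc)
      qed
      show "continuous (at y) T_inverse"
        using continuous_on_T_inverse y by (simp add: continuous_on_eq_continuous_at open_Compl)
      show "open (- {0 :: real^'n})" by (simp add: open_Compl)
    qed (use y T_inverse in auto)
    show "det (matrix (DT_inverse y)) > 0"
      using matrix_DT_inverse(3)[OF y] det_pos[OF T_inverse(2)[OF y]] by simp
  next
    fix x w assume x: "x \<in> frontier (polar_body L)" and w: "w \<in> polar_body (polar_body L)" and xw: "x \<bullet> w = 1"
    have xp: "x \<in> polar_body L" using pol.frontier_subset x by blast
    have "1 \<le> body_gauge L w" using gauge_upper[OF xp, of w] xw by simp
    then have wf: "w \<in> frontier L"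
      using w unfolding polar_polar by (simp add: frontier_eq antisym flip: gauge_le_1_iff)
    have "x = T w" using xw by (intro T_unique[OF wf xp]) (simp add: inner_commute)
    then show "w = T_inverse x" using T_inverse(3)[OF frontier_nonzero[OF wf]] by simp
  next
    show "continuous_on (- {0}) T_inverse" by (rule continuous_on_T_inverse)
    have "continuous_on (- {0}) (\<lambda>w. 1 / curv (T_inverse w))"
    proof (intro continuous_on_divide continuous_on_const)
      show "continuous_on (- {0}) (\<lambda>w. curv (T_inverse w))"
      proof (rule continuous_on_compose2[OF det_cont continuous_on_T_inverse], rule subsetI)
        fix z assume "z \<in> T_inverse ` (- {0})"
        then obtain w where w: "w \<in> - {0}" "z = T_inverse w" by (rule imageE)
        then show "z \<in> - {0}" using T_inverse(2)[of w] by simp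
      qed
      show "\<forall>x\<in>- {0}. curv (T_inverse x) \<noteq> 0"
      proof
        fix w :: "real^'n" assume "w \<in> - {0}"
        then show "curv (T_inverse w) \<noteq> 0" using det_pos[OF T_inverse(2)[of w]] by simp
      qed
    qed
    then show "continuous_on (- {0}) (\<lambda>y. det (matrix (DT_inverse y)))"
      by (rule continuous_on_cong[THEN iffD1, rotated -1]) (simp_all add: matrix_DT_inverse(3))
  qed
qed

lemma smooth_normal: "smooth_normal_body L"
proof
  show "CARD('n) \<ge> 2" by (rule dim)
  show "continuous_on (frontier L) (outer_normal L)"
  proof (rule continuous_on_cong[THEN iffD1, rotated -1])
    show "continuous_on (frontier L) (\<lambda>x. (1 / norm (T x)) *\<^sub>R T x)"
      using T_nonzero frontier_nonzero
      by (intro continuous_intros continuous_on_subset[OF T_cont]) auto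
  qed (simp_all add: outer_normal_eq)
  fix x assume x: "x \<in> frontier L"
  have nz: "norm (T x) > 0" using T_nonzero[OF frontier_nonzero[OF x]] by simp
  show "norm (outer_normal L x) = 1" using nz by (simp add: outer_normal_eq[OF x])
  show "y \<bullet> outer_normal L x \<le> x \<bullet> outer_normal L x" if "y \<in> L" for y
    using nz T_polar[OF x] that by (simp add: outer_normal_eq[OF x] polar_body_def T_frontier[OF x] divide_right_mono)
qed

lemma curv_radial: "y \<noteq> 0 \<Longrightarrow> curv ((1 / body_gauge L y) *\<^sub>R y) = curv y"
  using DT_scale[of y "1 / body_gauge L y"] gauge_pos[of y] by simp

lemma curv_powr_continuous: "continuous_on (- {0}) (\<lambda>y. curv y powr s)"
  by (rule continuous_on_powr[OF det_cont continuous_on_const]) (use det_pos in force)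

lemma curv_powr_integrable: "set_integrable lborel (L - {0}) (\<lambda>y. curv y powr s)"
proof -
  have "compact ((\<lambda>y. curv y powr s) ` frontier L)"
    using compact_frontier frontier_nonzero
    by (intro compact_continuous_image continuous_on_subset[OF curv_powr_continuous]) auto
  then obtain B where B: "\<And>y. y \<in> frontier L \<Longrightarrow> norm (curv y powr s) \<le> B"
    using compact_imp_bounded bounded_iff by (metis (no_types, lifting) image_eqI)
  have bound: "norm (curv y powr s) \<le> B" if "y \<noteq> 0" for y
    using B[OF radial_frontier[OF that]] by (simp only: curv_radial[OF that])
  have Lb: "L - {0} \<in> sets borel" using body_props by auto
  have m: "(\<lambda>y. indicator (L - {0}) y *\<^sub>R (curv y powr s)) \<in> borel_measurable borel"
    by (rule borel_measurable_continuous_on_indicator[OF Lb])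
       (rule continuous_on_subset[OF curv_powr_continuous], auto)
  have fin: "emeasure lborel (L - {0}) < \<infinity>"
    using body_props(4) by (intro emeasure_bounded_finite) (rule bounded_subset, auto)
  show ?thesis
    unfolding set_integrable_def
    by (rule integrableI_bounded_set[of "L - {0}" _ _ B])
       (use Lb m fin bound in \<open>auto simp: indicator_def\<close>)
qed

lemma curv_powr_integrable_on: "(\<lambda>y. curv y powr s) integrable_on (L - {0})"
  using set_borel_integral_eq_integral(1)[OF curv_powr_integrable] .

text \<open>The integrand is constant along rays, so its integral against the cone measure is \<open>n\<close> times its integral
  over the body.\<close>

theorem affine_surface_area_eq_integral:
  "affine_surface_area (ereal q) L =
    real CARD('n) * integral (L - {0}) (\<lambda>y. curv y powr (q / (real CARD('n) + q)))"
proof -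
  interpret smooth_normal_body L by (rule smooth_normal)
  define s where "s = q / (real CARD('n) + q)"
  let ?g = "\<lambda>x. centro_affine_curvature L (outer_normal L x) powr s"
  have "(\<lambda>x. curv x powr s) \<in> borel_measurable (restrict_space borel (frontier L))"
    using frontier_nonzero
    by (intro borel_measurable_continuous_on_restrict continuous_on_subset[OF curv_powr_continuous]) auto
  then have g: "?g \<in> borel_measurable (restrict_space borel (frontier L))"
    by (rule measurable_cong[THEN iffD1, rotated]) (simp add: centro_affine_curvature_eq space_restrict_space)
  then have gc: "?g \<in> borel_measurable (cone_measure L)"
    using measurable_cong_sets[OF sets_surface(1) refl] by blast
  let ?h = "\<lambda>x. indicator (L - {0}) x *\<^sub>R (curv x powr s)"
  have "(\<integral>\<^sup>+x. ennreal (?g x) \<partial>cone_measure L) =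
     of_nat CARD('n) * (\<integral>\<^sup>+x. ennreal (?g ((1 / body_gauge L x) *\<^sub>R x)) * indicator (L - {0}) x \<partial>lborel)"
    using g by (intro nn_integral_cone_measure) simp
  also have "(\<integral>\<^sup>+x. ennreal (?g ((1 / body_gauge L x) *\<^sub>R x)) * indicator (L - {0}) x \<partial>lborel) =
     (\<integral>\<^sup>+x. ennreal (?h x) \<partial>lborel)"
    by (intro nn_integral_cong)
       (auto simp: indicator_def centro_affine_curvature_eq radial_frontier curv_radial simp del: mult_1 split: if_splits)
  also have "\<dots> = ennreal (integral\<^sup>L lborel ?h)"
    using curv_powr_integrable[of s] by (intro nn_integral_eq_integral) (auto simp: set_integrable_def)
  also have "integral\<^sup>L lborel ?h = integral (L - {0}) (\<lambda>y. curv y powr s)"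
    using set_borel_integral_eq_integral(2)[OF curv_powr_integrable[of s]] by (simp add: set_lebesgue_integral_def)
  finally have nn: "(\<integral>\<^sup>+x. ennreal (?g x) \<partial>cone_measure L) =
     of_nat CARD('n) * ennreal (integral (L - {0}) (\<lambda>y. curv y powr s))" .
  have nonneg: "0 \<le> integral (L - {0}) (\<lambda>y. curv y powr s)"
    by (intro integral_nonneg curv_powr_integrable_on) simp
  have "(LINT x|cone_measure L. ?g x) = enn2real (\<integral>\<^sup>+x. ennreal (?g x) \<partial>cone_measure L)"
    by (rule integral_eq_nn_integral[OF gc]) simp
  also have "\<dots> = real CARD('n) * integral (L - {0}) (\<lambda>y. curv y powr s)"
    unfolding nn using nonneg by (simp add: enn2real_mult)
  finally show ?thesis
    unfolding affine_surface_area_def s_def by simp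
qed

lemma measure_eq_integral: "measure lebesgue L = integral (L - {0}) (\<lambda>y. curv y powr 0)"
proof -
  have "L - {0} \<in> lmeasurable" "L \<in> lmeasurable"
    using body_props by (auto intro!: bounded_set_imp_lmeasurable bounded_subset[OF body_props(4)])
  have "measure lebesgue L = integral L (\<lambda>y. 1)"
    using \<open>L \<in> lmeasurable\<close> by (rule lmeasure_integral)
  also have "\<dots> = integral (L - {0}) (\<lambda>y. 1)"
    by (rule integral_spike_set[symmetric]) (auto intro: negligible_subset[of "{0}"])
  also have "\<dots> = integral (L - {0}) (\<lambda>y. curv y powr 0)"
    by (rule integral_cong) (use det_pos in force)
  finally show ?thesis .
qed

text \<open>The gradient map carries the body to its polar body. Its Jacobian determinant is the curvature, and the
  curvature of the polar body at the image of a point is the reciprocal of that of the body at the point.\<close>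

theorem integral_polar_curv_powr:
  "integral (polar_body L - {0}) (\<lambda>w. det (matrix (DT_inverse w)) powr s) =
    integral (L - {0}) (\<lambda>y. curv y powr (1 - s))"
proof -
  interpret pol: centered_body "polar_body L" by (rule centered_body_polar)
  have Lb: "L - {0} \<in> sets borel" using body_props by auto
  have img: "T ` (L - {0}) = polar_body L - {0}"
  proof (intro subset_antisym subsetI)
    fix w assume "w \<in> T ` (L - {0})"
    then obtain y where y: "y \<in> L" "y \<noteq> 0" "w = T y" by blast
    then have "body_gauge (polar_body L) w \<le> 1"
      using gauge_polar_T[OF y(2)] by (simp add: gauge_le_1_iff)
    then show "w \<in> polar_body L - {0}"
      using T_nonzero[OF y(2)] y(3) by (simp add: pol.gauge_le_1_iff)
  next
    fix w assume w: "w \<in> polar_body L - {0}"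
    then have "body_gauge L (T_inverse w) \<le> 1"
      using gauge_T_inverse[of w] by (simp add: pol.gauge_le_1_iff)
    then have "T_inverse w \<in> L - {0}"
      using T_inverse(2)[of w] w by (simp add: gauge_le_1_iff)
    then show "w \<in> T ` (L - {0})" using T_inverse(1)[of w] w by (metis DiffD2 image_eqI singletonI)
  qed
  have "((\<lambda>y. curv y powr (1 - s)) has_integral integral (L - {0}) (\<lambda>y. curv y powr (1 - s))) (L - {0})"
    using curv_powr_integrable_on by (rule integrable_integral)
  then have "((\<lambda>y. \<bar>det (matrix (DT y))\<bar> * (det (matrix (DT_inverse (T y))) powr s)) has_integral
      integral (L - {0}) (\<lambda>y. curv y powr (1 - s))) (L - {0})"
  proof (rule has_integral_cong[THEN iffD1, rotated])
    fix y assume "y \<in> L - {0}"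
    then have y: "y \<noteq> 0" by simp
    have "det (matrix (DT_inverse (T y))) = 1 / curv y"
      using matrix_DT_inverse(3)[OF T_nonzero[OF y]] T_inverse(3)[OF y] by simp
    then show "curv y powr (1 - s) = \<bar>det (matrix (DT y))\<bar> * (det (matrix (DT_inverse (T y))) powr s)"
      using det_pos[OF y] by (simp add: powr_diff powr_divide)
  qed
  then have "((\<lambda>w. det (matrix (DT_inverse w)) powr s) has_integral
      integral (L - {0}) (\<lambda>y. curv y powr (1 - s))) (T ` (L - {0}))"
  proof (rule has_integral_change_of_variables[THEN iffD1, rotated -1])
    show "L - {0} \<in> sets borel" by (rule Lb)
    show "bounded (L - {0})" by (rule bounded_subset[OF body_props(4)]) auto
    show "bounded (T ` (L - {0}))" unfolding img by (rule bounded_subset[OF pol.body_props(4)]) auto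
    show "(T has_derivative DT x) (at x within L - {0})" if "x \<in> L - {0}" for x
      using T_deriv[of x] that by (auto intro: has_derivative_at_withinI)
    show "inj_on T (L - {0})" by (rule inj_on_subset[OF T_inj]) auto
  qed simp
  then show ?thesis unfolding img by (rule integral_unique)
qed

end

section \<open>Bodies with twice continuously differentiable boundary\<close>

text \<open>A local defining function determines the normal cone at a boundary point, hence the normalised
  normal \<open>g y / (y \<bullet> g y)\<close>, which varies differentiably.\<close>

lemma (in centered_body) defining_function_normal:
  assumes U: "open U" "y \<in> U" "y \<in> frontier L" and LU: "L \<inter> U = {z \<in> U. G z \<le> 0}"
    and G: "(G has_derivative (\<lambda>v. gy \<bullet> v)) (at y)" and gy: "gy \<noteq> 0"
  shows "y \<bullet> gy > 0" "(1 / (y \<bullet> gy)) *\<^sub>R gy \<in> polar_body L"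
    "\<And>w. w \<in> polar_body L \<Longrightarrow> y \<bullet> w = 1 \<Longrightarrow> w = (1 / (y \<bullet> gy)) *\<^sub>R gy"
proof -
  have yL: "y \<in> L" using U(3) frontier_subset by blast
  have Gle: "G y \<le> 0" using LU U(2) yL by blast
  have G0: "G y = 0"
  proof (rule ccontr)
    assume "G y \<noteq> 0"
    then have neg: "G y < 0" using Gle by simp
    have "(G \<longlongrightarrow> G y) (at y)"
      using has_derivative_continuous[OF G] by (simp add: continuous_within)
    then have "eventually (\<lambda>z. G z < 0) (at y)" using neg by (rule order_tendstoD(2))
    then have "eventually (\<lambda>z. G z < 0) (nhds y)" using neg by (simp add: eventually_nhds_conv_at)
    moreover have "eventually (\<lambda>z. z \<in> U) (nhds y)" using U by (simp add: eventually_nhds_in_open)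
    ultimately have "eventually (\<lambda>z. z \<in> L) (nhds y)"
    proof eventually_elim
      fix z assume "G z < 0" "z \<in> U"
      then have "z \<in> L \<inter> U" unfolding LU by simp
      then show "z \<in> L" by simp
    qed
    then obtain S where "open S" "y \<in> S" "\<forall>z\<in>S. z \<in> L" unfolding eventually_nhds by blast
    then have "y \<in> interior L" by (intro interiorI[of S]) auto
    then show False using U(3) by (simp add: frontier_def)
  qed
  have ray: "((\<lambda>t. G (y + t *\<^sub>R v)) has_real_derivative (gy \<bullet> v)) (at 0)" for v
  proof -
    have "((\<lambda>t. y + t *\<^sub>R v) has_derivative (\<lambda>t. t *\<^sub>R v)) (at (0::real))"
      by (auto intro!: derivative_eq_intros)
    from has_derivative_compose[OF this, of G "\<lambda>v. gy \<bullet> v"] G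
    have "((\<lambda>t. G (y + t *\<^sub>R v)) has_derivative (\<lambda>t. gy \<bullet> (t *\<^sub>R v))) (at 0)" by simp
    then show ?thesis unfolding has_field_derivative_def by (simp add: mult_commute_abs)
  qed
  have inU: "\<exists>d>0. \<forall>t. 0 < t \<and> t < d \<longrightarrow> y + t *\<^sub>R v \<in> U" for v
  proof -
    obtain e where e: "e > 0" "ball y e \<subseteq> U" by (rule openE[OF U(1,2)])
    have "y + t *\<^sub>R v \<in> U" if t: "0 < t" "t < e / (norm v + 1)" for t
    proof -
      have "t * norm v \<le> t * (norm v + 1)" using t by (intro mult_left_mono) auto
      also have "\<dots> < e" using t by (simp add: pos_less_divide_eq add_nonneg_pos)
      finally have "y + t *\<^sub>R v \<in> ball y e" using t by (simp add: dist_norm)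
      then show ?thesis using e by blast
    qed
    then show ?thesis using e by (intro exI[of _ "e / (norm v + 1)"]) (simp add: add_nonneg_pos)
  qed
  have normal: "z \<bullet> gy \<le> y \<bullet> gy" if z: "z \<in> L" for z
  proof (rule ccontr)
    assume "\<not> z \<bullet> gy \<le> y \<bullet> gy"
    then have "gy \<bullet> (z - y) > 0" by (simp add: inner_diff_right inner_commute)
    from DERIV_pos_inc_right[OF ray[of "z - y"] this]
    obtain d1 where d1: "d1 > 0" "\<And>h. 0 < h \<Longrightarrow> h < d1 \<Longrightarrow> 0 < G (y + h *\<^sub>R (z - y))"
      using G0 by auto
    obtain d2 where d2: "d2 > 0" "\<And>t. 0 < t \<Longrightarrow> t < d2 \<Longrightarrow> y + t *\<^sub>R (z - y) \<in> U"
      using inU by blast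
    define t where "t = min (min d1 d2) 1 / 2"
    have t: "0 < t" "t < d1" "t < d2" "t < 1" using d1 d2 by (auto simp: t_def)
    have "(1 - t) *\<^sub>R y + t *\<^sub>R z \<in> L" using t by (intro convexD[OF body_props(1) yL z]) auto
    moreover have "(1 - t) *\<^sub>R y + t *\<^sub>R z = y + t *\<^sub>R (z - y)" by (simp add: algebra_simps)
    ultimately have "G (y + t *\<^sub>R (z - y)) \<le> 0" using LU d2(2)[OF t(1,3)] by auto
    then show False using d1(2)[OF t(1,2)] by simp
  qed
  show pos: "y \<bullet> gy > 0"
  proof -
    obtain r where r: "r > 0" "cball 0 r \<subseteq> L" by (rule inner_radius)
    have "(r / norm gy) *\<^sub>R gy \<in> L" using r gy by (intro subsetD[OF r(2)]) simp
    then have "((r / norm gy) *\<^sub>R gy) \<bullet> gy \<le> y \<bullet> gy" by (rule normal)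
    moreover have "((r / norm gy) *\<^sub>R gy) \<bullet> gy = r * norm gy"
      using gy by (simp add: dot_square_norm power2_eq_square)
    moreover have "r * norm gy > 0" using r gy by simp
    ultimately show ?thesis by linarith
  qed
  show "(1 / (y \<bullet> gy)) *\<^sub>R gy \<in> polar_body L"
    using normal pos by (simp add: polar_body_def)
  fix w assume w: "w \<in> polar_body L" and yw: "y \<bullet> w = 1"
  have dir: "v \<bullet> w \<le> 0" if v: "v \<bullet> gy < 0" for v
  proof -
    have "gy \<bullet> v < 0" using v by (simp add: inner_commute)
    from DERIV_neg_dec_right[OF ray[of v] this]
    obtain d1 where d1: "d1 > 0" "\<And>h. 0 < h \<Longrightarrow> h < d1 \<Longrightarrow> G (y + h *\<^sub>R v) < 0"
      using G0 by auto
    obtain d2 where d2: "d2 > 0" "\<And>t. 0 < t \<Longrightarrow> t < d2 \<Longrightarrow> y + t *\<^sub>R v \<in> U"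
      using inU by blast
    define t where "t = min d1 d2 / 2"
    have t: "0 < t" "t < d1" "t < d2" using d1 d2 by (auto simp: t_def)
    have "y + t *\<^sub>R v \<in> L \<inter> U"
      unfolding LU using d2(2)[OF t(1,3)] d1(2)[OF t(1,2)] by simp
    then have "y + t *\<^sub>R v \<in> L" by (rule IntD1)
    then have "(y + t *\<^sub>R v) \<bullet> w \<le> 1" using w by (simp add: polar_body_def)
    then have "t * (v \<bullet> w) \<le> 0" using yw by (simp add: inner_add_left)
    then show ?thesis using t(1) by (simp add: mult_le_0_iff)
  qed
  define c where "c = (w \<bullet> gy) / (gy \<bullet> gy)"
  define p where "p = w - c *\<^sub>R gy"
  have gg: "gy \<bullet> gy > 0" using gy by simp
  have pg: "p \<bullet> gy = 0" using gg by (simp add: p_def c_def inner_diff_left)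
  have pw: "p \<bullet> w = p \<bullet> p" using pg by (simp add: p_def inner_diff_right)
  have "p = 0"
  proof (rule ccontr)
    assume "p \<noteq> 0"
    then have q: "p \<bullet> p > 0" by simp
    define k where "k = \<bar>gy \<bullet> w\<bar> + 1"
    have k: "k > 0" by (simp add: k_def)
    define e where "e = (p \<bullet> p) / (2 * k)"
    have e: "e > 0" using q k by (simp add: e_def)
    have "(p - e *\<^sub>R gy) \<bullet> gy < 0" using pg gg e by (simp add: inner_diff_left)
    then have "(p - e *\<^sub>R gy) \<bullet> w \<le> 0" by (rule dir)
    then have "p \<bullet> p \<le> e * (gy \<bullet> w)" by (simp add: inner_diff_left pw)
    also have "\<dots> \<le> e * k" using e by (intro mult_left_mono) (auto simp: k_def)
    also have "\<dots> = (p \<bullet> p) / 2" using k by (simp add: e_def)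
    finally show False using q by simp
  qed
  then have wc: "w = c *\<^sub>R gy" by (simp add: p_def)
  then have "c * (y \<bullet> gy) = 1" using yw by simp
  then have "c = 1 / (y \<bullet> gy)" using pos by (simp add: field_simps)
  then show "w = (1 / (y \<bullet> gy)) *\<^sub>R gy" using wc by simp
qed

locale C2_body = centered_body L for L :: "(real^'n) set" +
  assumes dim: "CARD('n) \<ge> 2" and C2: "C2_boundary L"
begin

definition normalised_normal :: "real^'n \<Rightarrow> real^'n" where
  "normalised_normal x = (SOME w. w \<in> polar_body L \<and> x \<bullet> w = 1)"

text \<open>The point of the polar body dual to a boundary point, extended homogeneously of degree one.\<close>

definition gradient_map :: "real^'n \<Rightarrow> real^'n" where
  "gradient_map y = body_gauge L y *\<^sub>R normalised_normal ((1 / body_gauge L y) *\<^sub>R y)"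

lemma local_chart:
  assumes x: "x \<in> frontier L"
  obtains U g H where "open U" "x \<in> U" "continuous_on U g"
    "\<And>y. y \<in> U \<Longrightarrow> (g has_derivative blinfun_apply (H y)) (at y)" "continuous_on U H"
    "\<And>y. y \<in> U \<inter> frontier L \<Longrightarrow> y \<bullet> g y > 0 \<and> (1 / (y \<bullet> g y)) *\<^sub>R g y \<in> polar_body L \<and>
       (\<forall>w. w \<in> polar_body L \<longrightarrow> y \<bullet> w = 1 \<longrightarrow> w = (1 / (y \<bullet> g y)) *\<^sub>R g y)"
proof -
  obtain U G where U: "open U" "x \<in> U" "C2_on U G" "\<not> (G has_derivative (\<lambda>v. 0)) (at x)"
      "L \<inter> U = {y\<in>U. G y \<le> 0}"
    using C2 x unfolding C2_boundary_def by blast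
  obtain g H where gH: "\<And>y. y \<in> U \<Longrightarrow> (G has_derivative (\<lambda>v. g y \<bullet> v)) (at y)"
      "\<And>y. y \<in> U \<Longrightarrow> (g has_derivative blinfun_apply (H y)) (at y)" "continuous_on U H"
    using U(3) unfolding C2_on_def by blast
  have gc: "continuous_on U g"
    using gH(2) by (intro continuous_at_imp_continuous_on) (auto intro: has_derivative_continuous)
  define U' where "U' = {y \<in> U. g y \<noteq> 0}"
  have "open U'"
  proof -
    have "U' = U \<inter> g -` (- {0})" by (auto simp: U'_def)
    then show ?thesis
      using continuous_open_preimage[OF gc U(1), of "- {0}"] by (simp add: open_Compl)
  qed
  moreover have "x \<in> U'"
  proof -
    have "g x \<noteq> 0" using U(4) gH(1)[OF U(2)] by auto
    then show ?thesis using U(2) by (simp add: U'_def)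
  qed
  moreover have "continuous_on U' g" "continuous_on U' H"
    using gc gH(3) by (auto intro: continuous_on_subset simp: U'_def)
  moreover have "(g has_derivative blinfun_apply (H y)) (at y)" if "y \<in> U'" for y
    using gH(2) that by (simp add: U'_def)
  moreover have "y \<bullet> g y > 0 \<and> (1 / (y \<bullet> g y)) *\<^sub>R g y \<in> polar_body L \<and>
       (\<forall>w. w \<in> polar_body L \<longrightarrow> y \<bullet> w = 1 \<longrightarrow> w = (1 / (y \<bullet> g y)) *\<^sub>R g y)" if y: "y \<in> U' \<inter> frontier L" for y
  proof -
    have y': "y \<in> U" "y \<in> frontier L" "g y \<noteq> 0" using y by (auto simp: U'_def)
    show ?thesis
      using defining_function_normal[OF U(1) y'(1,2) U(5) gH(1)[OF y'(1)] y'(3)] by blast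
  qed
  ultimately show ?thesis by (intro that[of U' g H])
qed

lemma normalised_normal:
  assumes x: "x \<in> frontier L"
  shows "normalised_normal x \<in> polar_body L" "x \<bullet> normalised_normal x = 1"
    "\<And>w. w \<in> polar_body L \<Longrightarrow> x \<bullet> w = 1 \<Longrightarrow> w = normalised_normal x"
proof -
  obtain U g H where U: "x \<in> U" and ch: "\<And>y. y \<in> U \<inter> frontier L \<Longrightarrow> y \<bullet> g y > 0 \<and> (1 / (y \<bullet> g y)) *\<^sub>R g y \<in> polar_body L \<and>
       (\<forall>w. w \<in> polar_body L \<longrightarrow> y \<bullet> w = 1 \<longrightarrow> w = (1 / (y \<bullet> g y)) *\<^sub>R g y)"
    by (rule local_chart[OF x]) blast
  let ?w = "(1 / (x \<bullet> g x)) *\<^sub>R g x"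
  have *: "x \<bullet> g x > 0" "?w \<in> polar_body L" and uniq: "\<And>w. w \<in> polar_body L \<Longrightarrow> x \<bullet> w = 1 \<Longrightarrow> w = ?w"
    using ch[of x] U x by blast+
  have "?w \<in> polar_body L \<and> x \<bullet> ?w = 1" using * by simp
  then have N: "normalised_normal x \<in> polar_body L \<and> x \<bullet> normalised_normal x = 1"
    unfolding normalised_normal_def by (rule someI)
  then show "normalised_normal x \<in> polar_body L" "x \<bullet> normalised_normal x = 1" by auto
  fix w assume "w \<in> polar_body L" "x \<bullet> w = 1"
  then show "w = normalised_normal x" using uniq[of w] uniq[of "normalised_normal x"] N by simp
qed

lemma gradient_map_local:
  assumes y0: "y0 \<noteq> 0"
  obtains W g H where "open W" "y0 \<in> W" "0 \<notin> W" "\<And>y. y \<in> W \<Longrightarrow> y \<bullet> g ((1 / body_gauge L y) *\<^sub>R y) > 0"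
    "\<And>y. y \<in> W \<Longrightarrow> gradient_map y =
       ((body_gauge L y)\<^sup>2 / (y \<bullet> g ((1 / body_gauge L y) *\<^sub>R y))) *\<^sub>R g ((1 / body_gauge L y) *\<^sub>R y)"
    "\<And>y. y \<in> W \<Longrightarrow> (g has_derivative blinfun_apply (H ((1 / body_gauge L y) *\<^sub>R y))) (at ((1 / body_gauge L y) *\<^sub>R y))"
    "continuous_on W (\<lambda>y. g ((1 / body_gauge L y) *\<^sub>R y))" "continuous_on W (\<lambda>y. H ((1 / body_gauge L y) *\<^sub>R y))"
proof -
  let ?p = "\<lambda>y. (1 / body_gauge L y) *\<^sub>R y"
  obtain U g H where U: "open U" "?p y0 \<in> U" "continuous_on U g"
    "\<And>y. y \<in> U \<Longrightarrow> (g has_derivative blinfun_apply (H y)) (at y)" "continuous_on U H"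
    and ch: "\<And>y. y \<in> U \<inter> frontier L \<Longrightarrow> y \<bullet> g y > 0 \<and> (1 / (y \<bullet> g y)) *\<^sub>R g y \<in> polar_body L \<and>
       (\<forall>w. w \<in> polar_body L \<longrightarrow> y \<bullet> w = 1 \<longrightarrow> w = (1 / (y \<bullet> g y)) *\<^sub>R g y)"
    by (rule local_chart[OF radial_frontier[OF y0]]) blast
  have pc: "continuous_on (- {0}) ?p"
    by (intro continuous_intros continuous_on_gauge) auto
  define W where "W = (- {0}) \<inter> ?p -` U"
  have W: "open W" unfolding W_def
    by (rule continuous_open_preimage[OF pc _ U(1)]) (simp add: open_Compl)
  have pW: "continuous_on W ?p" by (rule continuous_on_subset[OF pc]) (auto simp: W_def)
  have pU: "?p ` W \<subseteq> U" by (auto simp: W_def)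
  show ?thesis
  proof (rule that[OF W])
    show "y0 \<in> W" "0 \<notin> W" using y0 U(2) by (auto simp: W_def)
    fix y assume y: "y \<in> W"
    then have y0: "y \<noteq> 0" and py: "?p y \<in> U \<inter> frontier L"
      using radial_frontier[of y] by (auto simp: W_def)
    have g: "body_gauge L y > 0" by (rule gauge_pos[OF y0])
    have "?p y \<bullet> g (?p y) > 0" using ch[OF py] by blast
    then show pos: "y \<bullet> g (?p y) > 0" using g by (simp add: zero_less_divide_iff)
    have "normalised_normal (?p y) = (1 / (?p y \<bullet> g (?p y))) *\<^sub>R g (?p y)"
      using ch[OF py] normalised_normal(1,2)[of "?p y"] py by blast
    then show "gradient_map y = ((body_gauge L y)\<^sup>2 / (y \<bullet> g (?p y))) *\<^sub>R g (?p y)"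
      using g by (simp add: gradient_map_def power2_eq_square)
    show "(g has_derivative blinfun_apply (H (?p y))) (at (?p y))" using U(4) py by blast
  next
    show "continuous_on W (\<lambda>y. g (?p y))" by (rule continuous_on_compose2[OF U(3) pW pU])
    show "continuous_on W (\<lambda>y. H (?p y))" by (rule continuous_on_compose2[OF U(5) pW pU])
  qed
qed

lemma dual_body: "dual_body L gradient_map"
proof
  show "CARD('n) \<ge> 2" by (rule dim)
  fix y :: "real^'n" assume y: "y \<noteq> 0"
  note N = normalised_normal[OF radial_frontier[OF y]]
  have g: "body_gauge L y > 0" by (rule gauge_pos[OF y])
  show "y \<bullet> gradient_map y = (body_gauge L y)\<^sup>2"
  proof -
    have "body_gauge L y * (((1 / body_gauge L y) *\<^sub>R y) \<bullet> normalised_normal ((1 / body_gauge L y) *\<^sub>R y)) = body_gauge L y"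
      unfolding N(2) by simp
    then have "y \<bullet> normalised_normal ((1 / body_gauge L y) *\<^sub>R y) = body_gauge L y"
      using g y by (simp add: inner_scaleR_left)
    then show ?thesis by (simp add: gradient_map_def power2_eq_square)
  qed
  show "z \<bullet> gradient_map y \<le> body_gauge L z * body_gauge L y" for z
    using gauge_upper[OF N(1), of z] g
    by (simp add: gradient_map_def inner_commute mult.commute mult_right_mono)
  show "gradient_map (t *\<^sub>R y) = t *\<^sub>R gradient_map y" if t: "t > 0" for t
    using t by (simp add: gradient_map_def gauge_scale)
next
  fix x w assume x: "x \<in> frontier L" and w: "w \<in> polar_body L" "x \<bullet> w = 1"
  have "body_gauge L x = 1" using x by (simp add: frontier_eq)
  then show "w = gradient_map x"
    using normalised_normal(3)[OF x w] by (simp add: gradient_map_def)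
next
  have "isCont gradient_map y0" if y0: "y0 \<noteq> 0" for y0
  proof -
    obtain W g H where W: "open W" "y0 \<in> W" "0 \<notin> W" "\<And>y. y \<in> W \<Longrightarrow> y \<bullet> g ((1 / body_gauge L y) *\<^sub>R y) > 0"
      and eq: "\<And>y. y \<in> W \<Longrightarrow> gradient_map y =
       ((body_gauge L y)\<^sup>2 / (y \<bullet> g ((1 / body_gauge L y) *\<^sub>R y))) *\<^sub>R g ((1 / body_gauge L y) *\<^sub>R y)"
      and c: "continuous_on W (\<lambda>y. g ((1 / body_gauge L y) *\<^sub>R y))"
      by (rule gradient_map_local[OF y0]) blast
    have "continuous_on W (\<lambda>y. ((body_gauge L y)\<^sup>2 / (y \<bullet> g ((1 / body_gauge L y) *\<^sub>R y))) *\<^sub>R g ((1 / body_gauge L y) *\<^sub>R y))"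
      using W(4) by (intro continuous_intros continuous_on_gauge c) force
    then have "continuous_on W gradient_map"
      by (rule continuous_on_eq) (simp add: eq)
    then show ?thesis using W(1,2) by (simp add: continuous_on_eq_continuous_at)
  qed
  then show "continuous_on (- {0}) gradient_map"
    by (intro continuous_at_imp_continuous_on) auto
qed

sublocale dual_body L gradient_map by (rule dual_body)

definition hessian :: "real^'n \<Rightarrow> real^'n \<Rightarrow> real^'n" where
  "hessian y = frechet_derivative gradient_map (at y)"

text \<open>Near a point the gradient map is a rational expression in the gauge, in \<open>y\<close> and in the gradient \<open>g\<close> of a
  defining function at the radial projection of \<open>y\<close>. The derivative of the gauge is in turn expressed by the gradient
  map, which is continuous; so all terms of the derivative are continuous.\<close>

lemma gradient_map_C1:
  assumes y0: "y0 \<noteq> 0"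
  obtains W D where "open W" "y0 \<in> W" "0 \<notin> W" "\<And>y. y \<in> W \<Longrightarrow> (gradient_map has_derivative D y) (at y)"
    "\<And>v. continuous_on W (\<lambda>y. D y v)"
proof -
  obtain W g H where W: "open W" "y0 \<in> W" "0 \<notin> W" and pos: "\<And>y. y \<in> W \<Longrightarrow> y \<bullet> g ((1 / body_gauge L y) *\<^sub>R y) > 0"
    and eq: "\<And>y. y \<in> W \<Longrightarrow> gradient_map y =
       ((body_gauge L y)\<^sup>2 / (y \<bullet> g ((1 / body_gauge L y) *\<^sub>R y))) *\<^sub>R g ((1 / body_gauge L y) *\<^sub>R y)"
    and g: "\<And>y. y \<in> W \<Longrightarrow> (g has_derivative blinfun_apply (H ((1 / body_gauge L y) *\<^sub>R y))) (at ((1 / body_gauge L y) *\<^sub>R y))"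
    and gc: "continuous_on W (\<lambda>y. g ((1 / body_gauge L y) *\<^sub>R y))" and Hc: "continuous_on W (\<lambda>y. H ((1 / body_gauge L y) *\<^sub>R y))"
    by (rule gradient_map_local[OF y0]) blast
  define p where "p y = (1 / body_gauge L y) *\<^sub>R y" for y
  note pos = pos[folded p_def] and eq = eq[folded p_def] and g = g[folded p_def] and gc = gc[folded p_def] and Hc = Hc[folded p_def]
  define r where "r y v = (gradient_map y \<bullet> v) / body_gauge L y" for y v
  define p' where "p' y v = (1 / body_gauge L y) *\<^sub>R v + (- r y v / (body_gauge L y * body_gauge L y)) *\<^sub>R y" for y v
  define k where "k y v = blinfun_apply (H (p y)) (p' y v)" for y v
  define m where "m y = y \<bullet> g (p y)" for y
  define m' where "m' y v = y \<bullet> k y v + v \<bullet> g (p y)" for y v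
  define a where "a y = (body_gauge L y)\<^sup>2 / m y" for y
  define a' where "a' y v = (2 * body_gauge L y * r y v * m y - (body_gauge L y)\<^sup>2 * m' y v) / (m y * m y)" for y v
  define D where "D y v = a y *\<^sub>R k y v + a' y v *\<^sub>R g (p y)" for y v
  have gp: "body_gauge L y > 0" if "y \<in> W" for y using W(3) that by (intro gauge_pos) auto
  have mp: "m y > 0" if "y \<in> W" for y using pos[OF that] by (simp add: m_def)
  have der: "(gradient_map has_derivative D y) (at y)" if y: "y \<in> W" for y
  proof -
    have y0: "y \<noteq> 0" using y W(3) by auto
    have rd: "(body_gauge L has_derivative r y) (at y)"
      unfolding r_def[abs_def] by (rule has_derivative_gauge[OF y0])
    have "((\<lambda>y. 1 / body_gauge L y) has_derivative (\<lambda>v. - r y v / (body_gauge L y * body_gauge L y))) (at y)"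
      using gp[OF y] by (auto intro!: derivative_eq_intros rd)
    from has_derivative_scaleR[OF this has_derivative_ident]
    have pd: "(p has_derivative p' y) (at y)"
      unfolding p_def[abs_def] p'_def[abs_def] .
    have kd: "((\<lambda>y. g (p y)) has_derivative k y) (at y)"
      unfolding k_def[abs_def] by (rule has_derivative_compose[OF pd g[OF y]])
    have md: "(m has_derivative m' y) (at y)"
      unfolding m_def[abs_def] m'_def[abs_def] by (rule has_derivative_inner[OF has_derivative_ident kd])
    have ad: "(a has_derivative a' y) (at y)"
    proof -
      have "((\<lambda>y. (body_gauge L y)\<^sup>2) has_derivative (\<lambda>v. 2 * body_gauge L y * r y v)) (at y)"
        by (auto intro!: derivative_eq_intros rd)
      from has_derivative_divide'[OF this md] mp[OF y] show ?thesis
        unfolding a_def[abs_def] a'_def[abs_def] by simp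
    qed
    have "((\<lambda>y. a y *\<^sub>R g (p y)) has_derivative D y) (at y)"
      unfolding D_def[abs_def] by (rule has_derivative_scaleR[OF ad kd])
    then show ?thesis
      by (rule has_derivative_transform_within_open[OF _ W(1) y]) (simp add: eq a_def m_def)
  qed
  have cont: "continuous_on W (\<lambda>y. D y v)" for v
  proof -
    have gauge_c: "continuous_on W (body_gauge L)" by (rule continuous_on_gauge)
    have gn: "\<forall>y\<in>W. body_gauge L y \<noteq> 0" using gp by force
    have mn: "\<forall>y\<in>W. m y \<noteq> 0" using mp by force
    have gm: "continuous_on W gradient_map"
      by (rule continuous_on_subset[OF T_cont]) (use W(3) in auto)
    have rc: "continuous_on W (\<lambda>y. r y v)"
      unfolding r_def using gn by (intro continuous_intros gm gauge_c) auto
    have pc: "continuous_on W (\<lambda>y. p' y v)"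
      unfolding p'_def using gn by (intro continuous_intros rc gauge_c) auto
    have kc: "continuous_on W (\<lambda>y. k y v)"
      unfolding k_def by (intro continuous_intros Hc pc)
    have mc: "continuous_on W m" "continuous_on W (\<lambda>y. m' y v)"
      unfolding m_def m'_def by (intro continuous_intros gc kc)+
    have ac: "continuous_on W a" "continuous_on W (\<lambda>y. a' y v)"
      unfolding a_def a'_def using mn by (intro continuous_intros gauge_c mc rc; auto)+
    show ?thesis unfolding D_def by (intro continuous_intros ac kc gc)
  qed
  show ?thesis by (rule that[OF W der cont])
qed

lemma has_derivative_hessian: "y \<noteq> 0 \<Longrightarrow> (gradient_map has_derivative hessian y) (at y)"
  unfolding hessian_def frechet_derivative_works[symmetric]
  by (rule gradient_map_C1[of y]) (auto intro: differentiableI)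

lemma hessian_continuous: "continuous_on (- {0}) (\<lambda>y. hessian y v)"
proof (rule continuous_at_imp_continuous_on, rule ballI)
  fix y0 :: "real^'n" assume "y0 \<in> - {0}"
  then have y0: "y0 \<noteq> 0" by simp
  obtain W D where W: "open W" "y0 \<in> W" "0 \<notin> W" and D: "\<And>y. y \<in> W \<Longrightarrow> (gradient_map has_derivative D y) (at y)"
    and c: "\<And>v. continuous_on W (\<lambda>y. D y v)"
    by (rule gradient_map_C1[OF y0]) blast
  have "hessian y v = D y v" if "y \<in> W" for y
  proof -
    have "y \<noteq> 0" using that W(3) by auto
    then have "hessian y = D y" using has_derivative_unique[OF has_derivative_hessian D[OF that]] by simp
    then show ?thesis by simp
  qed
  then have "continuous_on W (\<lambda>y. hessian y v)"
    by (intro continuous_on_eq[OF c[of v]]) simp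
  then show "isCont (\<lambda>y. hessian y v) y0" using W(1,2) by (simp add: continuous_on_eq_continuous_at)
qed

sublocale smooth_dual_body L gradient_map hessian
  by unfold_locales (rule has_derivative_hessian)

lemma continuous_on_det_hessian: "continuous_on (- {0}) (\<lambda>y. det (matrix (hessian y)))"
proof -
  have "continuous_on (- {0}) (\<lambda>y. hessian y (axis j 1) $ i)" for i j
    by (intro continuous_intros hessian_continuous)
  note entry = this
  show ?thesis
    unfolding det_def matrix_def vec_lambda_beta
    by (intro continuous_on_sum continuous_on_mult continuous_on_const continuous_on_prod entry)
qed

lemma positive_body:
  assumes pos: "\<And>x. x \<in> frontier L \<Longrightarrow> gauss_curvature L x > 0"
  shows "positive_body L gradient_map hessian"
proof
  fix y :: "real^'n" assume y: "y \<noteq> 0"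
  let ?x = "(1 / body_gauge L y) *\<^sub>R y"
  have x: "?x \<in> frontier L" by (rule radial_frontier[OF y])
  have nz: "norm (gradient_map ?x) > 0" using T_nonzero[OF frontier_nonzero[OF x]] by simp
  have prod: "0 < (1 / norm (gradient_map ?x)) ^ (CARD('n) + 1) * det (matrix (hessian ?x))"
    using pos[OF x] unfolding gauss_curvature_eq[OF x] .
  have "0 < (1 / norm (gradient_map ?x)) ^ (CARD('n) + 1)" using nz by simp
  then have "det (matrix (hessian ?x)) > 0"
    by (rule zero_less_mult_pos[OF prod])
  then show "det (matrix (hessian y)) > 0"
    using DT_scale[OF y, of "1 / body_gauge L y"] gauge_pos[OF y] by simp
qed (rule continuous_on_det_hessian)

end

section \<open>Second derivatives along lines\<close>

lemma has_real_derivative_along_line: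
  assumes "(f has_derivative D) (at (x + s *\<^sub>R v))"
  shows "((\<lambda>s. f (x + s *\<^sub>R v)) has_real_derivative D v) (at s)"
proof -
  have "((\<lambda>s. x + s *\<^sub>R v) has_derivative (\<lambda>s. s *\<^sub>R v)) (at s)"
    by (auto intro!: derivative_eq_intros)
  from has_derivative_compose[OF this assms]
  have "((\<lambda>s. f (x + s *\<^sub>R v)) has_derivative (\<lambda>t. D (t *\<^sub>R v))) (at s)" .
  moreover have "D (t *\<^sub>R v) = D v * t" for t
    using has_derivative_linear[OF assms] by (simp add: linear_scale)
  ultimately show ?thesis by (simp add: has_field_derivative_def)
qed

lemma has_real_derivative_inner_along_line:
  assumes "(T has_derivative D) (at (x + s *\<^sub>R v))"
  shows "((\<lambda>s. T (x + s *\<^sub>R v) \<bullet> w) has_real_derivative D v \<bullet> w) (at s)"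
  using has_real_derivative_along_line[of "\<lambda>y. T y \<bullet> w" "\<lambda>v. D v \<bullet> w" x s v]
    has_derivative_inner_left[OF assms, of w] by simp

text \<open>Symmetry of second derivatives, by applying the mean value theorem to a second difference
  in both orders.\<close>

lemma second_derivative_symmetric:
  fixes \<phi> :: "'a::euclidean_space \<Rightarrow> real" and T :: "'a \<Rightarrow> 'a"
  assumes W: "open W" "y \<in> W"
    and \<phi>: "\<And>y. y \<in> W \<Longrightarrow> (\<phi> has_derivative (\<lambda>v. T y \<bullet> v)) (at y)"
    and T: "\<And>y. y \<in> W \<Longrightarrow> (T has_derivative D y) (at y)"
    and c: "\<And>v. continuous_on W (\<lambda>y. D y v)"
  shows "D y v \<bullet> w = D y w \<bullet> v"
proof (rule ccontr)
  assume ne: "D y v \<bullet> w \<noteq> D y w \<bullet> v"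
  define e where "e = \<bar>D y v \<bullet> w - D y w \<bullet> v\<bar> / 2"
  have e: "e > 0" using ne by (simp add: e_def)
  have close: "\<exists>d>0. \<forall>z. dist z y < d \<longrightarrow> z \<in> W \<and> dist (D z a \<bullet> b) (D y a \<bullet> b) < e" for a b
  proof -
    have "continuous_on W (\<lambda>z. D z a \<bullet> b)" by (intro continuous_intros c)
    then obtain d1 where d1: "d1 > 0" "\<And>z. z \<in> W \<Longrightarrow> dist z y < d1 \<Longrightarrow> dist (D z a \<bullet> b) (D y a \<bullet> b) < e"
      using continuous_on_iff[THEN iffD1, rule_format, OF _ W(2) e] by blast
    obtain d2 where d2: "d2 > 0" "ball y d2 \<subseteq> W" by (rule openE[OF W])
    show ?thesis
    proof (intro exI[of _ "min d1 d2"] conjI allI impI)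
      show "min d1 d2 > 0" using d1 d2 by simp
      fix z assume "dist z y < min d1 d2"
      then have "z \<in> W" "dist z y < d1" using d2 by (auto simp: dist_commute)
      then show "z \<in> W" "dist (D z a \<bullet> b) (D y a \<bullet> b) < e" using d1 by auto
    qed
  qed
  obtain d1 where d1: "d1 > 0" "\<And>z. dist z y < d1 \<Longrightarrow> z \<in> W \<and> dist (D z v \<bullet> w) (D y v \<bullet> w) < e" using close by blast
  obtain d2 where d2: "d2 > 0" "\<And>z. dist z y < d2 \<Longrightarrow> z \<in> W \<and> dist (D z w \<bullet> v) (D y w \<bullet> v) < e" using close by blast
  define t where "t = min d1 d2 / (2 * (norm v + norm w + 1))"
  have t: "t > 0" using d1 d2 by (simp add: t_def add_nonneg_pos)
  have near: "dist (y + \<sigma> *\<^sub>R a + \<tau> *\<^sub>R b) y < min d1 d2"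
    if "0 \<le> \<sigma>" "\<sigma> \<le> t" "0 \<le> \<tau>" "\<tau> \<le> t" "{a, b} = {v, w}" for \<sigma> \<tau> a b
  proof -
    have "norm (\<sigma> *\<^sub>R a + \<tau> *\<^sub>R b) \<le> \<sigma> * norm a + \<tau> * norm b"
      using that norm_triangle_ineq[of "\<sigma> *\<^sub>R a" "\<tau> *\<^sub>R b"] by simp
    also have "\<dots> \<le> t * norm a + t * norm b" using that by (intro add_mono mult_right_mono) auto
    also have "\<dots> = t * (norm v + norm w)" using that(5) by (auto simp: doubleton_eq_iff algebra_simps)
    also have "\<dots> < t * (2 * (norm v + norm w + 1))"
    proof (rule mult_strict_left_mono[OF _ t])
      have "0 \<le> norm v + norm w" by simp
      then show "norm v + norm w < 2 * (norm v + norm w + 1)" unfolding distrib_left by linarith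
    qed
    also have "\<dots> = min d1 d2"
    proof -
      have "2 * (norm v + norm w + 1) \<noteq> 0"
        using add_nonneg_pos[of "norm v + norm w" 1] by simp
      then show ?thesis unfolding t_def by (rule nonzero_eq_divide_eq[THEN iffD1]) simp
    qed
    finally show ?thesis by (simp add: dist_norm add.assoc)
  qed
  have mixed: "\<exists>z. dist z y < min d1 d2 \<and>
      \<phi> (y + t *\<^sub>R a + t *\<^sub>R b) - \<phi> (y + t *\<^sub>R a) - (\<phi> (y + t *\<^sub>R b) - \<phi> y) = t * t * (D z b \<bullet> a)"
    if ab: "{a, b} = {v, w}" for a b
  proof -
    have inW: "y + \<sigma> *\<^sub>R a + \<tau> *\<^sub>R b \<in> W" if "0 \<le> \<sigma>" "\<sigma> \<le> t" "0 \<le> \<tau>" "\<tau> \<le> t" for \<sigma> \<tau>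
      using near[OF that ab] d1(2) by simp
    let ?f = "\<lambda>s. \<phi> ((y + t *\<^sub>R b) + s *\<^sub>R a) - \<phi> (y + s *\<^sub>R a)"
    have "\<exists>\<sigma>>0. \<sigma> < t \<and> ?f t - ?f 0 = (t - 0) * (T ((y + t *\<^sub>R b) + \<sigma> *\<^sub>R a) \<bullet> a - T (y + \<sigma> *\<^sub>R a) \<bullet> a)"
    proof (rule MVT2[OF t])
      fix s assume s: "0 \<le> s" "s \<le> t"
      have "(y + t *\<^sub>R b) + s *\<^sub>R a \<in> W" "y + s *\<^sub>R a \<in> W"
        using inW[of s t] inW[of s 0] s t by (simp_all add: add_ac)
      then show "(?f has_real_derivative T ((y + t *\<^sub>R b) + s *\<^sub>R a) \<bullet> a - T (y + s *\<^sub>R a) \<bullet> a) (at s)"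
        by (intro DERIV_diff has_real_derivative_along_line \<phi>)
    qed
    then obtain \<sigma> where \<sigma>: "0 < \<sigma>" "\<sigma> < t"
      "?f t - ?f 0 = t * (T ((y + t *\<^sub>R b) + \<sigma> *\<^sub>R a) \<bullet> a - T (y + \<sigma> *\<^sub>R a) \<bullet> a)" by auto
    let ?g = "\<lambda>r. T ((y + \<sigma> *\<^sub>R a) + r *\<^sub>R b) \<bullet> a"
    have "\<exists>\<tau>>0. \<tau> < t \<and> ?g t - ?g 0 = (t - 0) * (D ((y + \<sigma> *\<^sub>R a) + \<tau> *\<^sub>R b) b \<bullet> a)"
    proof (rule MVT2[OF t])
      fix r assume "0 \<le> r" "r \<le> t"
      then have "(y + \<sigma> *\<^sub>R a) + r *\<^sub>R b \<in> W" using inW[of \<sigma> r] \<sigma> by simp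
      then show "(?g has_real_derivative D ((y + \<sigma> *\<^sub>R a) + r *\<^sub>R b) b \<bullet> a) (at r)"
        by (intro has_real_derivative_inner_along_line T)
    qed
    then obtain \<tau> where \<tau>: "0 < \<tau>" "\<tau> < t" "?g t - ?g 0 = t * (D ((y + \<sigma> *\<^sub>R a) + \<tau> *\<^sub>R b) b \<bullet> a)" by auto
    have "?f t - ?f 0 = t * (?g t - ?g 0)" using \<sigma>(3) by (simp add: add_ac)
    then have "?f t - ?f 0 = t * t * (D ((y + \<sigma> *\<^sub>R a) + \<tau> *\<^sub>R b) b \<bullet> a)" using \<tau>(3) by simp
    moreover have "dist ((y + \<sigma> *\<^sub>R a) + \<tau> *\<^sub>R b) y < min d1 d2"
      using near[of \<sigma> \<tau> a b] \<sigma> \<tau> ab by simp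
    ultimately show ?thesis by (intro exI[of _ "(y + \<sigma> *\<^sub>R a) + \<tau> *\<^sub>R b"]) (simp add: add_ac)
  qed
  obtain z1 where z1: "dist z1 y < min d1 d2"
    "\<phi> (y + t *\<^sub>R v + t *\<^sub>R w) - \<phi> (y + t *\<^sub>R v) - (\<phi> (y + t *\<^sub>R w) - \<phi> y) = t * t * (D z1 w \<bullet> v)"
    using mixed[of v w] by auto
  obtain z2 where z2: "dist z2 y < min d1 d2"
    "\<phi> (y + t *\<^sub>R w + t *\<^sub>R v) - \<phi> (y + t *\<^sub>R w) - (\<phi> (y + t *\<^sub>R v) - \<phi> y) = t * t * (D z2 v \<bullet> w)"
    using mixed[of w v] by auto
  have "t * t * (D z1 w \<bullet> v) = t * t * (D z2 v \<bullet> w)"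
  proof -
    have swap: "y + t *\<^sub>R w + t *\<^sub>R v = y + t *\<^sub>R v + t *\<^sub>R w" by (simp add: add_ac)
    show ?thesis using z1(2) z2(2)[unfolded swap] by linarith
  qed
  then have "D z1 w \<bullet> v = D z2 v \<bullet> w" using t by simp
  moreover have "dist (D z1 w \<bullet> v) (D y w \<bullet> v) < e" using d2(2)[of z1] z1(1) by simp
  moreover have "dist (D z2 v \<bullet> w) (D y v \<bullet> w) < e" using d1(2)[of z2] z2(1) by simp
  moreover have "\<bar>D y v \<bullet> w - D y w \<bullet> v\<bar> \<le> \<bar>D z2 v \<bullet> w - D y w \<bullet> v\<bar> + \<bar>D z2 v \<bullet> w - D y v \<bullet> w\<bar>"
    using abs_triangle_ineq4[of "D z2 v \<bullet> w - D y w \<bullet> v" "D z2 v \<bullet> w - D y v \<bullet> w"] by simp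
  ultimately show False unfolding e_def dist_real_def by simp
qed

lemma second_derivative_nonpos_at_max:
  fixes f :: "real \<Rightarrow> real"
  assumes d: "d > 0" and f: "\<And>s. \<bar>s\<bar> < d \<Longrightarrow> (f has_real_derivative f' s) (at s)"
    and f': "(f' has_real_derivative l) (at 0)" and max: "\<And>s. \<bar>s\<bar> < d \<Longrightarrow> f s \<le> f 0"
  shows "l \<le> 0"
proof (rule ccontr)
  assume "\<not> l \<le> 0"
  then have l: "l > 0" by simp
  have f0: "f' 0 = 0"
    by (rule DERIV_local_max[OF f[of 0] d]) (use d max in auto)
  obtain d' where d': "d' > 0" "\<And>h. 0 < h \<Longrightarrow> h < d' \<Longrightarrow> f' 0 < f' (0 + h)"
    using DERIV_pos_inc_right[OF f' l] by auto
  define h where "h = min d d' / 2"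
  have h: "0 < h" "h < d" "h < d'" using d d' by (auto simp: h_def)
  have "\<exists>z>0. z < h \<and> f h - f 0 = (h - 0) * f' z"
    by (rule MVT2[OF h(1)]) (use f h in auto)
  then obtain z where z: "0 < z" "z < h" "f h - f 0 = h * f' z" by auto
  have "f' z > 0" using d'(2)[of z] z h f0 by simp
  then have "f h > f 0" using z h by (smt (verit) mult_pos_pos)
  then show False using max[of h] h by simp
qed

text \<open>The restriction to lines of the barrier \<open>exp (- \<alpha> |x - q|\<^sup>2)\<close> in Hopf's argument.\<close>

lemma gaussian_line_derivatives:
  fixes z q u :: "'a::real_inner"
  defines "w \<equiv> z - q"
  shows "((\<lambda>s. exp (- \<alpha> * (norm (z + s *\<^sub>R u - q))\<^sup>2)) has_real_derivative
      exp (- \<alpha> * (norm (z + s *\<^sub>R u - q))\<^sup>2) * (- \<alpha> * (2 * (w \<bullet> u) + 2 * s * (u \<bullet> u)))) (at s)" (is ?A)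
    and "((\<lambda>s. exp (- \<alpha> * (norm (z + s *\<^sub>R u - q))\<^sup>2) * (- \<alpha> * (2 * (w \<bullet> u) + 2 * s * (u \<bullet> u)))) has_real_derivative
      exp (- \<alpha> * (norm w)\<^sup>2) * (4 * \<alpha>\<^sup>2 * (w \<bullet> u)\<^sup>2 - 2 * \<alpha> * (u \<bullet> u))) (at 0)" (is ?B)
proof -
  have Q: "(norm (z + s *\<^sub>R u - q))\<^sup>2 = w \<bullet> w + 2 * s * (w \<bullet> u) + s\<^sup>2 * (u \<bullet> u)" for s
  proof -
    have "z + s *\<^sub>R u - q = w + s *\<^sub>R u" by (simp add: w_def)
    then show ?thesis
      by (simp add: power2_norm_eq_inner inner_add_left inner_add_right inner_commute algebra_simps)
         (simp add: power2_eq_square)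
  qed
  show ?A unfolding Q
    by (auto intro!: derivative_eq_intros simp: algebra_simps power2_eq_square)
  have nw: "(norm w)\<^sup>2 = w \<bullet> w" by (rule power2_norm_eq_inner)
  show ?B unfolding Q nw
    by (auto intro!: derivative_eq_intros simp: algebra_simps power2_eq_square)
qed

section \<open>Bodies of constant centro-affine curvature\<close>

lemma inner_congruence:
  fixes E B :: "real^'n^'n"
  shows "x \<bullet> ((transpose E ** B ** E) *v x) = (E *v x) \<bullet> (B *v (E *v x))"
  by (metis dot_lmul_matrix matrix_vector_mul_assoc transpose_matrix_vector transpose_transpose)

lemma trace_congruence:
  fixes E B :: "real^'n^'n"
  shows "matrix_trace (transpose E ** B ** E) = (\<Sum>i\<in>UNIV. (E *v axis i 1) \<bullet> (B *v (E *v axis i 1)))"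
  unfolding inner_congruence[symmetric] matrix_trace_def
  by (simp add: inner_axis' matrix_vector_mult_basis column_def)

text \<open>If the curvature is constant, the equation \<open>det (DT y) = c\<close> is the equation \<open>det D\<^sup>2 \<phi> = c\<close>
  for \<open>\<phi> = gauge\<^sup>2 / 2\<close>.\<close>

locale constant_curvature_body = positive_body L T DT for L :: "(real^'n) set" and T DT +
  fixes c :: real
  assumes DT_cont: "\<And>v. continuous_on (- {0}) (\<lambda>y. DT y v)"
    and const: "\<And>y. y \<noteq> 0 \<Longrightarrow> det (matrix (DT y)) = c"
begin

definition potential :: "real^'n \<Rightarrow> real" where
  "potential y = (body_gauge L y)\<^sup>2 / 2"

lemma has_derivative_potential: "y \<noteq> 0 \<Longrightarrow> (potential has_derivative (\<lambda>v. T y \<bullet> v)) (at y)"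
proof -
  assume y: "y \<noteq> 0"
  have "(potential has_derivative (\<lambda>v. body_gauge L y * ((T y \<bullet> v) / body_gauge L y))) (at y)"
    unfolding potential_def[abs_def]
    by (auto intro!: derivative_eq_intros has_derivative_gauge[OF y])
  then show ?thesis using y by simp
qed

lemma DT_symmetric: "y \<noteq> 0 \<Longrightarrow> DT y v \<bullet> w = DT y w \<bullet> v"
  by (rule second_derivative_symmetric[of "- {0}" y potential T DT])
     (auto simp: open_Compl intro: has_derivative_potential T_deriv DT_cont)

text \<open>The gradient of the convex function \<open>potential\<close> is monotone; duality gives this directly.\<close>

lemma T_monotone:
  assumes "y \<noteq> 0" "z \<noteq> 0"
  shows "0 \<le> (T z - T y) \<bullet> (z - y)"
proof -
  have "z \<bullet> T y \<le> body_gauge L z * body_gauge L y" "y \<bullet> T z \<le> body_gauge L y * body_gauge L z"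
    using T_le assms by auto
  moreover have "2 * (body_gauge L z * body_gauge L y) \<le> (body_gauge L z)\<^sup>2 + (body_gauge L y)\<^sup>2"
    using sum_squares_bound[of "body_gauge L z" "body_gauge L y"] by simp
  ultimately have "z \<bullet> T y + y \<bullet> T z \<le> z \<bullet> T z + y \<bullet> T y"
    using T_inner assms by (simp add: mult.commute)
  then show ?thesis by (simp add: inner_diff_left inner_diff_right inner_commute)
qed

lemma DT_nonneg:
  assumes y: "y \<noteq> 0"
  shows "0 \<le> DT y v \<bullet> v"
proof (rule ccontr)
  assume "\<not> 0 \<le> DT y v \<bullet> v"
  then have neg: "DT y v \<bullet> v < 0" by simp
  have "((\<lambda>s. T (y + s *\<^sub>R v) \<bullet> v) has_real_derivative DT y v \<bullet> v) (at 0)"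
    by (rule has_real_derivative_inner_along_line) (use T_deriv[OF y] in simp)
  from DERIV_neg_dec_right[OF this neg] obtain d where
    d: "d > 0" "\<And>h. 0 < h \<Longrightarrow> h < d \<Longrightarrow> T (y + h *\<^sub>R v) \<bullet> v < T y \<bullet> v" by auto
  have v: "v \<noteq> 0" using neg linear_0[OF linear_DT[OF y]] by auto
  define m where "m = norm y / norm v"
  have m: "m > 0" using v y by (simp add: m_def)
  define h where "h = min d m / 2"
  have "0 < h" "h < d" "h < m" using d(1) m by (auto simp: h_def)
  then have h: "0 < h" "h < d" "h < norm y / norm v" by (simp_all add: m_def)
  have "norm (h *\<^sub>R v) < norm y" using h v by (simp add: pos_less_divide_eq)
  then have nz: "y + h *\<^sub>R v \<noteq> 0" by (metis add_eq_0_iff less_irrefl norm_minus_cancel)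
  have "0 \<le> h * ((T (y + h *\<^sub>R v) - T y) \<bullet> v)"
    using T_monotone[OF y nz] by simp
  then have "T y \<bullet> v \<le> T (y + h *\<^sub>R v) \<bullet> v"
    using h(1) by (simp add: zero_le_mult_iff inner_diff_left)
  then show False using d(2)[OF h(1,2)] by simp
qed

lemma matrix_DT:
  assumes y: "y \<noteq> 0"
  shows "matrix (DT y) *v v = DT y v" "transpose (matrix (DT y)) = matrix (DT y)" "0 \<le> v \<bullet> (matrix (DT y) *v v)"
proof -
  show 1: "matrix (DT y) *v v = DT y v" for v
    using fun_cong[OF matrix_vector_mul(2)[OF linear_DT[OF y]], of v] by simp
  show "transpose (matrix (DT y)) = matrix (DT y)"
    using DT_symmetric[OF y] by (simp add: transpose_def matrix_def vec_eq_iff) (metis inner_axis inner_commute mult.right_neutral real_inner_1_right inner_real_def)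
  show "0 \<le> v \<bullet> (matrix (DT y) *v v)"
    using DT_nonneg[OF y, of v] by (simp add: 1 inner_commute)
qed

text \<open>In a frame orthonormal for \<open>DT z\<close> the trace is the operator linearised at \<open>z\<close>. Among all
  \<open>DT y\<close>, which have the same determinant, it is least for \<open>DT z\<close> itself.\<close>

lemma orthonormal_frame:
  assumes z: "z \<noteq> 0"
  obtains u :: "'n \<Rightarrow> real^'n" where "\<And>i. DT z (u i) \<bullet> u i = 1"
    "\<And>y. y \<noteq> 0 \<Longrightarrow> real CARD('n) \<le> (\<Sum>i\<in>UNIV. DT y (u i) \<bullet> u i)"
    "\<And>w. DT z (\<Sum>i\<in>UNIV. (w \<bullet> u i) *\<^sub>R u i) = w"
proof -
  let ?A = "\<lambda>y. matrix (DT y)"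
  obtain E :: "real^'n^'n" where E: "transpose E ** ?A z ** E = mat 1"
    by (rule posdef_congruent_identity[OF matrix_DT(2,3)[OF z] less_imp_neq[OF det_pos[OF z], symmetric]])
  define u where "u i = E *v axis i 1" for i
  have form: "axis i 1 \<bullet> ((transpose E ** ?A y ** E) *v axis i 1) = DT y (u i) \<bullet> u i" if "y \<noteq> 0" for y i
    unfolding inner_congruence by (simp add: u_def[symmetric] matrix_DT(1)[OF that] inner_commute)
  show ?thesis
  proof (rule that[of u])
    show "DT z (u i) \<bullet> u i = 1" for i
      using form[OF z, of i] unfolding E by (simp add: inner_axis')
    fix y :: "real^'n" assume y: "y \<noteq> 0"
    have "real CARD('n) \<le> matrix_trace (transpose E ** ?A y ** E)"
      by (rule card_le_relative_trace[OF E matrix_DT(2,3)[OF y]]) (simp add: const y z)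
    then show "real CARD('n) \<le> (\<Sum>i\<in>UNIV. DT y (u i) \<bullet> u i)"
      by (simp add: trace_congruence u_def[symmetric] matrix_DT(1)[OF y] inner_commute)
  next
    fix w
    have sum: "(\<Sum>i\<in>UNIV. (w \<bullet> u i) *\<^sub>R u i) = E *v (transpose E *v w)"
    proof -
      have "w \<bullet> u i = (transpose E *v w) $ i" for i
        unfolding u_def matrix_vector_mult_basis
        by (simp add: column_def inner_vec_def matrix_vector_mult_def transpose_def mult.commute)
      then have "(\<Sum>i\<in>UNIV. (w \<bullet> u i) *\<^sub>R u i) = (\<Sum>i\<in>UNIV. E *v ((transpose E *v w) $ i *\<^sub>R axis i 1))"
        by (simp only: u_def matrix_vector_mult_scaleR)
      also have "\<dots> = E *v (\<Sum>i\<in>UNIV. (transpose E *v w) $ i *\<^sub>R axis i 1)"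
        by (rule linear_sum[OF matrix_vector_mul_linear, symmetric])
      also have "(\<Sum>i\<in>UNIV. (transpose E *v w) $ i *\<^sub>R axis i (1::real)) = transpose E *v w"
        using basis_expansion[of "transpose E *v w"] by (simp only: scalar_mult_eq_scaleR)
      finally show ?thesis .
    qed
    have "E ** (transpose E ** ?A z) = mat 1"
      using E by (simp only: matrix_left_right_inverse[of E])
    then have "(E ** transpose E) ** ?A z = mat 1" by (simp only: matrix_mul_assoc)
    then have "?A z ** (E ** transpose E) = mat 1" by (simp only: matrix_left_right_inverse)
    then have "?A z *v (E *v (transpose E *v w)) = w"
      by (simp only: matrix_vector_mul_assoc matrix_mul_assoc matrix_vector_mul_lid)
    then show "DT z (\<Sum>i\<in>UNIV. (w \<bullet> u i) *\<^sub>R u i) = w"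
      by (simp only: sum matrix_DT(1)[OF z])
  qed
qed

lemma DT_pos:
  assumes z: "z \<noteq> 0" and x: "x \<noteq> 0"
  shows "0 < DT z x \<bullet> x"
proof (rule ccontr)
  assume "\<not> 0 < DT z x \<bullet> x"
  then have 0: "DT z x \<bullet> x = 0" using DT_nonneg[OF z, of x] by simp
  \<comment> \<open>A null vector of a nonnegative form is in the kernel: test against the perturbation by \<open>DT z x\<close>.\<close>
  have quad: "0 \<le> 2 * s * (DT z x \<bullet> w) + s\<^sup>2 * (DT z w \<bullet> w)" for s w
    using DT_nonneg[OF z, of "x + s *\<^sub>R w"] DT_symmetric[OF z, of w x] 0
    by (simp add: linear_add[OF linear_DT[OF z]] linear_scale[OF linear_DT[OF z]] inner_add_left inner_add_right power2_eq_square algebra_simps)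
  define w where "w = DT z x"
  define B where "B = DT z w \<bullet> w + 1"
  have B: "B > 0" using DT_nonneg[OF z, of w] by (simp add: B_def)
  have w: "w \<noteq> 0"
    using inj_DT[OF z] x linear_0[OF linear_DT[OF z]] unfolding w_def by (metis injD)
  define s where "s = - (w \<bullet> w) / B"
  have "0 \<le> 2 * s * (w \<bullet> w) + s\<^sup>2 * (DT z w \<bullet> w)" using quad[of s w] by (simp add: w_def)
  also have "\<dots> \<le> 2 * s * (w \<bullet> w) + s\<^sup>2 * B" by (intro add_left_mono mult_left_mono) (auto simp: B_def)
  also have "\<dots> = - (w \<bullet> w)\<^sup>2 / B" using B by (simp add: s_def power2_eq_square field_simps)
  finally have "(w \<bullet> w)\<^sup>2 / B \<le> 0" by simp
  moreover have "(w \<bullet> w)\<^sup>2 / B > 0" using w B by simp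
  ultimately show False by simp
qed

lemma uniform_ellipticity:
  assumes N: "compact N" "0 \<notin> N"
  obtains l b where "l > 0" "b > 0" "\<And>z x. z \<in> N \<Longrightarrow> l * (x \<bullet> x) \<le> DT z x \<bullet> x"
    "\<And>z x. z \<in> N \<Longrightarrow> norm (DT z x) \<le> b * norm x"
proof -
  let ?S = "sphere (0 :: real^'n) 1"
  have exp: "DT z x = (\<Sum>i\<in>UNIV. (x $ i) *\<^sub>R DT z (axis i 1))" if "z \<noteq> 0" for z x
  proof -
    have "x = (\<Sum>i\<in>UNIV. x $ i *\<^sub>R axis i 1)" using basis_expansion[of x] by (simp only: scalar_mult_eq_scaleR)
    then have "DT z x = DT z (\<Sum>i\<in>UNIV. x $ i *\<^sub>R axis i 1)" by simp
    then show ?thesis by (simp add: linear_sum[OF linear_DT[OF that]] linear_scale[OF linear_DT[OF that]])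
  qed
  have "continuous_on (N \<times> ?S) (\<lambda>p. \<Sum>i\<in>UNIV. (snd p $ i) *\<^sub>R DT (fst p) (axis i 1))"
  proof (intro continuous_on_sum continuous_on_scaleR)
    fix i
    show "continuous_on (N \<times> ?S) (\<lambda>p. snd p $ i)" by (intro continuous_intros)
    show "continuous_on (N \<times> ?S) (\<lambda>p. DT (fst p) (axis i 1))"
      by (rule continuous_on_compose2[OF DT_cont continuous_on_fst[OF continuous_on_id]]) (use N(2) in auto)
  qed
  then have c: "continuous_on (N \<times> ?S) (\<lambda>p. DT (fst p) (snd p))"
  proof (rule continuous_on_eq)
    fix p assume "p \<in> N \<times> ?S"
    then have "fst p \<noteq> 0" using N(2) by auto
    then show "(\<Sum>i\<in>UNIV. (snd p $ i) *\<^sub>R DT (fst p) (axis i 1)) = DT (fst p) (snd p)"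
      by (rule exp[symmetric])
  qed
  have comp: "compact (N \<times> ?S)" using N(1) by (intro compact_Times) auto
  have c1: "continuous_on (N \<times> ?S) (\<lambda>p. DT (fst p) (snd p) \<bullet> snd p)"
    by (intro continuous_intros c)
  show ?thesis
  proof (cases "N \<times> ?S = {}")
    case True
    then have "N = {}" by (simp add: sphere_eq_empty)
    then show ?thesis using that[of 1 1] by simp
  next
    case False
    obtain p where p: "p \<in> N \<times> ?S" "\<And>p'. p' \<in> N \<times> ?S \<Longrightarrow> DT (fst p) (snd p) \<bullet> snd p \<le> DT (fst p') (snd p') \<bullet> snd p'"
      using continuous_attains_inf[OF comp False c1] by blast
    define l where "l = DT (fst p) (snd p) \<bullet> snd p"
    have l: "l > 0"
      unfolding l_def using p(1) N(2) by (intro DT_pos) auto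
    obtain b where b: "b > 0" "\<And>p'. p' \<in> N \<times> ?S \<Longrightarrow> norm (DT (fst p') (snd p')) \<le> b"
      using compact_imp_bounded[OF compact_continuous_image[OF c comp]] unfolding bounded_pos by auto
    have unit: "(1 / norm x) *\<^sub>R x \<in> ?S" "DT z ((1 / norm x) *\<^sub>R x) = (1 / norm x) *\<^sub>R DT z x" if "x \<noteq> 0" "z \<in> N" for x z
    proof -
      have "z \<noteq> 0" using that N(2) by auto
      then show "(1 / norm x) *\<^sub>R x \<in> ?S" "DT z ((1 / norm x) *\<^sub>R x) = (1 / norm x) *\<^sub>R DT z x"
        using that(1) linear_scale[OF linear_DT] by auto
    qed
    show ?thesis
    proof (rule that[OF l b(1)])
      fix z x assume z: "z \<in> N"
      then have z0: "z \<noteq> 0" using N(2) by auto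
      show "l * (x \<bullet> x) \<le> DT z x \<bullet> x"
      proof (cases "x = 0")
        case False
        have "l \<le> DT z ((1 / norm x) *\<^sub>R x) \<bullet> ((1 / norm x) *\<^sub>R x)"
          using p(2)[of "(z, (1 / norm x) *\<^sub>R x)"] unit(1)[OF False z] z by (simp add: l_def)
        also have "\<dots> = (DT z x \<bullet> x) / (x \<bullet> x)"
          unfolding unit(2)[OF False z] by (simp add: dot_square_norm power2_eq_square)
        finally show ?thesis using False by (simp add: pos_le_divide_eq)
      qed simp
      show "norm (DT z x) \<le> b * norm x"
      proof (cases "x = 0")
        case False
        have "norm (DT z ((1 / norm x) *\<^sub>R x)) \<le> b"
          using b(2)[of "(z, (1 / norm x) *\<^sub>R x)"] unit(1)[OF False z] z by simp
        then have "norm (DT z x) / norm x \<le> b" unfolding unit(2)[OF False z] by simp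
        then show ?thesis using False by (simp add: pos_divide_le_eq)
      qed (simp add: linear_0[OF linear_DT[OF z0]])
    qed
  qed
qed

text \<open>A second difference of the potential is a subsolution of the linearised operator, for which the
  Gaussian barrier is a strict subsolution away from its centre; so their sum has no interior maximum.\<close>

lemma no_interior_maximum:
  assumes d: "d > 0" and nz: "\<And>y. dist y z < d \<Longrightarrow> y \<noteq> 0 \<and> y + t *\<^sub>R e \<noteq> 0 \<and> y - t *\<^sub>R e \<noteq> 0"
    and t: "t > 0" and \<epsilon>: "\<epsilon> > 0" and \<alpha>: "\<alpha> > 0" and l: "l > 0" "b > 0"
    and ell: "\<And>x. l * (x \<bullet> x) \<le> DT z x \<bullet> x" "\<And>x. norm (DT z x) \<le> b * norm x"
    and large: "real CARD('n) * b\<^sup>2 < 2 * \<alpha> * l\<^sup>2 * (norm (z - q))\<^sup>2"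
    and max: "\<And>y. dist y z < d \<Longrightarrow>
       (potential (y + t *\<^sub>R e) + potential (y - t *\<^sub>R e) - 2 * potential y) / t\<^sup>2 + \<epsilon> * (exp (- \<alpha> * (norm (y - q))\<^sup>2) - k)
       \<le> (potential (z + t *\<^sub>R e) + potential (z - t *\<^sub>R e) - 2 * potential z) / t\<^sup>2 + \<epsilon> * (exp (- \<alpha> * (norm (z - q))\<^sup>2) - k)"
  shows False
proof -
  let ?n = "real CARD('n)"
  define w where "w = z - q"
  have z: "z \<noteq> 0" "z + t *\<^sub>R e \<noteq> 0" "z - t *\<^sub>R e \<noteq> 0" using nz[of z] d by auto
  obtain u :: "'n \<Rightarrow> real^'n" where u: "\<And>i. DT z (u i) \<bullet> u i = 1"
    "\<And>y. y \<noteq> 0 \<Longrightarrow> ?n \<le> (\<Sum>i\<in>UNIV. DT y (u i) \<bullet> u i)"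
    "\<And>w. DT z (\<Sum>i\<in>UNIV. (w \<bullet> u i) *\<^sub>R u i) = w"
    by (rule orthonormal_frame[OF z(1)]) blast
  \<comment> \<open>The second derivative, in direction \<open>u i\<close>, of the function that is maximal at \<open>z\<close>.\<close>
  define hess where "hess i = (DT (z + t *\<^sub>R e) (u i) \<bullet> u i + DT (z - t *\<^sub>R e) (u i) \<bullet> u i - 2 * (DT z (u i) \<bullet> u i)) / t\<^sup>2
     + \<epsilon> * (exp (- \<alpha> * (norm w)\<^sup>2) * (4 * \<alpha>\<^sup>2 * (w \<bullet> u i)\<^sup>2 - 2 * \<alpha> * (u i \<bullet> u i)))" for i
  have nonpos: "hess i \<le> 0" for i
  proof -
    let ?u = "u i"
    define d' where "d' = d / (norm ?u + 1)"
    have d': "d' > 0" using d by (simp add: d'_def add_nonneg_pos)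
    have near: "dist (z + s *\<^sub>R ?u) z < d" if "\<bar>s\<bar> < d'" for s
    proof -
      have "\<bar>s\<bar> * norm ?u \<le> \<bar>s\<bar> * (norm ?u + 1)" by (intro mult_left_mono) auto
      also have "\<dots> < d" using that by (simp add: d'_def pos_less_divide_eq add_nonneg_pos)
      finally show ?thesis by (simp add: dist_norm)
    qed
    let ?f = "\<lambda>s. (potential ((z + t *\<^sub>R e) + s *\<^sub>R ?u) + potential ((z - t *\<^sub>R e) + s *\<^sub>R ?u) - 2 * potential (z + s *\<^sub>R ?u)) / t\<^sup>2
       + \<epsilon> * (exp (- \<alpha> * (norm (z + s *\<^sub>R ?u - q))\<^sup>2) - k)"
    let ?f' = "\<lambda>s. (T ((z + t *\<^sub>R e) + s *\<^sub>R ?u) \<bullet> ?u + T ((z - t *\<^sub>R e) + s *\<^sub>R ?u) \<bullet> ?u - 2 * (T (z + s *\<^sub>R ?u) \<bullet> ?u)) / t\<^sup>2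
       + \<epsilon> * (exp (- \<alpha> * (norm (z + s *\<^sub>R ?u - q))\<^sup>2) * (- \<alpha> * (2 * (w \<bullet> ?u) + 2 * s * (?u \<bullet> ?u))) - 0)"
    have nz': "z + s *\<^sub>R ?u \<noteq> 0" "(z + t *\<^sub>R e) + s *\<^sub>R ?u \<noteq> 0" "(z - t *\<^sub>R e) + s *\<^sub>R ?u \<noteq> 0" if "\<bar>s\<bar> < d'" for s
      using nz[OF near[OF that]] by (auto simp: algebra_simps)
    show "hess i \<le> 0"
    proof (rule second_derivative_nonpos_at_max[OF d'])
      fix s :: real assume s: "\<bar>s\<bar> < d'"
      show "(?f has_real_derivative ?f' s) (at s)"
        unfolding w_def
        by (intro DERIV_add DERIV_cdivide DERIV_diff DERIV_cmult DERIV_const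
            has_real_derivative_along_line[of potential] has_derivative_potential gaussian_line_derivatives(1) nz'[OF s])
      show "?f s \<le> ?f 0"
        using max[OF near[OF s]] by (simp add: algebra_simps)
    next
      have T0: "((\<lambda>s. T (y + s *\<^sub>R ?u) \<bullet> ?u) has_real_derivative DT y ?u \<bullet> ?u) (at 0)" if "y \<noteq> 0" for y
        by (rule has_real_derivative_inner_along_line) (use T_deriv[OF that] in simp)
      have "(?f' has_real_derivative (DT (z + t *\<^sub>R e) ?u \<bullet> ?u + DT (z - t *\<^sub>R e) ?u \<bullet> ?u - 2 * (DT z ?u \<bullet> ?u)) / t\<^sup>2
          + \<epsilon> * (exp (- \<alpha> * (norm w)\<^sup>2) * (4 * \<alpha>\<^sup>2 * (w \<bullet> ?u)\<^sup>2 - 2 * \<alpha> * (?u \<bullet> ?u)) - 0)) (at 0)"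
        unfolding w_def
        by (intro DERIV_add DERIV_cdivide DERIV_diff DERIV_cmult DERIV_const T0 gaussian_line_derivatives(2) z)
      then show "(?f' has_real_derivative hess i) (at 0)" by (simp add: hess_def)
    qed
  qed
  have "0 < (\<Sum>i\<in>UNIV. hess i)"
  proof -
    define S where "S = (\<Sum>i\<in>UNIV. (w \<bullet> u i)\<^sup>2)"
    define U where "U = (\<Sum>i\<in>UNIV. u i \<bullet> u i)"
    define a where "a = (\<Sum>i\<in>UNIV. (w \<bullet> u i) *\<^sub>R u i)"
    have DTa: "DT z a = w" unfolding a_def by (rule u(3))
    have "S = w \<bullet> a" by (simp add: S_def a_def inner_sum_right power2_eq_square)
    then have S1: "l * (a \<bullet> a) \<le> S" using ell(1)[of a] DTa by simp
    have "(norm w)\<^sup>2 \<le> (b * norm a)\<^sup>2" using ell(2)[of a] DTa by (intro power_mono) auto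
    then have S2: "(norm w)\<^sup>2 \<le> b\<^sup>2 * (a \<bullet> a)" by (simp add: power_mult_distrib power2_norm_eq_inner)
    have "l * (norm w)\<^sup>2 \<le> l * (b\<^sup>2 * (a \<bullet> a))" using S2 l by (intro mult_left_mono) auto
    also have "\<dots> = b\<^sup>2 * (l * (a \<bullet> a))" by simp
    also have "\<dots> \<le> b\<^sup>2 * S" using S1 by (intro mult_left_mono) auto
    finally have S3: "l * (norm w)\<^sup>2 \<le> b\<^sup>2 * S" .
    have "l * U = (\<Sum>i\<in>UNIV. l * (u i \<bullet> u i))" by (simp add: U_def sum_distrib_left)
    also have "\<dots> \<le> (\<Sum>i\<in>(UNIV::'n set). 1)" using ell(1) u(1) by (intro sum_mono) metis
    finally have U1: "l * U \<le> ?n" by simp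
    have "b\<^sup>2 * (l * U) \<le> b\<^sup>2 * ?n" using U1 by (intro mult_left_mono) auto
    also have "\<dots> < 2 * \<alpha> * l * (l * (norm w)\<^sup>2)" using large by (simp add: w_def power2_eq_square mult_ac)
    also have "\<dots> \<le> 2 * \<alpha> * l * (b\<^sup>2 * S)" using S3 \<alpha> l by (intro mult_left_mono) auto
    finally have "(b\<^sup>2 * l) * U < (b\<^sup>2 * l) * (2 * \<alpha> * S)" by (simp add: mult_ac)
    then have "U < 2 * \<alpha> * S" using l by simp
    then have bar: "0 < 4 * \<alpha>\<^sup>2 * S - 2 * \<alpha> * U"
      using mult_strict_left_mono[of U "2 * \<alpha> * S" "2 * \<alpha>"] \<alpha> by (simp add: power2_eq_square mult_ac)
    have "(\<Sum>i\<in>UNIV. hess i) = ((\<Sum>i\<in>UNIV. DT (z + t *\<^sub>R e) (u i) \<bullet> u i) + (\<Sum>i\<in>UNIV. DT (z - t *\<^sub>R e) (u i) \<bullet> u i) - 2 * ?n) / t\<^sup>2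
        + \<epsilon> * (exp (- \<alpha> * (norm w)\<^sup>2) * (4 * \<alpha>\<^sup>2 * S - 2 * \<alpha> * U))"
      by (simp add: hess_def u(1) S_def U_def sum.distrib sum_subtractf sum_divide_distrib[symmetric] sum_distrib_left[symmetric])
    moreover have "0 \<le> ((\<Sum>i\<in>UNIV. DT (z + t *\<^sub>R e) (u i) \<bullet> u i) + (\<Sum>i\<in>UNIV. DT (z - t *\<^sub>R e) (u i) \<bullet> u i) - 2 * ?n) / t\<^sup>2"
      using u(2)[OF z(2)] u(2)[OF z(3)] by (intro divide_nonneg_nonneg) auto
    moreover have "0 < \<epsilon> * (exp (- \<alpha> * (norm w)\<^sup>2) * (4 * \<alpha>\<^sup>2 * S - 2 * \<alpha> * U))"
      using \<epsilon> bar by simp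
    ultimately show ?thesis by linarith
  qed
  moreover have "(\<Sum>i\<in>UNIV. hess i) \<le> 0" using nonpos by (intro sum_nonpos) auto
  ultimately show False by simp
qed


text \<open>Taylor's formula of order two for the even part of the potential on the line through \<open>y\<close>.\<close>

lemma second_difference_mean_value:
  assumes t: "t > 0" and nz: "\<And>s. \<bar>s\<bar> \<le> t \<Longrightarrow> y + s *\<^sub>R e \<noteq> 0"
  obtains s where "0 < s" "s < t"
    "(potential (y + t *\<^sub>R e) + potential (y - t *\<^sub>R e) - 2 * potential y) / t\<^sup>2 =
      (DT (y + s *\<^sub>R e) e \<bullet> e + DT (y - s *\<^sub>R e) e \<bullet> e) / 2"
proof -
  let ?f = "\<lambda>s. potential (y + s *\<^sub>R e) + potential (y + s *\<^sub>R (- e))"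
  let ?f1 = "\<lambda>s. T (y + s *\<^sub>R e) \<bullet> e + T (y + s *\<^sub>R (- e)) \<bullet> (- e)"
  let ?f2 = "\<lambda>s. DT (y + s *\<^sub>R e) e \<bullet> e + DT (y + s *\<^sub>R (- e)) (- e) \<bullet> (- e)"
  define diff where "diff m = (if m = 0 then ?f else if m = 1 then ?f1 else ?f2)" for m :: nat
  have nz': "y + s *\<^sub>R e \<noteq> 0" "y + s *\<^sub>R (- e) \<noteq> 0" if "0 \<le> s" "s \<le> t" for s
    using nz[of s] nz[of "- s"] that by auto
  have d: "(diff m has_real_derivative diff (Suc m) s) (at s)" if "m < 2" "0 \<le> s" "s \<le> t" for m s
  proof -
    have "m = 0 \<or> m = 1" using that by auto
    moreover have "(?f has_real_derivative ?f1 s) (at s)"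
      by (intro DERIV_add has_real_derivative_along_line has_derivative_potential nz' that)
    moreover have "(?f1 has_real_derivative ?f2 s) (at s)"
      by (intro DERIV_add has_real_derivative_inner_along_line T_deriv nz' that)
    ultimately show ?thesis by (auto simp: diff_def)
  qed
  have "\<exists>s>0. s < t \<and> ?f t = (\<Sum>m<2. diff m 0 / fact m * t ^ m) + diff 2 s / fact 2 * t ^ 2"
    by (rule Maclaurin[OF t]) (use d in \<open>auto simp: diff_def\<close>)
  then obtain s where s: "0 < s" "s < t" "?f t = (\<Sum>m<2. diff m 0 / fact m * t ^ m) + diff 2 s / fact 2 * t ^ 2" by blast
  have "(\<Sum>m<2. diff m 0 / fact m * t ^ m) = 2 * potential y"
    by (simp add: numeral_2_eq_2 diff_def)
  moreover have "diff 2 s = DT (y + s *\<^sub>R e) e \<bullet> e + DT (y - s *\<^sub>R e) e \<bullet> e"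
    using linear_neg[OF linear_DT[OF nz'(2)[of s]], of e] s by (simp add: diff_def)
  ultimately have eq: "potential (y + t *\<^sub>R e) + potential (y - t *\<^sub>R e) - 2 * potential y =
      (DT (y + s *\<^sub>R e) e \<bullet> e + DT (y - s *\<^sub>R e) e \<bullet> e) / 2 * t\<^sup>2"
    using s(3) by simp
  show ?thesis
    by (rule that[OF s(1,2)]) (use eq t in simp)
qed

lemma second_difference_close:
  assumes \<eta>: "\<eta> > 0" and \<rho>: "\<rho> > 0" and N: "\<And>y. y \<in> N \<Longrightarrow> \<rho> \<le> norm y" "bounded N"
  obtains t where "t > 0" "t * norm e < \<rho> / 2"
    "\<And>y. y \<in> N \<Longrightarrow> \<bar>(potential (y + t *\<^sub>R e) + potential (y - t *\<^sub>R e) - 2 * potential y) / t\<^sup>2 - DT y e \<bullet> e\<bar> < \<eta>"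
proof -
  obtain R where R: "\<And>y. y \<in> N \<Longrightarrow> norm y \<le> R" using N(2) by (auto simp: bounded_iff)
  let ?K = "cball 0 (R + \<rho>) - ball (0 :: real^'n) (\<rho> / 2)"
  have K: "compact ?K" by (intro compact_diff) auto
  have "continuous_on ?K (\<lambda>y. DT y e \<bullet> e)"
    by (rule continuous_on_subset[of "- {0}"]) (use \<rho> in \<open>auto intro!: continuous_intros DT_cont\<close>)
  then have "uniformly_continuous_on ?K (\<lambda>y. DT y e \<bullet> e)" using K by (rule compact_uniformly_continuous)
  then obtain \<delta> where \<delta>: "\<delta> > 0" "\<And>x y. x \<in> ?K \<Longrightarrow> y \<in> ?K \<Longrightarrow> dist y x < \<delta> \<Longrightarrow> dist (DT y e \<bullet> e) (DT x e \<bullet> e) < \<eta>"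
    unfolding uniformly_continuous_on_def using \<eta> by meson
  define m where "m = min \<delta> (\<rho> / 2)"
  have m: "m > 0" "m \<le> \<delta>" "m \<le> \<rho> / 2" using \<delta> \<rho> by (auto simp: m_def)
  define t where "t = m / (norm e + 1)"
  have t: "t > 0" using m by (simp add: t_def add_nonneg_pos)
  have te: "t * norm e < m"
  proof -
    have "t * norm e < t * (norm e + 1)" using t by simp
    also have "\<dots> = m" unfolding t_def using norm_ge_zero[of e] by (simp add: add_nonneg_eq_0_iff)
    finally show ?thesis .
  qed
  have small: "norm (s *\<^sub>R e) < m" if "\<bar>s\<bar> \<le> t" for s
  proof -
    have "norm (s *\<^sub>R e) \<le> t * norm e" using that by (simp add: mult_right_mono)
    then show ?thesis using te by simp
  qed
  show ?thesis
  proof (rule that[OF t])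
    show "t * norm e < \<rho> / 2" using te m by simp
    fix y assume y: "y \<in> N"
    have inK: "y + s *\<^sub>R e \<in> ?K" if "\<bar>s\<bar> \<le> t" for s
    proof -
      have "norm (y + s *\<^sub>R e) \<le> norm y + norm (s *\<^sub>R e)" by (rule norm_triangle_ineq)
      moreover have "norm y - norm (s *\<^sub>R e) \<le> norm (y + s *\<^sub>R e)" by (rule norm_diff_ineq)
      ultimately have "norm (y + s *\<^sub>R e) \<le> R + \<rho>" "\<not> norm (y + s *\<^sub>R e) < \<rho> / 2"
        using small[OF that] m N(1)[OF y] R[OF y] \<rho> by linarith+
      then show ?thesis by (simp only: Diff_iff mem_cball_0 mem_ball_0 simp_thms)
    qed
    have nz: "y + s *\<^sub>R e \<noteq> 0" if "\<bar>s\<bar> \<le> t" for s using inK[OF that] \<rho> by auto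
    obtain s where s: "0 < s" "s < t"
      "(potential (y + t *\<^sub>R e) + potential (y - t *\<^sub>R e) - 2 * potential y) / t\<^sup>2 =
      (DT (y + s *\<^sub>R e) e \<bullet> e + DT (y - s *\<^sub>R e) e \<bullet> e) / 2"
      by (rule second_difference_mean_value[OF t nz])
    have close: "dist (DT (y + s *\<^sub>R e) e \<bullet> e) (DT y e \<bullet> e) < \<eta>" if "\<bar>s\<bar> \<le> t" for s
      using \<delta>(2)[of y "y + s *\<^sub>R e"] inK[OF that] inK[of 0] t small[OF that] m by (simp add: dist_norm)
    from close[of s] close[of "- s"] s
    show "\<bar>(potential (y + t *\<^sub>R e) + potential (y - t *\<^sub>R e) - 2 * potential y) / t\<^sup>2 - DT y e \<bullet> e\<bar> < \<eta>"
      unfolding s(3) by (simp add: dist_real_def abs_less_iff field_simps)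
  qed
qed

text \<open>By connectedness of the punctured space \<open>Z\<close> has a point that is not interior. A point of \<open>Z\<close> nearest to a
  point outside close by is not the origin, and a ball of half the distance touches \<open>Z\<close> only there.\<close>

lemma touching_ball:
  fixes Z :: "(real^'n) set"
  assumes Z: "Z \<noteq> {}" "0 \<notin> Z" and cl: "open (- insert 0 Z)" and proper: "y1 \<noteq> 0" "y1 \<notin> Z"
  obtains x0 q r where "x0 \<in> Z" "r > 0" "norm (x0 - q) = r" "\<And>y. y \<in> Z \<Longrightarrow> norm (y - q) \<le> r \<Longrightarrow> y = x0"
proof -
  have "\<not> open Z"
  proof
    assume "open Z"
    have conn: "connected (- {0 :: real^'n})"
      using dim by (intro connected_punctured_universe) simp
    have "Z \<inter> - {0} = {} \<or> (- insert 0 Z) \<inter> - {0} = {}"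
      by (rule connectedD[OF conn \<open>open Z\<close> cl]) auto
    then show False using Z proper by auto
  qed
  then obtain z1 where z1: "z1 \<in> Z" "\<And>d. d > 0 \<Longrightarrow> \<not> ball z1 d \<subseteq> Z"
    by (auto simp: open_contains_ball)
  have z0: "norm z1 > 0" using z1(1) Z(2) by auto
  obtain q0 where q0: "dist z1 q0 < norm z1 / 4" "q0 \<notin> Z"
    using z1(2)[of "norm z1 / 4"] z0 by (auto simp: subset_iff)
  have "closed (insert 0 Z)" using cl by (simp add: closed_def)
  then obtain x0 where x0: "x0 \<in> insert 0 Z" "\<And>y. y \<in> insert 0 Z \<Longrightarrow> dist q0 x0 \<le> dist q0 y"
    using distance_attains_inf[of "insert 0 Z" q0] by blast
  have d1: "dist q0 x0 \<le> dist q0 z1" using x0(2) z1(1) by simp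
  have "x0 \<noteq> 0"
  proof
    assume "x0 = 0"
    then have "norm q0 < norm z1 / 4" using d1 q0(1) by (simp add: dist_commute)
    moreover have "norm z1 \<le> norm q0 + dist z1 q0" by (simp add: dist_norm norm_triangle_sub)
    ultimately show False using q0(1) z0 by simp
  qed
  then have x0Z: "x0 \<in> Z" using x0(1) by simp
  define q where "q = (1/2) *\<^sub>R (q0 + x0)"
  define v where "v = x0 - q"
  have q0q: "q0 = q - v" by (simp add: q_def v_def algebra_simps flip: scaleR_add_left)
  have "q0 \<noteq> x0" using q0(2) x0Z by auto
  then have v: "norm v > 0" using q0q by (auto simp: v_def)
  show ?thesis
  proof (rule that[OF x0Z v])
    show "norm (x0 - q) = norm v" by (simp add: v_def)
    fix y assume y: "y \<in> Z" "norm (y - q) \<le> norm v"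
    define a where "a = y - q"
    have "dist q0 x0 \<le> dist q0 y" using x0(2) y(1) by simp
    moreover have "q0 - x0 = - (2 *\<^sub>R v)" unfolding q0q by (simp add: v_def algebra_simps scaleR_2)
    moreover have "q0 - y = - (a + v)" unfolding q0q by (simp add: a_def)
    ultimately have "2 * norm v \<le> norm (a + v)" by (simp add: dist_norm norm_minus_cancel del: minus_add_distrib)
    then have "(2 * norm v)\<^sup>2 \<le> (norm (a + v))\<^sup>2" by (intro power_mono) auto
    then have "4 * (norm v)\<^sup>2 \<le> (norm (a + v))\<^sup>2" by (simp add: power_mult_distrib)
    moreover have "(norm (a + v))\<^sup>2 + (norm (a - v))\<^sup>2 = 2 * (norm a)\<^sup>2 + 2 * (norm v)\<^sup>2"
      by (simp add: power2_norm_eq_inner inner_add_left inner_add_right inner_diff_left inner_diff_right)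
    moreover have "(norm a)\<^sup>2 \<le> (norm v)\<^sup>2" using y(2) by (intro power_mono) (auto simp: a_def)
    ultimately have "(norm (a - v))\<^sup>2 \<le> 0" by linarith
    then have "a = v" by simp
    then show "y = x0" by (simp add: a_def v_def)
  qed
qed

text \<open>Hopf's argument for the strong maximum principle, carried out for second differences since the
  second derivative itself need not be differentiable.\<close>

lemma second_derivative_constant:
  assumes y1: "y1 \<noteq> 0" and y2: "y2 \<noteq> 0"
  shows "DT y1 e \<bullet> e = DT y2 e \<bullet> e"
proof -
  define v where "v y = DT y e \<bullet> e" for y
  have vc: "continuous_on (- {0}) v" unfolding v_def by (intro continuous_intros DT_cont)
  have vr: "v ((1 / body_gauge L y) *\<^sub>R y) = v y" if "y \<noteq> 0" for y
    using DT_scale[OF that, of "1 / body_gauge L y"] gauge_pos[OF that] by (simp add: v_def)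
  have fr: "frontier L \<noteq> {}" using radial_frontier[OF y1] by auto
  have "continuous_on (frontier L) v"
    by (rule continuous_on_subset[OF vc]) (use frontier_nonzero in auto)
  then obtain xm where xm: "xm \<in> frontier L" "\<And>x. x \<in> frontier L \<Longrightarrow> v x \<le> v xm"
    using continuous_attains_sup[OF compact_frontier fr] by blast
  define M where "M = v xm"
  have le: "v y \<le> M" if "y \<noteq> 0" for y
    using xm(2)[OF radial_frontier[OF that]] by (simp add: M_def vr[OF that])
  have "v y = M" if y0: "y \<noteq> 0" for y
  proof (rule ccontr)
    assume ne: "v y \<noteq> M"
    \<comment> \<open>The set where the maximum is attained. If it were not everything, some ball would touch it from
      outside at a point \<open>x0\<close>, and the Gaussian barrier centred at the centre of the ball leads to a contradiction.\<close>
    define Z where "Z = {y. y \<noteq> 0 \<and> v y = M}"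
    have Zopen: "open (- insert 0 Z)"
    proof -
      have "- insert 0 Z = - {0} \<inter> v -` {..<M}"
      proof (intro subset_antisym subsetI)
        fix x assume "x \<in> - insert 0 Z"
        then have "x \<noteq> 0" "v x \<noteq> M" by (auto simp: Z_def)
        then show "x \<in> - {0} \<inter> v -` {..<M}" using le[of x] by simp
      qed (auto simp: Z_def)
      then show ?thesis using continuous_open_preimage[OF vc, of "{..<M}"] by (simp add: open_Compl)
    qed
    have Zne: "Z \<noteq> {}" and Z0: "0 \<notin> Z" using xm(1) frontier_nonzero by (auto simp: Z_def M_def)
    have yZ: "y \<notin> Z" using ne by (simp add: Z_def)
    obtain x0 q r where x0: "x0 \<in> Z" and r: "r > 0" "norm (x0 - q) = r"
      and touch: "\<And>y. y \<in> Z \<Longrightarrow> norm (y - q) \<le> r \<Longrightarrow> y = x0"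
      by (rule touching_ball[OF Zne Z0 Zopen y0 yZ]) blast
    have x00: "norm x0 > 0" and vx0: "v x0 = M" using x0 by (auto simp: Z_def)
    define \<rho> where "\<rho> = min (r / 2) (norm x0 / 2)"
    have \<rho>: "\<rho> > 0" "\<rho> \<le> r / 2" "\<rho> \<le> norm x0 / 2" using r(1) x00 by (auto simp: \<rho>_def)
    define N where "N = cball x0 \<rho>"
    have Nn: "norm x0 / 2 \<le> norm z" if "z \<in> N" for z
    proof -
      have "norm x0 \<le> norm z + dist x0 z" by (simp add: dist_norm norm_triangle_sub)
      then show ?thesis using that \<rho> by (simp add: N_def)
    qed
    have N0: "0 \<notin> N" using Nn[of 0] x00 by auto
    have Nc: "compact N" by (simp add: N_def)
    obtain l b where lb: "l > 0" "b > 0" "\<And>z x. z \<in> N \<Longrightarrow> l * (x \<bullet> x) \<le> DT z x \<bullet> x"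
      "\<And>z x. z \<in> N \<Longrightarrow> norm (DT z x) \<le> b * norm x"
      by (rule uniform_ellipticity[OF Nc N0]) blast
    \<comment> \<open>Points of \<open>N\<close> stay at distance at least \<open>r / 2\<close> from the centre of the barrier.\<close>
    have Nq: "r / 2 \<le> norm (z - q)" if "z \<in> N" for z
    proof -
      have "norm (x0 - q) \<le> norm (z - q) + norm (x0 - z)" using norm_triangle_ineq[of "z - q" "x0 - z"] by simp
      then show ?thesis using that r \<rho> by (simp add: N_def dist_norm)
    qed
    \<comment> \<open>Large enough for the barrier to be a strict subsolution on all of \<open>N\<close>.\<close>
    define \<alpha> where "\<alpha> = real CARD('n) * b\<^sup>2 / (l\<^sup>2 * (r / 2)\<^sup>2)"
    have \<alpha>: "\<alpha> > 0" using lb r by (simp add: \<alpha>_def)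
    have large: "real CARD('n) * b\<^sup>2 < 2 * \<alpha> * l\<^sup>2 * (norm (z - q))\<^sup>2" if "z \<in> N" for z
    proof -
      have pos: "real CARD('n) * b\<^sup>2 > 0" using lb by simp
      have "real CARD('n) * b\<^sup>2 = \<alpha> * l\<^sup>2 * (r / 2)\<^sup>2" using lb r by (simp add: \<alpha>_def)
      also have "\<dots> \<le> \<alpha> * l\<^sup>2 * (norm (z - q))\<^sup>2"
        using Nq[OF that] r \<alpha> by (intro mult_left_mono power_mono) auto
      finally show ?thesis using pos by simp
    qed
    define bar where "bar z = exp (- \<alpha> * (norm (z - q))\<^sup>2) - exp (- \<alpha> * r\<^sup>2)" for z
    have bar_x0: "bar x0 = 0" using r by (simp add: bar_def)
    have bar_le: "bar z \<le> 1" for z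
    proof -
      have "exp (- \<alpha> * (norm (z - q))\<^sup>2) \<le> 1" using \<alpha> by simp
      moreover have "exp (- \<alpha> * r\<^sup>2) > 0" by simp
      ultimately show ?thesis unfolding bar_def by linarith
    qed
    have bar_neg: "bar z < 0" if "norm (z - q) > r" for z
    proof -
      have "r\<^sup>2 < (norm (z - q))\<^sup>2" using that r by (intro power_strict_mono) auto
      then show ?thesis using \<alpha> by (simp add: bar_def)
    qed
    have vN: "continuous_on N v" by (rule continuous_on_subset[OF vc]) (use N0 in auto)
    have barc: "continuous_on S bar" for S unfolding bar_def by (intro continuous_intros)
    have SN: "sphere x0 \<rho> \<subseteq> N" by (auto simp: N_def)
    \<comment> \<open>Outside the touching ball the barrier is negative; inside, \<open>v\<close> stays below its maximum by compactness.\<close>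
    obtain \<epsilon> where \<epsilon>: "\<epsilon> > 0" "\<And>z. z \<in> sphere x0 \<rho> \<Longrightarrow> v z + \<epsilon> * bar z < M"
    proof -
      define K where "K = sphere x0 \<rho> \<inter> cball q r"
      have KM: "v z < M" if "z \<in> K" for z
      proof -
        have "z \<in> N" using that SN by (auto simp: K_def)
        then have z0: "z \<noteq> 0" using N0 by metis
        have "z \<noteq> x0" "norm (z - q) \<le> r" using that \<rho>(1) by (auto simp: K_def dist_norm norm_minus_commute)
        then have "v z \<noteq> M" using touch[of z] z0 by (auto simp: Z_def)
        then show ?thesis using le[OF z0] by simp
      qed
      obtain m where m: "m < M" "\<And>z. z \<in> K \<Longrightarrow> v z \<le> m"
      proof (cases "K = {}")
        case True
        then show ?thesis using that[of "M - 1"] by simp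
      next
        case False
        have "compact K" "continuous_on K v"
          using SN by (auto simp: K_def intro!: compact_Int continuous_on_subset[OF vN])
        then obtain k where "k \<in> K" "\<And>z. z \<in> K \<Longrightarrow> v z \<le> v k"
          using continuous_attains_sup[of K v] False by blast
        then show ?thesis using that[of "v k"] KM by simp
      qed
      have "v z + (M - m) / 2 * bar z < M" if z: "z \<in> sphere x0 \<rho>" for z
      proof (cases "norm (z - q) \<le> r")
        case True
        then have "v z \<le> m" using z by (intro m(2)) (simp add: K_def dist_norm norm_minus_commute)
        moreover have "(M - m) / 2 * bar z \<le> (M - m) / 2 * 1" using m(1) bar_le[of z] by (intro mult_left_mono) auto
        ultimately show ?thesis using m(1) by (simp add: field_simps)
      next
        case False
        then have "(M - m) / 2 * bar z < 0" using bar_neg[of z] m(1) by (intro mult_pos_neg) auto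
        moreover have "v z \<le> M"
        proof (rule le)
          show "z \<noteq> 0" using subsetD[OF SN z] N0 by metis
        qed
        ultimately show ?thesis by simp
      qed
      then show ?thesis using that[of "(M - m) / 2"] m(1) by simp
    qed
    have sne: "sphere x0 \<rho> \<noteq> {}" using \<rho>(1) by simp
    have "continuous_on (sphere x0 \<rho>) (\<lambda>z. v z + \<epsilon> * bar z)"
      by (intro continuous_intros continuous_on_subset[OF vN SN] barc)
    then obtain zm where zm: "zm \<in> sphere x0 \<rho>" "\<And>z. z \<in> sphere x0 \<rho> \<Longrightarrow> v z + \<epsilon> * bar z \<le> v zm + \<epsilon> * bar zm"
      using continuous_attains_sup[OF compact_sphere sne] by blast
    \<comment> \<open>Second differences within \<open>\<eta>\<close> of \<open>v\<close> still exceed at \<open>x0\<close> all values on the sphere, so that they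
      attain their maximum in the interior of \<open>N\<close>.\<close>
    define \<eta> where "\<eta> = (M - (v zm + \<epsilon> * bar zm)) / 2"
    have \<eta>: "\<eta> > 0" using \<epsilon>(2)[OF zm(1)] by (simp add: \<eta>_def)
    have sph: "v z + \<epsilon> * bar z \<le> M - 2 * \<eta>" if "z \<in> sphere x0 \<rho>" for z
      using zm(2)[OF that] by (simp add: \<eta>_def field_simps)
    have x02: "norm x0 / 2 > 0" using x00 by simp
    have Nb: "bounded N" by (simp add: N_def)
    obtain t where t: "t > 0" "t * norm e < norm x0 / 2 / 2"
      "\<And>z. z \<in> N \<Longrightarrow> \<bar>(potential (z + t *\<^sub>R e) + potential (z - t *\<^sub>R e) - 2 * potential z) / t\<^sup>2 - DT z e \<bullet> e\<bar> < \<eta>"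
    proof (rule second_difference_close[OF \<eta> x02 Nn Nb, where e = e])
      fix t assume "t > 0" "t * norm e < norm x0 / 2 / 2"
        "\<And>z. z \<in> N \<Longrightarrow> \<bar>(potential (z + t *\<^sub>R e) + potential (z - t *\<^sub>R e) - 2 * potential z) / t\<^sup>2 - DT z e \<bullet> e\<bar> < \<eta>"
      then show ?thesis by (rule that)
    qed
    define vt where "vt z = (potential (z + t *\<^sub>R e) + potential (z - t *\<^sub>R e) - 2 * potential z) / t\<^sup>2" for z
    have vt: "\<bar>vt z - v z\<bar> < \<eta>" if "z \<in> N" for z using t(3)[OF that] by (simp add: vt_def v_def)
    have off: "z + t *\<^sub>R e \<noteq> 0" "z - t *\<^sub>R e \<noteq> 0" if "z \<in> N" for z
    proof -
      have "t * norm e < norm z" using Nn[OF that] t(2) x00 by linarith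
      then have n: "norm (t *\<^sub>R e) < norm z" using t(1) by simp
      show "z + t *\<^sub>R e \<noteq> 0" using n by (metis add_eq_0_iff less_irrefl norm_minus_cancel)
      show "z - t *\<^sub>R e \<noteq> 0" using n by auto
    qed
    have potc: "continuous_on UNIV potential"
      unfolding potential_def[abs_def] by (intro continuous_intros continuous_on_gauge) simp
    have "continuous_on N (\<lambda>z. vt z + \<epsilon> * bar z)"
      unfolding vt_def using t(1)
      by (intro continuous_intros barc continuous_on_compose2[OF potc]) auto
    moreover have "N \<noteq> {}" using \<rho>(1) by (simp add: N_def)
    ultimately obtain z where z: "z \<in> N" "\<And>y. y \<in> N \<Longrightarrow> vt y + \<epsilon> * bar y \<le> vt z + \<epsilon> * bar z"
      using continuous_attains_sup[OF Nc] by blast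
    have x0N: "x0 \<in> N" using \<rho>(1) by (simp add: N_def)
    have "z \<notin> sphere x0 \<rho>"
    proof
      assume zs: "z \<in> sphere x0 \<rho>"
      have "vt x0 + \<epsilon> * bar x0 \<le> vt z + \<epsilon> * bar z" by (rule z(2)[OF x0N])
      moreover have "vt x0 > M - \<eta>" using vt[OF x0N] vx0 by simp
      moreover have "vt z < v z + \<eta>" using vt[OF z(1)] by simp
      ultimately show False using sph[OF zs] bar_x0 by simp
    qed
    then have zb: "dist x0 z < \<rho>" using z(1) by (simp add: N_def order_less_le)
    have inN: "y \<in> N" if "dist y z < \<rho> - dist x0 z" for y
    proof -
      have "dist x0 y \<le> dist x0 z + dist y z" by (metis dist_commute dist_triangle)
      then show ?thesis using that by (simp add: N_def)
    qed
    show False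
    proof (rule no_interior_maximum)
      show "\<rho> - dist x0 z > 0" using zb by simp
      show "y \<noteq> 0 \<and> y + t *\<^sub>R e \<noteq> 0 \<and> y - t *\<^sub>R e \<noteq> 0" if "dist y z < \<rho> - dist x0 z" for y
        using off[OF inN[OF that]] inN[OF that] N0 by auto
      show "real CARD('n) * b\<^sup>2 < 2 * \<alpha> * l\<^sup>2 * (norm (z - q))\<^sup>2" by (rule large[OF z(1)])
      show "(potential (y + t *\<^sub>R e) + potential (y - t *\<^sub>R e) - 2 * potential y) / t\<^sup>2 + \<epsilon> * (exp (- \<alpha> * (norm (y - q))\<^sup>2) - exp (- \<alpha> * r\<^sup>2))
       \<le> (potential (z + t *\<^sub>R e) + potential (z - t *\<^sub>R e) - 2 * potential z) / t\<^sup>2 + \<epsilon> * (exp (- \<alpha> * (norm (z - q))\<^sup>2) - exp (- \<alpha> * r\<^sup>2))"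
        if "dist y z < \<rho> - dist x0 z" for y
        using z(2)[OF inN[OF that]] by (simp only: vt_def bar_def)
    qed (use t \<epsilon> \<alpha> lb z(1) in auto)
  qed
  then show ?thesis using y1 y2 by (simp add: v_def)
qed

text \<open>The second derivative of \<open>potential\<close> is a constant positive form, which a linear map \<open>E\<close> turns into the
  Euclidean one. By Euler's relation the gauge becomes the Euclidean norm.\<close>

theorem centered_ellipsoid_if_constant_curvature: "centered_ellipsoid L"
proof -
  fix k :: 'n
  define a :: "real^'n" where "a = axis k 1"
  have a: "a \<noteq> 0" by (simp add: a_def axis_eq_0_iff)
  have DT_eq: "DT y = DT a" if y: "y \<noteq> 0" for y
  proof
    fix v
    have "DT y v \<bullet> w = DT a v \<bullet> w" for w
    proof -
      have polar: "DT z (v + w) \<bullet> (v + w) = DT z v \<bullet> v + 2 * (DT z v \<bullet> w) + DT z w \<bullet> w" if "z \<noteq> 0" for z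
        using DT_symmetric[OF that, of v w] by (simp add: linear_add[OF linear_DT[OF that]] inner_add_left inner_add_right)
      have "DT y (v + w) \<bullet> (v + w) = DT a (v + w) \<bullet> (v + w)" "DT y v \<bullet> v = DT a v \<bullet> v" "DT y w \<bullet> w = DT a w \<bullet> w"
        by (rule second_derivative_constant[OF y a])+
      then show ?thesis unfolding polar[OF y] polar[OF a] by simp
    qed
    then show "DT y v = DT a v" by (metis vector_eq_ldot inner_commute)
  qed
  obtain E :: "real^'n^'n" where E: "transpose E ** matrix (DT a) ** E = mat 1"
    by (rule posdef_congruent_identity[OF matrix_DT(2,3)[OF a] less_imp_neq[OF det_pos[OF a], symmetric]])
  have invE: "invertible E"
    using E unfolding invertible_left_inverse by blast
  have gauge_E: "(body_gauge L (E *v x))\<^sup>2 = (norm x)\<^sup>2" for x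
  proof (cases "E *v x = 0")
    case True
    have "x \<bullet> ((transpose E ** matrix (DT a) ** E) *v x) = 0"
      unfolding inner_congruence True by simp
    then have "x = 0" unfolding E by simp
    then show ?thesis using True by simp
  next
    case False
    have "(body_gauge L (E *v x))\<^sup>2 = (E *v x) \<bullet> T (E *v x)" using T_inner[OF False] by simp
    also have "T (E *v x) = DT a (E *v x)" using DT_radial[OF False] DT_eq[OF False] by simp
    also have "\<dots> = matrix (DT a) *v (E *v x)" by (simp only: matrix_DT(1)[OF a])
    also have "(E *v x) \<bullet> \<dots> = x \<bullet> ((transpose E ** matrix (DT a) ** E) *v x)"
      by (rule inner_congruence[symmetric])
    also have "\<dots> = (norm x)\<^sup>2" unfolding E by (simp add: power2_norm_eq_inner)
    finally show ?thesis .
  qed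
  have gE: "body_gauge L (E *v x) = norm x" for x
    using gauge_E[of x] gauge_nonneg by (simp add: power2_eq_iff_nonneg)
  have "L = (\<lambda>x. E *v x) ` cball 0 1"
  proof (intro subset_antisym subsetI)
    fix y assume y: "y \<in> L"
    obtain E' where E': "E ** E' = mat 1" using invE by (auto simp: invertible_def)
    have Ey: "E *v (E' *v y) = y" by (simp only: matrix_vector_mul_assoc E' matrix_vector_mul_lid)
    have "body_gauge L y \<le> 1" using y by (simp add: gauge_le_1_iff)
    then have "norm (E' *v y) \<le> 1" using gE[of "E' *v y"] unfolding Ey by simp
    then show "y \<in> (\<lambda>x. E *v x) ` cball 0 1" using Ey by (intro image_eqI[of _ _ "E' *v y"]) auto
  next
    fix y assume "y \<in> (\<lambda>x. E *v x) ` cball 0 1"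
    then show "y \<in> L" using gE by (auto simp flip: gauge_le_1_iff)
  qed
  then show ?thesis unfolding centered_ellipsoid_def using invE by blast
qed

end

text \<open>For the image of the ball under \<open>A\<close> the gradient map is linear, with matrix the inverse of
  \<open>A ** transpose A\<close>.\<close>

lemma (in positive_body) curvature_constant_if_ellipsoid:
  assumes "centered_ellipsoid L"
  shows "\<exists>c. \<forall>y. y \<noteq> 0 \<longrightarrow> det (matrix (DT y)) = c"
proof -
  obtain A :: "real^'n^'n" where A: "invertible A" "L = (\<lambda>x. A *v x) ` cball 0 1"
    using assms unfolding centered_ellipsoid_def by blast
  obtain A' where A': "A ** A' = mat 1" "A' ** A = mat 1" using A(1) by (auto simp: invertible_def)
  define S where "S = transpose A' ** A'"
  have SA: "(A *v z) \<bullet> (S *v (A *v x)) = z \<bullet> x" for z x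
  proof -
    have "(A *v z) \<bullet> (S *v (A *v x)) = (A' *v (A *v z)) \<bullet> (A' *v (A *v x))"
      unfolding S_def by (metis dot_lmul_matrix matrix_vector_mul_assoc transpose_matrix_vector transpose_transpose)
    then show ?thesis by (simp only: matrix_vector_mul_assoc A' matrix_vector_mul_lid)
  qed
  have TS: "T x = S *v x" if x: "x \<in> frontier L" for x
  proof -
    obtain \<xi> where \<xi>: "x = A *v \<xi>" "norm \<xi> \<le> 1" using x frontier_subset A(2) by auto
    have "S *v x \<in> polar_body L"
      unfolding polar_body_def
    proof safe
      fix y assume "y \<in> L"
      then obtain \<zeta> where "y = A *v \<zeta>" "norm \<zeta> \<le> 1" using A(2) by auto
      then have "y \<bullet> (S *v x) = \<zeta> \<bullet> \<xi>" by (simp add: \<xi> SA)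
      also have "\<dots> \<le> norm \<zeta> * norm \<xi>" by (rule norm_cauchy_schwarz)
      also have "\<dots> \<le> 1" using \<open>norm \<zeta> \<le> 1\<close> \<xi>(2) by (simp add: mult_le_one)
      finally show "y \<bullet> (S *v x) \<le> 1" .
    qed
    moreover have "norm \<xi> = 1"
    proof (rule ccontr)
      assume "norm \<xi> \<noteq> 1"
      then have lt: "norm \<xi> < 1" using \<xi>(2) by simp
      have "\<xi> \<noteq> 0" using \<xi>(1) frontier_nonzero[OF x] by auto
      then have "A *v ((1 / norm \<xi>) *\<^sub>R \<xi>) \<in> L" unfolding A(2) by (intro imageI) simp
      then have "(1 / norm \<xi>) *\<^sub>R x \<in> L" by (simp add: \<xi>(1) matrix_vector_mult_scaleR)
      then have "(1 / norm \<xi>) * body_gauge L x \<le> 1" by (simp add: gauge_scale flip: gauge_le_1_iff)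
      then show False using x lt \<open>\<xi> \<noteq> 0\<close> by (simp add: frontier_eq)
    qed
    then have "x \<bullet> (S *v x) = 1" unfolding \<xi>(1) SA by (simp add: dot_square_norm)
    ultimately show ?thesis using T_unique[OF x] by metis
  qed
  have TS': "T y = S *v y" if y: "y \<noteq> 0" for y
  proof -
    have t: "1 / body_gauge L y > 0" using gauge_pos[OF y] by simp
    have "(1 / body_gauge L y) *\<^sub>R T y = (1 / body_gauge L y) *\<^sub>R (S *v y)"
      using TS[OF radial_frontier[OF y]] T_scale[OF y t] by (simp add: matrix_vector_mult_scaleR)
    then show ?thesis using t by (metis less_irrefl scaleR_cancel_left)
  qed
  have "DT y = (*v) S" if y: "y \<noteq> 0" for y
  proof (rule has_derivative_unique[OF T_deriv[OF y]])
    have "((*v) S has_derivative (*v) S) (at y)"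
      by (rule bounded_linear_imp_has_derivative[OF matrix_vector_mul_bounded_linear])
    then show "(T has_derivative (*v) S) (at y)"
      by (rule has_derivative_transform_within_open[of _ _ _ _ "- {0}"]) (use y TS' in \<open>auto simp: open_Compl\<close>)
  qed
  then show ?thesis by auto
qed

section \<open>Moments of the centro-affine curvature and the affine isoperimetric inequalities\<close>

context positive_body
begin

definition curv_moment :: "real \<Rightarrow> real" where
  "curv_moment s = integral (L - {0}) (\<lambda>y. curv y powr s)"

text \<open>By continuity \<open>F\<close> vanishes at the interior points of the body, and by homogeneity everywhere.\<close>

lemma zero_if_integral_nonpos:
  fixes F :: "real^'n \<Rightarrow> real"
  assumes cont: "continuous_on (- {0}) F" and int: "F integrable_on (L - {0})"
    and nonneg: "\<And>y. y \<noteq> 0 \<Longrightarrow> 0 \<le> F y" and hom: "\<And>y t. y \<noteq> 0 \<Longrightarrow> t > 0 \<Longrightarrow> F (t *\<^sub>R y) = F y"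
    and le: "integral (L - {0}) F \<le> 0" and y: "y \<noteq> 0"
  shows "F y = 0"
proof -
  let ?x = "(1 / (2 * body_gauge L y)) *\<^sub>R y"
  have g: "body_gauge L y > 0" by (rule gauge_pos[OF y])
  have "body_gauge L ?x < 1" using g by (simp add: gauge_scale)
  then have x: "?x \<in> interior L - {0}" using y g by (simp add: interior_eq)
  have "open (interior L - {0})" by (intro open_delete open_interior)
  then obtain a b where ab: "cbox a b \<subseteq> interior L - {0}" "?x \<in> box a b"
    using open_contains_cbox x by metis
  have sub: "cbox a b \<subseteq> L - {0}" using ab(1) interior_subset by blast
  have cont': "continuous_on (cbox a b) F" by (rule continuous_on_subset[OF cont]) (use sub in auto)
  have inta: "F integrable_on cbox a b" by (rule integrable_continuous[OF cont'])
  have "integral (cbox a b) F \<le> integral (L - {0}) F"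
    by (rule integral_subset_le[OF sub inta int]) (use nonneg in auto)
  moreover have "0 \<le> integral (cbox a b) F"
    by (rule integral_nonneg[OF inta]) (use sub nonneg in auto)
  ultimately have "integral (cbox a b) F = 0" using le by simp
  then have "(F has_integral 0) (cbox a b)" using inta by (simp add: has_integral_iff)
  moreover have "0 \<le> F z" if "z \<in> box a b" for z
    using that sub box_subset_cbox[of a b] by (intro nonneg) auto
  moreover have "?x \<in> cbox a b" "box a b \<noteq> {}" using ab(2) box_subset_cbox by auto
  ultimately have "F ?x = 0"
    using has_integral_0_cbox_imp_0[OF cont'] by metis
  then show ?thesis using hom[OF y, of "1 / (2 * body_gauge L y)"] g by simp
qed

lemma curv_scale: "y \<noteq> 0 \<Longrightarrow> t > 0 \<Longrightarrow> curv (t *\<^sub>R y) = curv y"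
  by (simp add: DT_scale)

lemma curv_moment_pos: "curv_moment s > 0"
proof (rule ccontr)
  assume "\<not> curv_moment s > 0"
  then have le: "integral (L - {0}) (\<lambda>y. curv y powr s) \<le> 0" by (simp add: curv_moment_def)
  fix k :: 'n
  have a: "axis k (1::real) \<noteq> 0" by (simp add: axis_eq_0_iff)
  have "curv (axis k 1) powr s = 0"
    by (rule zero_if_integral_nonpos[OF curv_powr_continuous curv_powr_integrable_on _ _ le a]) (simp_all add: curv_scale)
  then show False using det_pos[OF a] by simp
qed

text \<open>Chebyshev's inequality for the similarly or oppositely ordered functions \<open>curv\<close> and \<open>curv powr a\<close>.
  Subtracting \<open>m\<close> and \<open>m powr a\<close>, where \<open>m\<close> is the mean of \<open>curv\<close>, gives their product a constant sign,
  and the integral of this product is the difference of the two sides up to a constant factor.\<close>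

lemma curv_moment_chebyshev:
  assumes a: "a \<noteq> 0"
  shows "sgn a * (curv_moment a * curv_moment 1) \<le> sgn a * (curv_moment 0 * curv_moment (1 + a))"
    and "sgn a * (curv_moment a * curv_moment 1) = sgn a * (curv_moment 0 * curv_moment (1 + a)) \<longleftrightarrow>
      (\<exists>c. \<forall>y. y \<noteq> 0 \<longrightarrow> curv y = c)"
proof -
  let ?I = curv_moment
  define m where "m = ?I 1 / ?I 0"
  have m: "m > 0" using curv_moment_pos by (simp add: m_def)
  define G where "G y = sgn a * ((curv y powr a - m powr a) * (curv y - m))" for y
  have G_expand: "G y = sgn a * (curv y powr (1 + a) - m * curv y powr a - m powr a * curv y powr 1 + (m powr a * m) * curv y powr 0)"
    if "y \<noteq> 0" for y
    using det_pos[OF that] by (simp add: G_def powr_add algebra_simps)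
  have hi: "((\<lambda>y. curv y powr s) has_integral ?I s) (L - {0})" for s
    unfolding curv_moment_def by (rule integrable_integral[OF curv_powr_integrable_on])
  have "((\<lambda>y. sgn a * (curv y powr (1 + a) - m * curv y powr a - m powr a * curv y powr 1 + (m powr a * m) * curv y powr 0)) has_integral
      sgn a * (?I (1 + a) - m * ?I a - m powr a * ?I 1 + (m powr a * m) * ?I 0)) (L - {0})"
    by (intro has_integral_mult_right has_integral_add has_integral_diff hi)
  then have "(G has_integral sgn a * (?I (1 + a) - m * ?I a - m powr a * ?I 1 + (m powr a * m) * ?I 0)) (L - {0})"
    by (rule has_integral_cong[THEN iffD1, rotated]) (simp add: G_expand)
  moreover have "m * ?I 0 = ?I 1" using curv_moment_pos[of 0] by (simp add: m_def)
  then have "?I (1 + a) - m * ?I a - m powr a * ?I 1 + (m powr a * m) * ?I 0 = ?I (1 + a) - m * ?I a"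
    by (simp add: mult.assoc)
  ultimately have G: "(G has_integral sgn a * (?I (1 + a) - m * ?I a)) (L - {0})" by simp
  have G_sign: "0 \<le> G y \<and> (G y = 0 \<longrightarrow> curv y = m)" if y: "y \<noteq> 0" for y
  proof -
    have k: "curv y > 0" by (rule det_pos[OF y])
    show ?thesis
    proof (cases "a > 0")
      case True
      consider "curv y < m" | "curv y = m" | "m < curv y" by linarith
      then show ?thesis
      proof cases
        case 1
        then have "curv y powr a < m powr a" using k True by (intro powr_less_mono2) auto
        then have "0 < (curv y powr a - m powr a) * (curv y - m)" using 1 by (intro mult_neg_neg) auto
        then have "0 < G y" using True by (simp only: G_def sgn_pos mult_1)
        then show ?thesis by simp
      next
        case 3
        then have "m powr a < curv y powr a" using m True by (intro powr_less_mono2) auto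
        then have "0 < (curv y powr a - m powr a) * (curv y - m)" using 3 by (intro mult_pos_pos) auto
        then have "0 < G y" using True by (simp only: G_def sgn_pos mult_1)
        then show ?thesis by simp
      qed (simp add: G_def)
    next
      case False
      then have neg: "a < 0" using a by simp
      consider "curv y < m" | "curv y = m" | "m < curv y" by linarith
      then show ?thesis
      proof cases
        case 1
        then have "m powr a < curv y powr a" using k neg by (intro powr_less_mono2_neg) auto
        then have "(curv y powr a - m powr a) * (curv y - m) < 0" using 1 by (intro mult_pos_neg) auto
        then have "0 < G y" using neg by (simp only: G_def sgn_neg mult_minus1 neg_0_less_iff_less)
        then show ?thesis by simp
      next
        case 3
        then have "curv y powr a < m powr a" using m neg by (intro powr_less_mono2_neg) auto
        then have "(curv y powr a - m powr a) * (curv y - m) < 0" using 3 by (intro mult_neg_pos) auto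
        then have "0 < G y" using neg by (simp only: G_def sgn_neg mult_minus1 neg_0_less_iff_less)
        then show ?thesis by simp
      qed (simp add: G_def)
    qed
  qed
  have diff: "sgn a * (?I 0 * ?I (1 + a)) - sgn a * (?I a * ?I 1) = ?I 0 * (sgn a * (?I (1 + a) - m * ?I a))"
    using curv_moment_pos[of 0] by (simp add: m_def field_simps)
  have nonneg: "0 \<le> sgn a * (?I (1 + a) - m * ?I a)"
    by (rule has_integral_nonneg[OF G]) (use G_sign in auto)
  then have "0 \<le> ?I 0 * (sgn a * (?I (1 + a) - m * ?I a))"
    by (rule mult_nonneg_nonneg[OF less_imp_le[OF curv_moment_pos]])
  then show "sgn a * (?I a * ?I 1) \<le> sgn a * (?I 0 * ?I (1 + a))" using diff by linarith
  show "sgn a * (?I a * ?I 1) = sgn a * (?I 0 * ?I (1 + a)) \<longleftrightarrow> (\<exists>c. \<forall>y. y \<noteq> 0 \<longrightarrow> curv y = c)"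
  proof
    assume "sgn a * (?I a * ?I 1) = sgn a * (?I 0 * ?I (1 + a))"
    then have "sgn a * (?I (1 + a) - m * ?I a) = 0"
      using diff curv_moment_pos[of 0] by (simp only: diff_self mult_eq_0_iff) simp
    then have le: "integral (L - {0}) G \<le> 0" and int: "G integrable_on (L - {0})"
      using G by (simp_all only: has_integral_iff order_refl)
    have cont: "continuous_on (- {0}) G"
      unfolding G_def by (intro continuous_intros curv_powr_continuous det_cont)
    have "G y = 0" if y: "y \<noteq> 0" for y
      by (rule zero_if_integral_nonpos[OF cont int _ _ le y]) (use G_sign in \<open>auto simp: G_def curv_scale\<close>)
    then have "\<forall>y. y \<noteq> 0 \<longrightarrow> curv y = m" using G_sign by blast
    then show "\<exists>c. \<forall>y. y \<noteq> 0 \<longrightarrow> curv y = c" by blast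
  next
    assume "\<exists>c. \<forall>y. y \<noteq> 0 \<longrightarrow> curv y = c"
    then obtain c where c: "\<And>y. y \<noteq> 0 \<Longrightarrow> curv y = c" by blast
    fix k :: 'n
    have "c > 0" using det_pos[of "axis k 1"] c[of "axis k 1"] by (simp add: axis_eq_0_iff)
    have I: "?I s = c powr s * ?I 0" for s
    proof -
      have "?I s = integral (L - {0}) (\<lambda>y. c powr s * curv y powr 0)"
        unfolding curv_moment_def by (rule integral_cong) (use c \<open>c > 0\<close> in auto)
      then show ?thesis by (simp add: curv_moment_def)
    qed
    have "?I a * ?I 1 = ?I 0 * ?I (1 + a)"
      unfolding I[of a] I[of 1] I[of "1 + a"] using \<open>c > 0\<close> by (simp add: powr_add)
    then show "sgn a * (?I a * ?I 1) = sgn a * (?I 0 * ?I (1 + a))" by simp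
  qed
qed

lemma curv_moment_ratio:
  assumes a: "a \<noteq> 0"
  shows "sgn a * (curv_moment a / curv_moment (1 + a)) \<le> sgn a * (curv_moment 0 / curv_moment 1)"
    and "sgn a * (curv_moment a / curv_moment (1 + a)) = sgn a * (curv_moment 0 / curv_moment 1) \<longleftrightarrow>
      (\<exists>c. \<forall>y. y \<noteq> 0 \<longrightarrow> curv y = c)"
proof -
  let ?I = curv_moment
  have p: "?I (1 + a) * ?I 1 > 0" using curv_moment_pos by simp
  have l: "sgn a * (?I a / ?I (1 + a)) = sgn a * (?I a * ?I 1) / (?I (1 + a) * ?I 1)"
    using curv_moment_pos[of 1] by simp
  have r: "sgn a * (?I 0 / ?I 1) = sgn a * (?I 0 * ?I (1 + a)) / (?I (1 + a) * ?I 1)"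
    using curv_moment_pos[of "1 + a"] by simp
  show "sgn a * (?I a / ?I (1 + a)) \<le> sgn a * (?I 0 / ?I 1)"
    unfolding l r using curv_moment_chebyshev(1)[OF a] p by (intro divide_right_mono) auto
  have "x / d = y / d \<longleftrightarrow> x = y" if "d > 0" for x y d :: real using that by simp
  from this[OF p] show "sgn a * (?I a / ?I (1 + a)) = sgn a * (?I 0 / ?I 1) \<longleftrightarrow> (\<exists>c. \<forall>y. y \<noteq> 0 \<longrightarrow> curv y = c)"
    unfolding l r by (simp only: curv_moment_chebyshev(2)[OF a])
qed

text \<open>The companion index has the exponent \<open>- a\<close>. For \<open>n + 2 * p = 0\<close> one has \<open>a = - 1\<close>, and the
  convention for the infinite index fits the pattern since the volumes are the moments of order zero and one.\<close>

lemma affine_surface_areas: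
  fixes p :: real
  defines "n \<equiv> real CARD('n)"
  defines "a \<equiv> p / (n + p)" and "q \<equiv> companion_index n p"
  assumes p: "p \<noteq> - n"
  shows "affine_surface_area (ereal p) L = n * curv_moment a"
    "affine_surface_area (ereal p) (polar_body L) = n * curv_moment (1 - a)"
    "affine_surface_area q L = n * curv_moment (- a)"
    "affine_surface_area q (polar_body L) = n * curv_moment (1 + a)"
    "measure lebesgue L = curv_moment 0"
    "measure lebesgue (polar_body L) = curv_moment 1"
proof -
  interpret pol: positive_body "polar_body L" T_inverse DT_inverse by (rule polar_positive_body)
  have n: "n > 0" by (simp add: n_def)
  have polI: "integral (polar_body L - {0}) (\<lambda>w. det (matrix (DT_inverse w)) powr s) = curv_moment (1 - s)" for s
    by (simp add: integral_polar_curv_powr curv_moment_def)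
  have np: "n + p \<noteq> 0" using p by linarith
  show "affine_surface_area (ereal p) L = n * curv_moment a"
    unfolding affine_surface_area_eq_integral curv_moment_def n_def a_def ..
  show "affine_surface_area (ereal p) (polar_body L) = n * curv_moment (1 - a)"
    unfolding pol.affine_surface_area_eq_integral polI n_def a_def ..
  show vol: "measure lebesgue L = curv_moment 0"
    by (simp add: measure_eq_integral curv_moment_def)
  show volp: "measure lebesgue (polar_body L) = curv_moment 1"
    using polI[of 0] by (simp add: pol.measure_eq_integral)
  show "affine_surface_area q L = n * curv_moment (- a)" "affine_surface_area q (polar_body L) = n * curv_moment (1 + a)"
  proof -
    consider "n + 2 * p = 0" | "n + 2 * p \<noteq> 0" by blast
    then have "affine_surface_area q L = n * curv_moment (- a) \<and> affine_surface_area q (polar_body L) = n * curv_moment (1 + a)"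
    proof cases
      case 1
      then have "p = - n / 2" by simp
      then have "a = - 1" using n by (simp add: a_def)
      moreover have "q = \<infinity>" using 1 by (simp add: q_def companion_index_def)
      ultimately show ?thesis
        by (simp add: affine_surface_area_def polar_polar vol volp n_def)
    next
      case 2
      define r where "r = - (n * p) / (n + 2 * p)"
      have q: "q = ereal r" using 2 by (simp add: q_def companion_index_def r_def)
      have "n + r = n * (n + p) / (n + 2 * p)" using 2 by (simp add: r_def field_simps)
      then have "r / (n + r) = (- (n * p) / (n + 2 * p)) / (n * (n + p) / (n + 2 * p))" by (simp only: r_def)
      also have "\<dots> = - (n * p) / (n * (n + p))" using 2 by simp
      also have "\<dots> = - a" using n by (simp add: a_def)
      finally have r: "r / (n + r) = - a" .
      show ?thesis
        unfolding q affine_surface_area_eq_integral pol.affine_surface_area_eq_integral polI n_def[symmetric] r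
        by (simp add: curv_moment_def)
    qed
    then show "affine_surface_area q L = n * curv_moment (- a)" "affine_surface_area q (polar_body L) = n * curv_moment (1 + a)" by auto
  qed
qed

end

theorem theorem3p1:
  fixes K :: "(real^'n) set" and p :: real
  assumes "CARD('n) \<ge> 2"
    and "convex_body K"
    and "C2_boundary K"
    and "\<forall>x\<in>frontier K. gauss_curvature K x > 0"
    and "0 \<in> interior K"
    and "p \<noteq> 0" and "p \<noteq> - real CARD('n)"
  shows
    "let n = real CARD('n);
         SGN = sgn (p / (n + p));
         q = companion_index n p;
         lower = SGN * (affine_surface_area (ereal p) K / affine_surface_area q (polar_body K));
         middle = SGN * (measure lebesgue K / measure lebesgue (polar_body K));
         upper = SGN * (affine_surface_area q K / affine_surface_area (ereal p) (polar_body K))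
     in lower \<le> middle \<and> middle \<le> upper \<and>
        (lower = middle \<longleftrightarrow> centered_ellipsoid K) \<and>
        (middle = upper \<longleftrightarrow> centered_ellipsoid K)"
proof -
  interpret C2_body K using assms by unfold_locales auto
  interpret positive_body K gradient_map hessian
    by (rule positive_body) (use assms(4) in auto)
  let ?n = "real CARD('n)"
  define a where "a = p / (?n + p)"
  have a: "a \<noteq> 0" using assms(6,7) by (simp add: a_def add_eq_0_iff2)
  have ellipsoid: "(\<exists>c. \<forall>y. y \<noteq> 0 \<longrightarrow> curv y = c) \<longleftrightarrow> centered_ellipsoid K"
  proof
    assume "\<exists>c. \<forall>y. y \<noteq> 0 \<longrightarrow> curv y = c"
    then obtain c where c: "\<And>y. y \<noteq> 0 \<Longrightarrow> curv y = c" by blast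
    interpret constant_curvature_body K gradient_map hessian c
      by unfold_locales (use hessian_continuous c in auto)
    show "centered_ellipsoid K" by (rule centered_ellipsoid_if_constant_curvature)
  qed (rule curvature_constant_if_ellipsoid)
  let ?I = curv_moment
  note areas = affine_surface_areas[OF assms(7), folded a_def]
  have lower: "sgn a * (affine_surface_area (ereal p) K / affine_surface_area (companion_index ?n p) (polar_body K)) =
      sgn a * (?I a / ?I (1 + a))"
    unfolding areas by simp
  have middle: "sgn a * (measure lebesgue K / measure lebesgue (polar_body K)) = sgn a * (?I 0 / ?I 1)"
    unfolding areas ..
  \<comment> \<open>The right inequality is the left one with \<open>a\<close> replaced by \<open>- a\<close> and the sign reversed.\<close>
  have upper: "sgn a * (affine_surface_area (companion_index ?n p) K / affine_surface_area (ereal p) (polar_body K)) =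
      - (sgn (- a) * (?I (- a) / ?I (1 + - a)))"
    unfolding areas by (simp add: sgn_minus)
  have middle': "sgn a * (?I 0 / ?I 1) = - (sgn (- a) * (?I 0 / ?I 1))"
    by (simp add: sgn_minus)
  have na: "- a \<noteq> 0" using a by simp
  have combine: "x \<le> y \<and> y \<le> - z \<and> (x = y \<longleftrightarrow> E) \<and> (y = - z \<longleftrightarrow> E)"
    if "x \<le> y" "x = y \<longleftrightarrow> E" "z \<le> y'" "z = y' \<longleftrightarrow> E" "y = - y'" for x y y' z :: real and E
    using that by auto
  show ?thesis
    unfolding Let_def a_def[symmetric] lower middle upper ellipsoid[symmetric]
    by (rule combine[OF curv_moment_ratio[OF a] curv_moment_ratio[OF na] middle'])
qed

end
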